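(* Let $n \in \mathbb{N}$, $n\ge 1$, and let $1 \le m \le \binom{n+1}{2}$. Then there exists a Zariski-closed proper subset $E \subset \mathrm{Gr}(m,\mathcal{S}^n)$ such that if $L \in \mathrm{Gr}(m,\mathcal{S}^n)$ is not in $E$ and $L \cap \mathcal{S}^n_{++} \neq \emptyset$, then the maximum likelihood threshold $\mathrm{MLT}(L)$ of $L$ is the minimum $d$ such that \[ m \le nd-\binom{d}{2}. \]
   Context: $\mathcal{S}^n$ is the vector space of real symmetric $n\times n$ matrices, $\mathcal{S}^n_+$ the cone of positive semidefinite (PSD) matrices, and $\mathcal{S}^n_{++}$ the open cone of positive definite matrices. $\mathrm{Gr}(m,\mathcal{S}^n)$ is the Grassmannian of $m$-dimensional linear subspaces of $\mathcal{S}^n$, regarded as a real projective variety via Plücker coordinates; Zariski-closed subsets are zero loci of polynomials in the Plücker coordinates. For a linear subspace $L\subseteq\mathcal{S}^n$ with $L\cap \mathcal{S}^n_{++}\ne\emptyset$ and $S\in\mathcal{S}^n_+$, consider the optimization problem: minimize $\mathrm{Tr}(SK)-\log\det K$ subject to $K\in L\cap\mathcal{S}^n_{++}$. The maximum likelihood threshold $\mathrm{MLT}(L)$ is the minimum $d$ such that this problem has a solution (the minimum is attained) for all generic $S\in\mathcal{S}^n_+$ of rank $d$, i.e. for all $S$ in some nonempty Zariski-open subset of the set of PSD matrices of rank exactly $d$ (with the Zariski topology induced from $\mathcal{S}^n$). Here $d$ denotes a nonnegative integer with $d \le n$. *)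

theory Defs
  imports "HOL-Analysis.Analysis"
begin

definition sym_mats :: "(real^'n^'n) set" where
  "sym_mats = {A. transpose A = A}"

definition psd_mats :: "(real^'n^'n) set" where
  "psd_mats = {A \<in> sym_mats. \<forall>x. 0 \<le> x \<bullet> (A *v x)}"

definition pd_mats :: "(real^'n^'n) set" where
  "pd_mats = {A \<in> sym_mats. \<forall>x. x \<noteq> 0 \<longrightarrow> 0 < x \<bullet> (A *v x)}"

definition psd_mats_of_rank :: "nat \<Rightarrow> (real^'n^'n) set" where
  "psd_mats_of_rank d = {S \<in> psd_mats. rank S = d}"

(* Polynomials on a Euclidean space are the library's real_polynomial_function; on
   real^'i and real^'n^'n these are exactly the polynomials in the entries. *)
definition zariski_openin :: "'a::euclidean_space set \<Rightarrow> 'a set \<Rightarrow> bool" where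
  "zariski_openin X U \<longleftrightarrow>
     (\<exists>P. (\<forall>p\<in>P. real_polynomial_function p) \<and> U = X - {x. \<forall>p\<in>P. p x = 0})"

definition Gr :: "nat \<Rightarrow> (real^'n^'n) set set" where
  "Gr m = {L. subspace L \<and> L \<subseteq> sym_mats \<and> dim L = m}"

definition basis_of :: "('m \<Rightarrow> 'a::euclidean_space) \<Rightarrow> 'a set \<Rightarrow> bool" where
  "basis_of b L \<longleftrightarrow> inj b \<and> independent (range b) \<and> span (range b) = L"

(* The Pluecker vector of a basis b of an m-dimensional subspace, m = CARD('m): its
   coordinate at f is the m x m minor of the coordinate matrix of b formed by the matrix
   positions f 1, ..., f m. All m-tuples f of positions are used as indices, rather than
   m-element sets of positions (i, j) with i <= j: the extra coordinates are zero or,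
   up to sign, duplicates, so the polynomials in the coordinates are the same. *)
definition pluecker :: "('m::finite \<Rightarrow> real^'n^'n) \<Rightarrow> real^('m \<Rightarrow> 'n \<times> 'n)" where
  "pluecker b = (\<chi> f. det (\<chi> k l. b k $ fst (f l) $ snd (f l)))"

(* Over the reals (an infinite field) a polynomial function satisfies this iff it is given
   by a homogeneous polynomial. *)
definition homogeneous :: "('a::real_vector \<Rightarrow> real) \<Rightarrow> bool" where
  "homogeneous p \<longleftrightarrow> (\<exists>k::nat. \<forall>c x. p (c *\<^sub>R x) = c ^ k * p x)"

(* The Pluecker vector of L is defined up to a nonzero scalar (change of basis), so the
   vanishing of a homogeneous polynomial does not depend on the choice of b. *)
definition zariski_closed_Gr :: "'m::finite itself \<Rightarrow> (real^'n^'n) set set \<Rightarrow> bool" where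
  "zariski_closed_Gr _ E \<longleftrightarrow>
     (\<exists>P :: (real^('m \<Rightarrow> 'n \<times> 'n) \<Rightarrow> real) set.
        (\<forall>p\<in>P. real_polynomial_function p \<and> homogeneous p) \<and>
        E = {L \<in> Gr CARD('m). \<forall>p\<in>P. \<forall>b :: 'm \<Rightarrow> real^'n^'n.
               basis_of b L \<longrightarrow> p (pluecker b) = 0})"

definition mle_exists :: "(real^'n^'n) set \<Rightarrow> real^'n^'n \<Rightarrow> bool" where
  "mle_exists L S \<longleftrightarrow>
     (\<exists>K \<in> L \<inter> pd_mats. \<forall>K' \<in> L \<inter> pd_mats.
        trace (S ** K) - ln (det K) \<le> trace (S ** K') - ln (det K'))"

(* Meaningful when L meets pd_mats; then d = n always qualifies, so the minimum exists. *)
definition MLT :: "(real^'n^'n) set \<Rightarrow> nat" where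
  "MLT L = (LEAST d. d \<le> CARD('n) \<and>
     (\<exists>U. zariski_openin (psd_mats_of_rank d) U \<and> U \<noteq> {} \<and> (\<forall>S\<in>U. mle_exists L S)))"

end

theory Submission
  imports Defs
begin

text \<open>
Let \<open>L\<close> be a subspace of symmetric matrices that contains a positive definite matrix, and let \<open>S\<close> be
semidefinite. The maximum likelihood estimate exists if and only if no nonzero semidefinite \<open>K \<in> L\<close> satisfies
\<open>S ** K = 0\<close> (\<open>mle_existsI\<close>, \<open>not_mle_existsI\<close>), that is, if no such \<open>K\<close> vanishes on the range \<open>W\<close> of \<open>S\<close>. The
symmetric matrices that vanish on a given subspace of dimension \<open>d\<close> have codimension \<open>n d - (d choose 2)\<close>, here
\<open>rank_dim n d\<close>, in the space of all symmetric matrices.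

If \<open>m\<close> is at most this number, a generic \<open>L\<close> contains no nonzero matrix that vanishes on a generic \<open>W\<close>, and
the estimate exists for generic \<open>S\<close> of rank \<open>d\<close> (\<open>generic_rank_mle_exists\<close>).

Suppose that \<open>m\<close> is larger. Then \<open>L\<close> contains nonzero matrices vanishing on \<open>W\<close> for reasons of dimension, but it has
to be shown that for a Zariski dense set of \<open>W\<close> some of them are semidefinite. The idea is to construct them for an
open set of subspaces \<open>W\<close>, by induction on the dimension of \<open>W\<close>, starting with a positive definite matrix. Given a
semidefinite \<open>K \<in> L\<close> with kernel exactly \<open>W\<close>, let \<open>L\<^sub>W\<close> be the space of matrices in \<open>L\<close> that vanish on \<open>W\<close>, and
take a generic \<open>A \<in> L\<^sub>W\<close>. If \<open>c\<close> is the lowest eigenvalue of \<open>A\<close> relative to \<open>K\<close> on the orthogonal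
complement of \<open>W\<close>, then \<open>A - c K\<close> is semidefinite and its kernel is \<open>W\<close> enlarged by an eigenvector \<open>v\<close>
(\<open>pencil_step\<close>). The enlarged kernel can be moved freely in an open set when \<open>L\<close> is transversal to the space of
matrices vanishing on it (\<open>transversal_kernel_stable\<close>), and this reduces to the matrices in \<open>L\<^sub>W\<close> mapping
\<open>v\<close> onto the whole orthogonal complement of \<open>W\<close>. That can fail for the lowest eigenvector of every
\<open>A\<close>: block diagonal spaces are an example. So this is where genericity of \<open>L\<close> is needed.

The lowest eigenvector is not a polynomial function of \<open>A\<close> and \<open>K\<close>. Therefore the property is demanded of all eigenvectors
of the pencil. The eigenvalue can then be eliminated, by substituting a matrix for it in the polynomial that
expresses the property (\<open>eigenvalue_elimination\<close>), and the result is a polynomial condition on finitely many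
elements of \<open>L\<close>. Since elements of \<open>L\<close> depend linearly on the Pluecker vector of \<open>L\<close>, it defines a Zariski open subset of
the Grassmannian (\<open>zariski_closed_Gr_vanishing_on_tuples\<close>). The subset is nonempty because the pencil of a
diagonal matrix and the identity, together with suitable rank one matrices, satisfies the condition
(\<open>pencil_witness_determinant\<close>).

Subspaces of varying dimension are represented by a frame, a square matrix \<open>g\<close>, and a set \<open>J\<close> of column indices.
\<close>

section \<open>Polynomial functions\<close>

lemma real_polynomial_function_comp:
  assumes "real_polynomial_function p" "polynomial_function f"
  shows "real_polynomial_function (\<lambda>x. p (f x))"
  using real_polynomial_function_compose[OF assms(2,1)] by (simp add: o_def)

lemma polynomial_function_vec:
  fixes f :: "'a::real_normed_vector \<Rightarrow> 'b::euclidean_space^'i"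
  assumes "\<And>i. polynomial_function (\<lambda>x. f x $ i)"
  shows "polynomial_function f"
  unfolding polynomial_function_iff_Basis_inner
proof
  fix b :: "'b^'i" assume "b \<in> Basis"
  have "real_polynomial_function (\<lambda>x. \<Sum>i\<in>UNIV. (f x $ i) \<bullet> (b $ i))"
  proof (intro real_polynomial_function_sum)
    fix i
    have "bounded_linear (\<lambda>y. y \<bullet> (b $ i))" by (rule bounded_linear_inner_left)
    with assms[of i] show "real_polynomial_function (\<lambda>x. (f x $ i) \<bullet> (b $ i))"
      unfolding polynomial_function_def o_def by blast
  qed auto
  then show "real_polynomial_function (\<lambda>x. f x \<bullet> b)"
    by (simp add: inner_vec_def)
qed

lemma polynomial_function_nth:
  fixes f :: "'a::real_normed_vector \<Rightarrow> 'b::real_normed_vector^'i"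
  assumes "polynomial_function f"
  shows "polynomial_function (\<lambda>x. f x $ i)"
  using polynomial_function_compose[OF assms polynomial_function_bounded_linear[OF bounded_linear_vec_nth]]
  by (simp add: o_def)

lemma polynomial_function_Pair:
  fixes f :: "'a::real_normed_vector \<Rightarrow> 'b::euclidean_space" and g :: "'a \<Rightarrow> 'c::euclidean_space"
  assumes "polynomial_function f" "polynomial_function g"
  shows "polynomial_function (\<lambda>x. (f x, g x))"
  using assms by (auto simp: polynomial_function_iff_Basis_inner Basis_prod_def)

lemma polynomial_function_fst:
  fixes f :: "'a::real_normed_vector \<Rightarrow> 'b::real_normed_vector \<times> 'c::real_normed_vector"
  assumes "polynomial_function f"
  shows "polynomial_function (\<lambda>x. fst (f x))"
  using polynomial_function_compose[OF assms polynomial_function_bounded_linear[OF bounded_linear_fst]]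
  by (simp add: o_def)

lemma polynomial_function_snd:
  fixes f :: "'a::real_normed_vector \<Rightarrow> 'b::real_normed_vector \<times> 'c::real_normed_vector"
  assumes "polynomial_function f"
  shows "polynomial_function (\<lambda>x. snd (f x))"
  using polynomial_function_compose[OF assms polynomial_function_bounded_linear[OF bounded_linear_snd]]
  by (simp add: o_def)

lemma polynomial_function_times:
  fixes f g :: "'a::real_normed_vector \<Rightarrow> real"
  shows "polynomial_function f \<Longrightarrow> polynomial_function g \<Longrightarrow> polynomial_function (\<lambda>x. f x * g x)"
  using real_polynomial_function.intros(4)[of f g] by (simp add: real_polynomial_function_eq)

lemma polynomial_function_prod:
  fixes f :: "'i \<Rightarrow> 'a::real_normed_vector \<Rightarrow> real"
  shows "(\<And>i. i \<in> I \<Longrightarrow> polynomial_function (f i)) \<Longrightarrow> polynomial_function (\<lambda>x. \<Prod>i\<in>I. f i x)"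
  by (induction I rule: infinite_finite_induct) (auto intro: polynomial_function_times)

lemma polynomial_function_sum':
  shows "(\<And>i. i \<in> I \<Longrightarrow> polynomial_function (f i)) \<Longrightarrow> polynomial_function (\<lambda>x. \<Sum>i\<in>I. f i x)"
  by (induction I rule: infinite_finite_induct) auto

lemma polynomial_function_det:
  fixes F :: "'a::real_normed_vector \<Rightarrow> real^'n^'n"
  assumes "\<And>i j. polynomial_function (\<lambda>x. F x $ i $ j)"
  shows "polynomial_function (\<lambda>x. det (F x))"
  unfolding det_def
  by (intro polynomial_function_sum' polynomial_function_times polynomial_function_prod polynomial_function_const assms)

lemmas polynomial_intros =
  polynomial_function_const polynomial_function_id polynomial_function_add polynomial_function_diff
  polynomial_function_minus
  polynomial_function_times polynomial_function_mult polynomial_function_sum' polynomial_function_det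
  polynomial_function_Pair polynomial_function_fst polynomial_function_snd polynomial_function_nth

text \<open>This is how a single variable is eliminated below: the coefficients depend polynomially on the other
variables, so that other quantities, even matrices, may be substituted for the scalar.\<close>

lemma real_polynomial_function_expand_scalar:
  fixes p :: "real \<times> 'a::euclidean_space \<Rightarrow> real"
  assumes "real_polynomial_function p"
  shows "\<exists>N c. (\<forall>r. real_polynomial_function (c r)) \<and> (\<forall>t x. p (t, x) = (\<Sum>r\<le>(N::nat). c r x * t ^ r))"
  using assms
proof (induction p rule: real_polynomial_function.induct)
  case (linear f)
  interpret f: bounded_linear f by fact
  define c where "c r x = (if r = 0 then f (0, x) else if r = 1 then f (1, 0) else 0)" for r :: nat and x :: 'a
  have "bounded_linear (\<lambda>x. f (0, x))"
    using bounded_linear_compose[OF linear bounded_linear_Pair[OF bounded_linear_zero bounded_linear_ident]] .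
  then have "real_polynomial_function (c r)" for r
    unfolding c_def by (cases "r = 0"; cases "r = 1") auto
  moreover have "f (t, x) = (\<Sum>r\<le>(1::nat). c r x * t ^ r)" for t x
  proof -
    have "f (t, x) = f (t *\<^sub>R (1, 0) + (0, x))" by simp
    also have "\<dots> = t * f (1, 0) + f (0, x)" by (simp only: f.add f.scale) simp
    finally show ?thesis by (simp add: c_def)
  qed
  ultimately show ?case by blast
next
  case (const c)
  have "\<forall>r. real_polynomial_function ((\<lambda>(r::nat) (x::'a). c) r)" by auto
  moreover have "\<forall>t x. c = (\<Sum>r\<le>(0::nat). (\<lambda>(r::nat) (x::'a). c) r x * t ^ r)" by simp
  ultimately show ?case by (intro exI[of _ 0] exI[of _ "\<lambda>r x. c"]) auto
next
  case (add f g)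
  then obtain N1 c1 N2 c2 where
    1: "\<forall>r. real_polynomial_function (c1 r)" "\<forall>t x. f (t, x) = (\<Sum>r\<le>(N1::nat). c1 r x * t ^ r)" and
    2: "\<forall>r. real_polynomial_function (c2 r)" "\<forall>t x. g (t, x) = (\<Sum>r\<le>(N2::nat). c2 r x * t ^ r)" by blast
  define c where "c r x = (if r \<le> N1 then c1 r x else 0) + (if r \<le> N2 then c2 r x else 0)" for r x
  have "real_polynomial_function (c r)" for r
    unfolding c_def using 1(1) 2(1) by (cases "r \<le> N1"; cases "r \<le> N2") auto
  moreover have "f (t, x) + g (t, x) = (\<Sum>r\<le>max N1 N2. c r x * t ^ r)" for t x
    using sum_max_0[where m=N1 and n=N2 and x=t and a="\<lambda>r. c1 r x"]
      sum_max_0[where m=N2 and n=N1 and x=t and a="\<lambda>r. c2 r x"]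
    by (simp add: 1 2 c_def sum.distrib algebra_simps max.commute)
  ultimately show ?case by blast
next
  case (mult f g)
  then obtain N1 c1 N2 c2 where
    1: "\<forall>r. real_polynomial_function (c1 r)" "\<forall>t x. f (t, x) = (\<Sum>r\<le>(N1::nat). c1 r x * t ^ r)" and
    2: "\<forall>r. real_polynomial_function (c2 r)" "\<forall>t x. g (t, x) = (\<Sum>r\<le>(N2::nat). c2 r x * t ^ r)" by blast
  define b1 where "b1 r x = (if r \<le> N1 then c1 r x else 0)" for r x
  define b2 where "b2 r x = (if r \<le> N2 then c2 r x else 0)" for r x
  have b: "real_polynomial_function (b1 r)" "real_polynomial_function (b2 r)" for r
    unfolding b1_def b2_def using 1(1) 2(1) by (cases "r \<le> N1"; cases "r \<le> N2"; auto)+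
  define c where "c r x = (\<Sum>k\<le>r. b1 k x * b2 (r - k) x)" for r x
  have "real_polynomial_function (c r)" for r
    unfolding c_def using b by (intro real_polynomial_function_sum) auto
  moreover have "f (t, x) * g (t, x) = (\<Sum>r\<le>N1+N2. c r x * t ^ r)" for t x
  proof -
    have "f (t, x) = (\<Sum>r\<le>N1. b1 r x * t ^ r)" "g (t, x) = (\<Sum>r\<le>N2. b2 r x * t ^ r)"
      by (simp_all add: 1 2 b1_def b2_def)
    then show ?thesis
      using polynomial_product[of N1 "\<lambda>r. b1 r x" N2 "\<lambda>r. b2 r x" t]
      by (simp add: c_def b1_def b2_def Set_Interval.atLeast0AtMost)
  qed
  ultimately show ?case by blast
qed

lemma sum_powers_eq_0D:
  fixes c :: "nat \<Rightarrow> real"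
  assumes "\<And>t. (\<Sum>r\<le>N. c r * t ^ r) = 0" "r \<le> N"
  shows "c r = 0"
  using assms polyfun_eq_0[of c N] by simp

text \<open>Expanding \<open>p (t *\<^sub>R x)\<close> in powers of \<open>t\<close> separates the homogeneous components. Hence on a set that is
closed under scaling, \<open>p\<close> vanishes if and only if all its homogeneous components vanish; only conditions of the latter
kind make sense for Pluecker vectors.\<close>

lemma homogeneous_components:
  fixes p :: "'a::euclidean_space \<Rightarrow> real"
  assumes "real_polynomial_function p"
  obtains N h where "\<And>r. real_polynomial_function (h r)" "\<And>r. homogeneous (h r)"
    "\<And>t x. p (t *\<^sub>R x) = (\<Sum>r\<le>(N::nat). h r x * t ^ r)"
proof -
  have "real_polynomial_function (\<lambda>z::real \<times> 'a. p (fst z *\<^sub>R snd z))"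
    by (intro real_polynomial_function_comp[OF assms] polynomial_intros)
  from real_polynomial_function_expand_scalar[OF this] obtain N c where
    c: "\<And>r. real_polynomial_function (c r)" and e: "\<And>t x. p (t *\<^sub>R x) = (\<Sum>r\<le>(N::nat). c r x * t ^ r)"
    by auto
  define h where "h r x = (if r \<le> N then c r x else 0)" for r x
  have "real_polynomial_function (h r)" for r unfolding h_def using c by (cases "r \<le> N") auto
  moreover have "homogeneous (h r)" for r
  proof (cases "r \<le> N")
    case True
    have "c r (s *\<^sub>R x) = s ^ r * c r x" for s x
    proof -
      have "(\<Sum>r\<le>N. (c r (s *\<^sub>R x) - s ^ r * c r x) * t ^ r) = 0" for t
        using e[of t "s *\<^sub>R x"] e[of "t * s" x]
        by (simp add: algebra_simps sum_subtractf power_mult_distrib)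
      from sum_powers_eq_0D[OF this True] show ?thesis by simp
    qed
    then show ?thesis unfolding homogeneous_def h_def using True by auto
  next
    case False
    then show ?thesis unfolding homogeneous_def h_def by auto
  qed
  moreover have "p (t *\<^sub>R x) = (\<Sum>r\<le>N. h r x * t ^ r)" for t x by (simp add: e h_def)
  ultimately show ?thesis using that by blast
qed

lemma finite_zeros_on_line:
  fixes p :: "'a::euclidean_space \<Rightarrow> real"
  assumes "real_polynomial_function p" "p x \<noteq> 0"
  shows "finite {t. p (y + t *\<^sub>R (x - y)) = 0}"
proof -
  have "real_polynomial_function (\<lambda>t::real. p (y + t *\<^sub>R (x - y)))"
    by (intro real_polynomial_function_comp[OF assms(1)] polynomial_intros)
  then obtain a n where a: "\<And>t. p (y + t *\<^sub>R (x - y)) = (\<Sum>i\<le>(n::nat). a i * t ^ i)"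
    using real_polynomial_function_imp_sum by meson
  have "\<not> (\<forall>i\<le>n. a i = 0)"
  proof
    assume "\<forall>i\<le>n. a i = 0"
    then have "p (y + 1 *\<^sub>R (x - y)) = 0" unfolding a by simp
    with assms show False by simp
  qed
  then show ?thesis unfolding a using polyfun_finite_roots by blast
qed

text \<open>Irreducibility of an affine space in its most elementary form: on the line joining two points, each
polynomial that is nonzero at one of them has only finitely many zeros.\<close>

lemma polynomials_common_nonzero:
  fixes p :: "'i \<Rightarrow> 'a::euclidean_space \<Rightarrow> real"
  assumes "finite I" "V \<noteq> {}"
    "\<And>x y t. x \<in> V \<Longrightarrow> y \<in> V \<Longrightarrow> y + t *\<^sub>R (x - y) \<in> V"
    "\<And>i. i \<in> I \<Longrightarrow> real_polynomial_function (p i)" "\<And>i. i \<in> I \<Longrightarrow> \<exists>x\<in>V. p i x \<noteq> 0"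
  shows "\<exists>x\<in>V. \<forall>i\<in>I. p i x \<noteq> 0"
  using assms(1,4,5)
proof (induction I)
  case empty
  then show ?case using assms(2) by auto
next
  case (insert i I)
  then obtain x where x: "x \<in> V" "\<forall>i\<in>I. p i x \<noteq> 0" by blast
  obtain y where y: "y \<in> V" "p i y \<noteq> 0" using insert.prems by blast
  have "finite (\<Union>k\<in>I. {t. p k (y + t *\<^sub>R (x - y)) = 0})"
    using insert x by (intro finite_UN_I finite_zeros_on_line) auto
  moreover have "finite {t. p i (y + (1 - t) *\<^sub>R (x - y)) = 0}"
  proof -
    have "y + (1 - t) *\<^sub>R (x - y) = x + t *\<^sub>R (y - x)" for t by (simp add: algebra_simps)
    then show ?thesis using finite_zeros_on_line[of "p i" y x] insert y by auto
  qed
  then have "finite ((\<lambda>t. 1 - t) ` {t. p i (y + (1 - t) *\<^sub>R (x - y)) = 0})" by simp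
  then have "finite {t. p i (y + t *\<^sub>R (x - y)) = 0}"
    by (rule rev_finite_subset) (force simp: image_iff intro: exI[of _ "1 - _"])
  ultimately have "finite ({t. p i (y + t *\<^sub>R (x - y)) = 0} \<union> (\<Union>k\<in>I. {t. p k (y + t *\<^sub>R (x - y)) = 0}))" by blast
  from ex_new_if_finite[OF infinite_UNIV_char_0 this] obtain t where
    "p i (y + t *\<^sub>R (x - y)) \<noteq> 0" "\<forall>k\<in>I. p k (y + t *\<^sub>R (x - y)) \<noteq> 0" by auto
  then show ?case using assms(3)[OF x(1) y(1), of t] by blast
qed

text \<open>The same argument on a line through a point of the open set: Zariski open sets are dense.\<close>

lemma polynomial_nonzero_in_open:
  fixes p :: "'a::euclidean_space \<Rightarrow> real"
  assumes "real_polynomial_function p" "p x \<noteq> 0" "open U" "y \<in> U"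
  shows "\<exists>z\<in>U. p z \<noteq> 0"
proof -
  have "isCont (\<lambda>t::real. y + t *\<^sub>R (x - y)) 0" by (intro continuous_intros)
  then have "((\<lambda>t::real. y + t *\<^sub>R (x - y)) \<longlongrightarrow> y) (at 0)" by (simp add: isCont_def)
  from topological_tendstoD[OF this assms(3,4)]
  obtain e where e: "e > 0" "\<And>t. t \<noteq> 0 \<Longrightarrow> dist t 0 < e \<Longrightarrow> y + t *\<^sub>R (x - y) \<in> U"
    by (auto simp: eventually_at)
  have "infinite {0<..<e}" using e by (simp add: infinite_Ioo)
  with finite_zeros_on_line[OF assms(1,2), of y] have "\<not> {0<..<e} \<subseteq> {t. p (y + t *\<^sub>R (x - y)) = 0}"
    using finite_subset by blast
  then obtain t where "0 < t" "t < e" "p (y + t *\<^sub>R (x - y)) \<noteq> 0" unfolding subset_iff by auto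
  with e(2)[of t] show ?thesis by auto
qed

section \<open>Semidefinite matrices\<close>

lemma sym_mats_inner: "A \<in> sym_mats \<Longrightarrow> x \<bullet> (A *v y) = (A *v x) \<bullet> y"
  unfolding sym_mats_def by (metis (mono_tags) dot_lmul_matrix mem_Collect_eq transpose_matrix_vector)

lemma subspace_sym_mats: "subspace sym_mats"
  unfolding sym_mats_def
  by (auto simp: subspace_def transpose_def vec_eq_iff)

lemma sym_matsI: "(\<And>i j. A $ i $ j = A $ j $ i) \<Longrightarrow> A \<in> sym_mats"
  by (simp add: sym_mats_def transpose_def vec_eq_iff)

lemma psd_mats_sym: "A \<in> psd_mats \<Longrightarrow> A \<in> sym_mats" by (simp add: psd_mats_def)

lemma pd_mats_psd: "A \<in> pd_mats \<Longrightarrow> A \<in> psd_mats"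
  unfolding pd_mats_def psd_mats_def by (auto simp: less_imp_le) (metis inner_zero_left less_imp_le order_refl)

text \<open>Otherwise the quadratic form would become negative in the direction \<open>x - s *\<^sub>R (A *v x)\<close> for small \<open>s > 0\<close>.\<close>

lemma psd_kernel:
  assumes A: "A \<in> psd_mats" and 0: "x \<bullet> (A *v x) = 0"
  shows "A *v x = 0"
proof (rule ccontr)
  assume "A *v x \<noteq> 0"
  define y where "y = A *v x"
  define a where "a = y \<bullet> y"
  define b where "b = y \<bullet> (A *v y)"
  have a: "a > 0" using \<open>A *v x \<noteq> 0\<close> by (simp add: a_def y_def)
  have sy: "A \<in> sym_mats" using A by (rule psd_mats_sym)
  have e: "0 \<le> s * s * b - 2 * s * a" for s
  proof -
    have "0 \<le> (x - s *\<^sub>R y) \<bullet> (A *v (x - s *\<^sub>R y))" using A by (simp add: psd_mats_def)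
    also have "\<dots> = x \<bullet> (A *v x) - s * (x \<bullet> (A *v y)) - s * (y \<bullet> (A *v x)) + s * s * b"
      by (simp add: b_def inner_diff_left inner_diff_right matrix_vector_mult_diff_distrib scaleR_matrix_vector_assoc[symmetric]
          matrix_vector_mult_scaleR algebra_simps)
    also have "x \<bullet> (A *v y) = a" by (simp add: sym_mats_inner[OF sy] a_def y_def)
    finally show ?thesis using 0 by (simp add: a_def y_def)
  qed
  have "b \<ge> 0" using A by (simp add: psd_mats_def b_def)
  show False
  proof (cases "b = 0")
    case True with e[of 1] a show False by simp
  next
    case False
    with e[of "a / b"] a \<open>b \<ge> 0\<close> mult_pos_pos[OF a a] show False by (simp add: field_simps)
  qed
qed

definition outer :: "real^'n \<Rightarrow> real^'n^'n" where
  "outer u = (\<chi> i j. u $ i * u $ j)"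

lemma outer_mult: "outer u *v x = (u \<bullet> x) *\<^sub>R u"
  by (simp add: outer_def vec_eq_iff matrix_vector_mult_def inner_vec_def sum_distrib_left mult_ac)

lemma outer_sym: "outer u \<in> sym_mats"
  by (rule sym_matsI) (simp add: outer_def)

lemma outer_0 [simp]: "outer 0 = 0"
  by (simp add: outer_def vec_eq_iff)

text \<open>The columns of \<open>g\<close> with index in \<open>J\<close>, when independent, form a basis of a subspace that varies with \<open>g\<close>, and
this is a semidefinite matrix with that subspace as its range. By \<open>psd_eq_frame_sum\<close> every semidefinite matrix of
rank \<open>card J\<close> has this form.\<close>

definition frame_sum :: "'n set \<Rightarrow> real^'n^'n \<Rightarrow> real^'n^'n" where
  "frame_sum J g = (\<Sum>i\<in>J. outer (column i g))"

lemma sum_matrix_vector_mult: "(\<Sum>i\<in>I. f i) *v x = (\<Sum>i\<in>I. f i *v x)"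
  for x :: "real^'n"
  by (induction I rule: infinite_finite_induct) (auto simp: matrix_vector_mult_add_rdistrib)

lemma frame_sum_mult: "frame_sum J g *v x = (\<Sum>i\<in>J. (column i g \<bullet> x) *\<^sub>R column i g)"
  by (simp add: frame_sum_def sum_matrix_vector_mult outer_mult)

lemma frame_sum_quadratic: "x \<bullet> (frame_sum J g *v x) = (\<Sum>i\<in>J. (column i g \<bullet> x)\<^sup>2)"
  by (simp add: frame_sum_mult inner_sum_right power2_eq_square inner_commute)

lemma frame_sum_sym: "frame_sum J g \<in> sym_mats"
  unfolding frame_sum_def by (intro subspace_sum subspace_sym_mats outer_sym)

lemma frame_sum_psd: "frame_sum J g \<in> psd_mats"
  by (simp add: psd_mats_def frame_sum_sym frame_sum_quadratic sum_nonneg)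

lemma frame_sum_eq_0:
  fixes g :: "real^'n::finite^'n"
  shows "frame_sum J g *v x = 0 \<longleftrightarrow> (\<forall>i\<in>J. column i g \<bullet> x = 0)"
proof
  assume "frame_sum J g *v x = 0"
  then have "(\<Sum>i\<in>J. (column i g \<bullet> x)\<^sup>2) = 0" by (metis frame_sum_quadratic inner_zero_right)
  then show "\<forall>i\<in>J. column i g \<bullet> x = 0" by (simp add: sum_nonneg_eq_0_iff finite)
qed (simp add: frame_sum_mult)

text \<open>Symmetric elimination. Subtracting the rank one matrix \<open>S x x\<^sup>T S / (x\<^sup>T S x)\<close> from \<open>S\<close> keeps it
semidefinite and lowers its rank by one, since \<open>x\<close> moves into the kernel. This plays the role of the
spectral theorem throughout.\<close>

lemma psd_eq_frame_sum:
  fixes S :: "real^'n^'n"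
  assumes "S \<in> psd_mats" "rank S = card J"
  shows "\<exists>g. S = frame_sum J g"
proof -
  have "finite J" by simp
  then show ?thesis using assms
  proof (induction J arbitrary: S)
    case empty
    then have "S = 0" by (simp add: rank_eq_0)
    then show ?case by (auto simp: frame_sum_def)
  next
    case (insert a J)
    have "S \<noteq> 0" using insert by (auto simp: rank_eq_0)
    then obtain x where x: "x \<bullet> (S *v x) \<noteq> 0"
      using psd_kernel[OF insert.prems(1)] by (metis matrix_eq matrix_vector_mult_0)
    define c where "c = x \<bullet> (S *v x)"
    have c: "c > 0" using x insert.prems(1) by (simp add: c_def psd_mats_def less_le)
    define u where "u = (1 / sqrt c) *\<^sub>R (S *v x)"
    define T where "T = S - outer u"
    have sy: "S \<in> sym_mats" using insert.prems(1) by (rule psd_mats_sym)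
    have Ty: "T *v y = S *v y - ((x \<bullet> (S *v y)) / c) *\<^sub>R (S *v x)" for y
    proof -
      have "(S *v x) \<bullet> y = x \<bullet> (S *v y)" by (rule sym_mats_inner[OF sy, symmetric])
      then show ?thesis using c by (simp add: T_def matrix_vector_mult_diff_rdistrib outer_mult u_def)
    qed
    have Tx: "T *v x = 0" using c by (simp add: Ty flip: c_def)
    have Tsym: "T \<in> sym_mats" unfolding T_def by (intro subspace_diff subspace_sym_mats sy outer_sym)
    have "T \<in> psd_mats"
    proof -
      have "0 \<le> y \<bullet> (T *v y)" for y
      proof -
        define z where "z = y - ((x \<bullet> (S *v y)) / c) *\<^sub>R x"
        have "T *v z = T *v y" by (simp add: z_def matrix_vector_mult_diff_distrib matrix_vector_mult_scaleR Tx)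
        moreover have "z \<bullet> (T *v y) = y \<bullet> (T *v y)"
        proof -
          have "x \<bullet> (T *v y) = 0" by (simp only: sym_mats_inner[OF Tsym] Tx inner_zero_left)
          then show ?thesis by (simp add: z_def inner_diff_left)
        qed
        moreover have xz: "x \<bullet> (S *v z) = 0"
          using c by (simp add: z_def matrix_vector_mult_diff_distrib matrix_vector_mult_scaleR inner_diff_right c_def[symmetric])
        then have "z \<bullet> (T *v z) = z \<bullet> (S *v z)" by (simp add: Ty)
        ultimately show ?thesis using insert.prems(1) by (simp add: psd_mats_def)
      qed
      with Tsym show ?thesis by (simp add: psd_mats_def)
    qed
    moreover have "rank T = card J"
    proof -
      have "range ((*v) T) \<subseteq> range ((*v) S)"
      proof
        fix y assume "y \<in> range ((*v) T)"
        then obtain z where "y = T *v z" by auto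
        then have "y = S *v (z - ((x \<bullet> (S *v z)) / c) *\<^sub>R x)"
          by (simp add: Ty matrix_vector_mult_diff_distrib matrix_vector_mult_scaleR)
        then show "y \<in> range ((*v) S)" by blast
      qed
      then have sub: "insert (S *v x) (range ((*v) T)) \<subseteq> range ((*v) S)" by auto
      have "S *v x \<notin> range ((*v) T)"
      proof
        assume "S *v x \<in> range ((*v) T)"
        then obtain z where "S *v x = T *v z" by auto
        then have "x \<bullet> (S *v x) = 0" by (simp add: sym_mats_inner[OF Tsym] Tx)
        with x show False by simp
      qed
      moreover have "subspace (range ((*v) T))" by (intro linear_subspace_image) auto
      ultimately have "S *v x \<notin> span (range ((*v) T))" by (metis span_eq_iff)
      then have 1: "dim (insert (S *v x) (range ((*v) T))) = rank T + 1"
        by (simp add: dim_insert rank_dim_range)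
      have "range ((*v) S) \<subseteq> span (insert (S *v x) (range ((*v) T)))"
      proof
        fix y assume "y \<in> range ((*v) S)"
        then obtain z where "y = S *v z" by auto
        then have "y = T *v z + ((x \<bullet> (S *v z)) / c) *\<^sub>R (S *v x)" by (simp add: Ty)
        then show "y \<in> span (insert (S *v x) (range ((*v) T)))"
          by (metis insertI1 insertI2 rangeI span_add span_base span_scale)
      qed
      then have "dim (range ((*v) S)) \<le> dim (insert (S *v x) (range ((*v) T)))"
        by (metis dim_span dim_subset)
      moreover have "dim (insert (S *v x) (range ((*v) T))) \<le> dim (range ((*v) S))"
        using sub by (rule dim_subset)
      ultimately have "rank S = rank T + 1" using 1 by (simp add: rank_dim_range)
      then show ?thesis using insert by simp
    qed
    ultimately obtain g where g: "T = frame_sum J g" using insert.IH by blast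
    define g' where "g' = (\<chi> i j. if j = a then u $ i else g $ i $ j)"
    have "column a g' = u" "\<And>j. j \<in> J \<Longrightarrow> column j g' = column j g"
      using insert.hyps by (auto simp: g'_def column_def vec_eq_iff)
    then have "frame_sum (insert a J) g' = outer u + T"
      using insert.hyps by (simp add: frame_sum_def g)
    then show ?case by (metis T_def add.commute diff_add_cancel)
  qed
qed

lemma det_nonzero_kernel: "det A \<noteq> 0 \<Longrightarrow> A *v x = 0 \<longleftrightarrow> x = 0" for A :: "real^'n^'n"
  by (metis invertible_det_nz invertible_left_inverse matrix_left_invertible_ker matrix_vector_mult_0_right)

lemma det_nonzeroI:
  fixes A :: "real^'n^'n"
  shows "(\<And>x. A *v x = 0 \<Longrightarrow> x = 0) \<Longrightarrow> det A \<noteq> 0"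
  by (metis invertible_det_nz invertible_left_inverse matrix_left_invertible_ker)

lemma pd_rank:
  fixes A :: "real^'n^'n"
  assumes "A \<in> pd_mats"
  shows "rank A = CARD('n)"
proof -
  have "x = 0" if "A *v x = 0" for x
    using assms that by (metis (mono_tags, lifting) inner_zero_right less_irrefl mem_Collect_eq pd_mats_def)
  then have "det A \<noteq> 0" by (rule det_nonzeroI)
  then show ?thesis using rank_bound[of A] by (auto simp: det_eq_0_rank)
qed

lemma frame_sum_UNIV: "frame_sum UNIV g = g ** transpose g"
  by (simp add: frame_sum_def outer_def vec_eq_iff matrix_matrix_mult_def transpose_def column_def)

lemma pd_factor:
  fixes A :: "real^'n^'n"
  assumes "A \<in> pd_mats"
  obtains g where "A = g ** transpose g" "det g \<noteq> 0"
proof -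
  obtain g where g: "A = frame_sum UNIV g"
    using psd_eq_frame_sum[OF pd_mats_psd[OF assms], of UNIV] pd_rank[OF assms] by auto
  then have e: "A = g ** transpose g" by (simp add: frame_sum_UNIV)
  have "det A \<noteq> 0" using pd_rank[OF assms] by (metis det_eq_0_rank less_irrefl)
  then have "det g \<noteq> 0" by (simp add: e det_mul)
  with e that show ?thesis by blast
qed

lemma pd_det_pos: "A \<in> pd_mats \<Longrightarrow> det A > 0"
  by (erule pd_factor) (auto simp: det_mul zero_less_mult_iff)

lemma psd_det_pd: "(A :: real^'n^'n) \<in> psd_mats \<Longrightarrow> det A \<noteq> 0 \<Longrightarrow> A \<in> pd_mats"
  unfolding pd_mats_def
proof safe
  assume A: "A \<in> psd_mats" "det A \<noteq> 0"
  then show "A \<in> sym_mats" by (simp add: psd_mats_sym)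
  fix x :: "real^'n" assume x: "x \<noteq> 0"
  then have "A *v x \<noteq> 0" using A(2) by (simp add: det_nonzero_kernel)
  then have "x \<bullet> (A *v x) \<noteq> 0" using psd_kernel[OF A(1)] by blast
  with A(1) show "0 < x \<bullet> (A *v x)" by (simp add: psd_mats_def less_le)
qed

lemma matrix_mult_transpose_outer: "A ** outer u ** transpose A = outer (A *v u)"
proof -
  have "(A ** outer u ** transpose A) *v x = outer (A *v u) *v x" for x
  proof -
    have "u \<bullet> (transpose A *v x) = (A *v u) \<bullet> x"
      by (metis dot_lmul_matrix inner_commute transpose_matrix_vector)
    then show ?thesis
      by (simp add: matrix_vector_mul_assoc[symmetric] outer_mult matrix_vector_mult_scaleR)
  qed
  then show ?thesis by (simp add: matrix_eq)
qed

lemma matrix_add_rdistrib: "(A + B) ** C = A ** C + B ** (C :: real^'n^'n)"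
  by (simp add: matrix_matrix_mult_def vec_eq_iff sum.distrib algebra_simps)

text \<open>An orthogonal change of basis turns \<open>u\<close> into a multiple of a coordinate vector, and the matrix into a
diagonal one.\<close>

lemma det_mat1_add_outer:
  fixes u :: "real^'n"
  shows "det (mat 1 + outer u) = 1 + u \<bullet> u"
proof -
  define k :: 'n where "k = undefined"
  define e :: "real^'n" where "e = norm u *\<^sub>R axis k 1"
  have "norm e = norm u" by (simp add: e_def)
  then obtain f where f: "orthogonal_transformation f" "f e = u"
    using orthogonal_transformation_exists by blast
  define Q where "Q = matrix f"
  have Q: "orthogonal_matrix Q" using f(1) orthogonal_transformation_matrix Q_def by blast
  have Qe: "Q *v e = u" using f by (simp add: Q_def matrix_works orthogonal_transformation_linear)
  have "mat 1 + outer u = Q ** (mat 1 + outer e) ** transpose Q"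
    using Q by (simp add: matrix_add_ldistrib matrix_add_rdistrib matrix_mult_transpose_outer Qe orthogonal_matrix_def)
  then have "det (mat 1 + outer u) = det (Q ** transpose Q) * det (mat 1 + outer e)"
    by (simp add: det_mul mult_ac del: det_transpose)
  also have "\<dots> = det (mat 1 + outer e)" using Q by (simp add: orthogonal_matrix_def)
  also have "\<dots> = (\<Prod>i\<in>UNIV. (mat 1 + outer e) $ i $ i)"
    by (rule det_diagonal) (auto simp: e_def outer_def mat_def axis_def)
  also have "\<dots> = (\<Prod>i\<in>UNIV. if i = k then 1 + u \<bullet> u else 1)"
    by (rule prod.cong) (auto simp: e_def outer_def mat_def axis_def dot_square_norm power2_eq_square)
  also have "\<dots> = 1 + u \<bullet> u" by (simp add: prod.delta)
  finally show ?thesis .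
qed

lemma det_pd_add_outer:
  fixes A :: "real^'n^'n"
  assumes "A \<in> pd_mats"
  shows "det (A + outer u) \<ge> det A" and "u \<noteq> 0 \<Longrightarrow> det (A + outer u) > det A"
proof -
  obtain g where g: "A = g ** transpose g" "det g \<noteq> 0" using pd_factor[OF assms] .
  obtain h where h: "g ** h = mat 1" using g(2) by (metis invertible_def invertible_det_nz)
  define w where "w = h *v u"
  have gw: "g *v w = u" by (simp add: w_def matrix_vector_mul_assoc h)
  have "A + outer u = g ** (mat 1 + outer w) ** transpose g"
    by (simp add: matrix_add_ldistrib matrix_add_rdistrib matrix_mult_transpose_outer gw g)
  then have e: "det (A + outer u) = det A * (1 + w \<bullet> w)"
    by (simp add: det_mul g det_mat1_add_outer)
  have p: "det A > 0" using pd_det_pos[OF assms] .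
  show "det (A + outer u) \<ge> det A" using p by (simp add: e algebra_simps)
  assume "u \<noteq> 0"
  then have "w \<noteq> 0" using gw by auto
  then show "det (A + outer u) > det A" using p by (simp add: e algebra_simps)
qed

lemma pd_add_psd: "A \<in> pd_mats \<Longrightarrow> P \<in> psd_mats \<Longrightarrow> A + P \<in> pd_mats"
  by (auto simp: pd_mats_def psd_mats_def matrix_vector_mult_add_rdistrib inner_add_right
      intro!: subspace_add[OF subspace_sym_mats] add_pos_nonneg)

lemma psd_scale: "P \<in> psd_mats \<Longrightarrow> t \<ge> 0 \<Longrightarrow> t *\<^sub>R P \<in> psd_mats"
  by (auto simp: psd_mats_def scaleR_matrix_vector_assoc[symmetric] intro: subspace_scale[OF subspace_sym_mats])

text \<open>The perturbation is a sum of rank one terms, each of which increases the determinant.\<close>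

lemma det_add_psd_less:
  fixes A :: "real^'n^'n"
  assumes A: "A \<in> pd_mats" and P: "P \<in> psd_mats" "P \<noteq> 0"
  shows "det A < det (A + P)"
proof -
  obtain J :: "'n set" where "card J = rank P"
    using rank_bound[of P] obtain_subset_with_card_n[of "rank P" UNIV] by auto
  then obtain g where g: "P = frame_sum J g" using psd_eq_frame_sum[OF P(1), of J] by auto
  have ge: "det A \<le> det (A + frame_sum I g)" for I
  proof (induction I rule: infinite_finite_induct)
    case (insert x F)
    have "A + frame_sum F g \<in> pd_mats" by (intro pd_add_psd A frame_sum_psd)
    from det_pd_add_outer(1)[OF this, of "column x g"] insert show ?case
      by (simp add: frame_sum_def algebra_simps)
  qed (auto simp: frame_sum_def)
  obtain i where i: "i \<in> J" "column i g \<noteq> 0"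
  proof -
    have "\<not> (\<forall>i\<in>J. column i g = 0)"
    proof
      assume "\<forall>i\<in>J. column i g = 0"
      then have "frame_sum J g = 0" unfolding frame_sum_def by (intro sum.neutral) simp
      with P(2) g show False by simp
    qed
    then show thesis using that by blast
  qed
  have "A + frame_sum (J - {i}) g \<in> pd_mats" by (intro pd_add_psd A frame_sum_psd)
  from det_pd_add_outer(2)[OF this i(2)] ge[of "J - {i}"]
  have "det A < det (A + frame_sum (J - {i}) g + outer (column i g))" by simp
  also have "A + frame_sum (J - {i}) g + outer (column i g) = A + P"
    unfolding g frame_sum_def using i(1) by (simp add: sum.remove[of J i])
  finally show ?thesis .
qed

lemma coercive_on_subspace:
  fixes A :: "real^'n^'n"
  assumes "subspace V" "\<And>x. x \<in> V \<Longrightarrow> x \<noteq> 0 \<Longrightarrow> 0 < x \<bullet> (A *v x)"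
  obtains k where "k > 0" "\<And>x. x \<in> V \<Longrightarrow> k * (norm x)\<^sup>2 \<le> x \<bullet> (A *v x)"
proof (cases "V \<inter> sphere 0 1 = {}")
  case True
  have "x = 0" if "x \<in> V" for x
  proof (rule ccontr)
    assume "x \<noteq> 0"
    then have "(1 / norm x) *\<^sub>R x \<in> V \<inter> sphere 0 1"
      using that assms(1) by (auto intro: subspace_scale)
    with True show False by auto
  qed
  then have "1 * (norm x)\<^sup>2 \<le> x \<bullet> (A *v x)" if "x \<in> V" for x using that by fastforce
  then show ?thesis using that[of 1] by auto
next
  case False
  have "compact (V \<inter> sphere 0 1)" using assms(1) by (intro closed_Int_compact closed_subspace compact_sphere)
  moreover have "continuous_on (V \<inter> sphere 0 1) (\<lambda>x. x \<bullet> (A *v x))"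
    by (intro continuous_intros matrix_vector_mult_linear_continuous_on linear_continuous_on) (auto simp: linear_linear)
  ultimately obtain z where z: "z \<in> V \<inter> sphere 0 1" "\<And>y. y \<in> V \<inter> sphere 0 1 \<Longrightarrow> z \<bullet> (A *v z) \<le> y \<bullet> (A *v y)"
    using continuous_attains_inf[OF _ False] by blast
  define k where "k = z \<bullet> (A *v z)"
  have "z \<noteq> 0" using z(1) by auto
  then have "k > 0" using assms(2) z(1) by (auto simp: k_def)
  moreover have "k * (norm x)\<^sup>2 \<le> x \<bullet> (A *v x)" if "x \<in> V" for x
  proof (cases "x = 0")
    case False
    define y where "y = (1 / norm x) *\<^sub>R x"
    have "y \<in> V \<inter> sphere 0 1" using that False assms(1) by (auto simp: y_def intro: subspace_scale)
    then have "k \<le> y \<bullet> (A *v y)" using z(2) by (simp add: k_def)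
    also have "\<dots> = (x \<bullet> (A *v x)) / (norm x)\<^sup>2" using False
      by (simp add: y_def matrix_vector_mult_scaleR power2_eq_square)
    finally show ?thesis using False by (simp add: field_simps)
  qed simp
  ultimately show ?thesis using that by blast
qed

section \<open>Cramer vectors\<close>

text \<open>This is the adjugate of \<open>A\<close> applied to \<open>w\<close>. In contrast to \<open>A\<^sup>-\<^sup>1 w\<close> it is polynomial in \<open>A\<close> and \<open>w\<close>, and it
remains informative when \<open>A\<close> is singular: by \<open>mult_cramer_vec\<close> it then lies in the kernel of \<open>A\<close>.\<close>

definition cramer_vec :: "real^'n^'n \<Rightarrow> real^'n \<Rightarrow> real^'n" where
  "cramer_vec A w = (\<chi> k. det (\<chi> i j. if j = k then w $ i else A $ i $ j))"

lemma linear_cramer_vec: "linear (cramer_vec A)"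
proof -
  have e: "cramer_vec A w $ k = det (\<chi> i. if i = k then w else column i A)" for w k
    unfolding cramer_vec_def
    by (subst det_transpose[symmetric]) (auto intro!: arg_cong[where f=det] simp: vec_eq_iff transpose_def column_def)
  show ?thesis
  proof (rule linearI)
    fix x y :: "real^'a" and c :: real
    show "cramer_vec A (x + y) = cramer_vec A x + cramer_vec A y"
      using det_row_add[of _ "\<lambda>_. x" "\<lambda>_. y" "\<lambda>i. column i A"] by (simp add: vec_eq_iff e)
    show "cramer_vec A (c *\<^sub>R x) = c *\<^sub>R cramer_vec A x"
      using det_row_mul[of _ c "\<lambda>_. x" "\<lambda>i. column i A"] by (simp add: vec_eq_iff e scalar_mult_eq_scaleR[symmetric])
  qed
qed

lemma polynomial_function_cramer_vec:
  assumes "polynomial_function A" "polynomial_function w"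
  shows "polynomial_function (\<lambda>x. cramer_vec (A x) (w x))"
  unfolding cramer_vec_def
  apply (rule polynomial_function_vec)
  apply simp
  apply (rule polynomial_function_det)
  subgoal for k i j by (cases "j = k") (auto intro!: polynomial_intros assms)
  done

lemma cramer_vec_mult: "cramer_vec A (A *v x) = det A *\<^sub>R x"
  by (simp add: cramer_vec_def vec_eq_iff cramer_lemma mult.commute)

lemma mult_cramer_vec_invertible:
  assumes "det A \<noteq> 0" shows "A *v cramer_vec A w = det A *\<^sub>R w"
proof -
  obtain x where "A *v x = w" using assms cramer[of A] by blast
  then show ?thesis using cramer_vec_mult[of A x] by (auto simp: matrix_vector_mult_scaleR)
qed

lemma exists_det_add_scalar_nonzero: "\<exists>t. det (A + t *\<^sub>R mat 1) \<noteq> 0" for A :: "real^'n^'n"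
proof -
  obtain B where B: "B > 0" "\<And>x. norm (A *v x) \<le> norm x * B"
    using bounded_linear.pos_bounded[OF matrix_vector_mul_bounded_linear[of A]] by blast
  have "x = 0" if "(A + (B + 1) *\<^sub>R mat 1) *v x = 0" for x
  proof -
    have "A *v x + (B + 1) *\<^sub>R x = 0"
      using that by (simp add: matrix_vector_mult_add_rdistrib scaleR_matrix_vector_assoc[symmetric])
    then have "norm (A *v x) = norm ((B + 1) *\<^sub>R x)"
      by (metis add_eq_0_iff norm_minus_cancel)
    then have "norm (A *v x) = (B + 1) * norm x" using B(1) by simp
    with B(2)[of x] show "x = 0" by (simp add: algebra_simps)
  qed
  then show ?thesis using det_nonzeroI by blast
qed

lemma polynomial_function_matrix_vector_mult:
  fixes A :: "'a::real_normed_vector \<Rightarrow> real^'n^'k"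
  assumes "polynomial_function A" "polynomial_function w"
  shows "polynomial_function (\<lambda>x. A x *v w x)"
  by (rule polynomial_function_vec)
    (auto simp: matrix_vector_mult_def intro!: polynomial_intros assms)

text \<open>For invertible \<open>A\<close> this is Cramer's rule. Both sides are polynomial along the line \<open>A + t *\<^sub>R mat 1\<close>, on
which the determinant does not vanish identically, so the identity extends to singular \<open>A\<close>.\<close>

lemma mult_cramer_vec: "A *v cramer_vec A w = det A *\<^sub>R w"
proof (rule ccontr)
  assume "A *v cramer_vec A w \<noteq> det A *\<^sub>R w"
  then obtain i where i: "(A *v cramer_vec A w - det A *\<^sub>R w) $ i \<noteq> 0"
    by (auto simp: vec_eq_iff)
  define At where "At t = A + t *\<^sub>R mat 1" for t
  have At: "polynomial_function At" unfolding At_def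
    by (intro polynomial_intros)
  define p where "p b t = (if b then (At t *v cramer_vec (At t) w - det (At t) *\<^sub>R w) $ i else det (At t))" for b t
  have "real_polynomial_function (p b)" for b
    unfolding real_polynomial_function_eq p_def
    by (cases b; simp only: if_True if_False)
      (intro polynomial_intros At polynomial_function_cramer_vec polynomial_function_matrix_vector_mult)+
  moreover have "\<exists>t\<in>UNIV. p b t \<noteq> 0" for b
    using i exists_det_add_scalar_nonzero[of A] by (cases b) (auto simp: p_def At_def intro!: exI[of _ 0])
  ultimately obtain t where "\<forall>b\<in>UNIV. p b t \<noteq> 0"
    using polynomials_common_nonzero[of "UNIV::bool set" UNIV p] by auto
  then have "p True t \<noteq> 0" "p False t \<noteq> 0" by blast+
  then show False using mult_cramer_vec_invertible[of "At t" w] by (simp add: p_def)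
qed

section \<open>Zariski closed subsets of the Grassmannian\<close>

lemma independent_family_iff:
  fixes b :: "'m::finite \<Rightarrow> 'a::euclidean_space"
  shows "inj b \<and> independent (range b) \<longleftrightarrow> (\<forall>y. (\<Sum>k\<in>UNIV. y k *\<^sub>R b k) = 0 \<longrightarrow> (\<forall>k. y k = 0))"
proof safe
  fix y k assume b: "inj b" "independent (range b)" and 0: "(\<Sum>k\<in>UNIV. y k *\<^sub>R b k) = 0"
  have "(\<Sum>v\<in>range b. y (inv b v) *\<^sub>R v) = 0"
    using 0 b(1) by (simp add: sum.reindex)
  with b(2) have "\<forall>v\<in>range b. y (inv b v) = 0"
    unfolding independent_explicit by (elim conjE allE[of _ "\<lambda>v. y (inv b v)"]) simp
  then have "y (inv b (b k)) = 0" by blast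
  then show "y k = 0" using b(1) by simp
next
  assume a: "\<forall>y. (\<Sum>k\<in>UNIV. y k *\<^sub>R b k) = 0 \<longrightarrow> (\<forall>k. y k = 0)"
  show i: "inj b"
  proof (rule injI, rule ccontr)
    fix k l assume kl: "b k = b l" "k \<noteq> l"
    have "(\<Sum>i\<in>UNIV. ((if i = k then 1 else 0) - (if i = l then 1 else 0)) *\<^sub>R b i) = 0"
      using kl by (simp add: scaleR_diff_left sum_subtractf if_distrib[of "\<lambda>c. c *\<^sub>R _"] cong: if_cong)
    from a[rule_format, OF this, of k] have "(if k = k then 1 else 0) - (if k = l then 1 else (0::real)) = 0" .
    with kl show False by simp
  qed
  assume "dependent (range b)"
  then obtain u v where u: "v \<in> range b" "u v \<noteq> 0" "(\<Sum>v\<in>range b. u v *\<^sub>R v) = 0"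
    by (auto simp: dependent_finite)
  have "(\<Sum>k\<in>UNIV. u (b k) *\<^sub>R b k) = 0" using u(3) i by (simp add: sum.reindex)
  with a u(1,2) show False by auto
qed

lemma span_range_sum:
  fixes b :: "'m::finite \<Rightarrow> 'a::euclidean_space"
  assumes "x \<in> span (range b)"
  obtains y where "x = (\<Sum>k\<in>UNIV. y k *\<^sub>R b k)"
proof -
  have "span (range b) \<subseteq> range (\<lambda>y::real^'m. \<Sum>k\<in>UNIV. y $ k *\<^sub>R b k)"
  proof (rule span_minimal)
    have "b k = (\<Sum>l\<in>UNIV. axis k 1 $ l *\<^sub>R b l)" for k
      by (simp add: axis_def if_distrib[of "\<lambda>c. c *\<^sub>R _"] cong: if_cong)
    then show "range b \<subseteq> range (\<lambda>y::real^'m. \<Sum>k\<in>UNIV. y $ k *\<^sub>R b k)" by blast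
    have "linear (\<lambda>y::real^'m. \<Sum>k\<in>UNIV. y $ k *\<^sub>R b k)"
      by (rule linearI) (simp_all add: algebra_simps sum.distrib scaleR_sum_right)
    then show "subspace (range (\<lambda>y::real^'m. \<Sum>k\<in>UNIV. y $ k *\<^sub>R b k))"
      by (rule linear_subspace_image) simp
  qed
  then obtain y :: "real^'m" where "x = (\<Sum>k\<in>UNIV. y $ k *\<^sub>R b k)" using assms by blast
  then show ?thesis by (rule that)
qed

text \<open>For the Pluecker vector \<open>p\<close> of \<open>L\<close>, this is the element of \<open>L\<close> obtained by expanding the minors that differ
from \<open>f\<close> only in column \<open>l\<close>. It is linear in \<open>p\<close>, which
is what allows conditions on elements of \<open>L\<close> to be written in Pluecker coordinates.\<close>

definition pluecker_elem :: "real^('m \<Rightarrow> 'n \<times> 'n) \<Rightarrow> ('m::finite \<Rightarrow> 'n \<times> 'n) \<Rightarrow> 'm \<Rightarrow> real^'n^'n" where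
  "pluecker_elem p f l = (\<chi> i j. p $ (f(l := (i, j))))"

definition minor_matrix :: "('m::finite \<Rightarrow> real^'n^'n) \<Rightarrow> ('m \<Rightarrow> 'n \<times> 'n) \<Rightarrow> real^'m^'m" where
  "minor_matrix b f = (\<chi> k l. b k $ fst (f l) $ snd (f l))"

lemma pluecker_elem_cramer:
  fixes b :: "'m::finite \<Rightarrow> real^'n^'n"
  shows "pluecker_elem (pluecker b) f l $ i $ j = cramer_vec (minor_matrix b f) (\<chi> k. b k $ i $ j) $ l"
  by (auto simp: pluecker_elem_def pluecker_def cramer_vec_def minor_matrix_def vec_eq_iff intro!: arg_cong[where f=det])

lemma pluecker_elem_mem:
  fixes b :: "'m::finite \<Rightarrow> real^'n^'n"
  assumes "basis_of b L"
  shows "pluecker_elem (pluecker b) f l \<in> L"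
proof -
  have "(\<chi> k. b k $ i $ j) = (\<Sum>k\<in>UNIV. b k $ i $ j *\<^sub>R axis k (1::real))" for i j
    by (simp add: vec_eq_iff axis_def if_distrib[of "\<lambda>c. _ * c"] cong: if_cong)
  then have "cramer_vec (minor_matrix b f) (\<chi> k. b k $ i $ j)
    = (\<Sum>k\<in>UNIV. b k $ i $ j *\<^sub>R cramer_vec (minor_matrix b f) (axis k 1))" for i j
    by (simp add: linear_sum[OF linear_cramer_vec] linear_scale[OF linear_cramer_vec])
  then have "pluecker_elem (pluecker b) f l
    = (\<Sum>k\<in>UNIV. (cramer_vec (minor_matrix b f) (axis k 1) $ l) *\<^sub>R b k)"
    by (simp add: vec_eq_iff pluecker_elem_cramer mult.commute)
  also have "\<dots> \<in> span (range b)" by (intro span_sum span_scale span_base) auto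
  finally show ?thesis using assms by (simp add: basis_of_def)
qed

lemma pluecker_eq_det: "pluecker b $ f = det (minor_matrix b f)"
  by (simp add: pluecker_def minor_matrix_def)

text \<open>As soon as one minor \<open>f\<close> is nonzero, the elements \<open>pluecker_elem\<close> for the columns of \<open>f\<close> span \<open>L\<close>: this is
Cramer's rule for the minor matrix, read position by position.\<close>

lemma pluecker_elem_spans:
  fixes b :: "'m::finite \<Rightarrow> real^'n^'n"
  shows "(\<Sum>l\<in>UNIV. b k $ fst (f l) $ snd (f l) *\<^sub>R pluecker_elem (pluecker b) f l) = pluecker b $ f *\<^sub>R b k"
proof -
  have "(\<Sum>l\<in>UNIV. minor_matrix b f $ k $ l * cramer_vec (minor_matrix b f) w $ l) = det (minor_matrix b f) * w $ k" for w
    using arg_cong[OF mult_cramer_vec[of "minor_matrix b f" w], of "\<lambda>v. v $ k"]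
    by (simp add: matrix_vector_mult_def)
  then show ?thesis
    by (simp add: vec_eq_iff pluecker_elem_cramer pluecker_eq_det minor_matrix_def)
qed

text \<open>The rows of the coordinate matrix are independent, so its columns span, and some of them form a basis.\<close>

lemma exists_nonzero_pluecker:
  fixes b :: "'m::finite \<Rightarrow> real^'n^'n"
  assumes "inj b" "independent (range b)"
  shows "\<exists>f. pluecker b $ f \<noteq> 0"
proof -
  define v where "v p = (\<chi> k. b k $ fst p $ snd p)" for p
  have "span (range v) = UNIV"
  proof (rule ccontr)
    assume "span (range v) \<noteq> UNIV"
    then obtain y where y: "y \<noteq> 0" "\<forall>x\<in>span (range v). y \<bullet> x = 0"
      using span_not_UNIV_orthogonal by blast
    then have "y \<bullet> v (i, j) = 0" for i j by (simp add: span_base)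
    then have "(\<Sum>k\<in>UNIV. y $ k *\<^sub>R b k) = 0"
      by (simp add: vec_eq_iff v_def inner_vec_def)
    then have "\<forall>k. y $ k = 0" using assms independent_family_iff[of b] by blast
    with y(1) show False by (simp add: vec_eq_iff)
  qed
  moreover obtain B where B: "B \<subseteq> range v" "independent B" "range v \<subseteq> span B"
    using maximal_independent_subset by blast
  ultimately have "span B = UNIV" by (metis span_minimal subspace_span top.extremum_uniqueI)
  then have "card B = CARD('m)" using B(2) by (metis dim_UNIV DIM_cart DIM_real dim_span_eq_card_independent mult.right_neutral)
  then obtain h where h: "bij_betw h (UNIV::'m set) B"
    using finite_same_card_bij[of "UNIV::'m set" B] B(2) independent_imp_finite by fastforce
  have "h l \<in> range v" for l
    using bij_betwE[OF h] B(1) by blast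
  then have "\<forall>l. \<exists>p. h l = v p" by (simp add: image_iff)
  from choice[OF this] obtain f where f: "\<And>l. h l = v (f l)" by blast
  have ind: "\<forall>y. (\<Sum>k\<in>UNIV. y k *\<^sub>R h k) = 0 \<longrightarrow> (\<forall>k. y k = 0)"
    using h B(2) independent_family_iff[of h] by (simp add: bij_betw_def)
  have "det (minor_matrix b f) \<noteq> 0"
  proof (rule det_nonzeroI)
    fix x assume "minor_matrix b f *v x = 0"
    then have "(\<Sum>k\<in>UNIV. x $ k *\<^sub>R h k) = 0"
      by (simp add: vec_eq_iff matrix_vector_mult_def minor_matrix_def f v_def mult.commute)
    with ind show "x = 0" by (simp add: vec_eq_iff)
  qed
  then show ?thesis by (auto simp: pluecker_eq_det)
qed

lemma Gr_basis:
  assumes "L \<in> Gr CARD('m)"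
  obtains b :: "'m::finite \<Rightarrow> real^'n^'n" where "basis_of b L"
proof -
  obtain B where B: "B \<subseteq> L" "independent B" "L \<subseteq> span B" "card B = dim L"
    using basis_exists by blast
  have L: "subspace L" "dim L = CARD('m)" using assms by (auto simp: Gr_def)
  have "finite B" using B(2) independent_imp_finite by blast
  then obtain h where h: "bij_betw h (UNIV::'m set) B"
    using finite_same_card_bij[of "UNIV::'m set" B] B(4) L(2) by auto
  have "span B = L" using B L by (simp add: span_minimal subset_antisym)
  then have "basis_of h L" using h B by (auto simp: basis_of_def bij_betw_def)
  then show ?thesis using that by blast
qed

definition pluecker_tuple :: "real^'m^'m \<Rightarrow> ('m::finite \<Rightarrow> 'n \<times> 'n) \<Rightarrow> real^('m \<Rightarrow> 'n \<times> 'n) \<Rightarrow> real^'n^'n^'m" where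
  "pluecker_tuple Y f p = (\<chi> k. \<Sum>l\<in>UNIV. Y $ k $ l *\<^sub>R pluecker_elem p f l)"

text \<open>All genericity conditions enter through this lemma. A tuple of elements of \<open>L\<close> is of the form
\<open>pluecker_tuple Y f p\<close>, so a polynomial condition on it becomes, for every fixed \<open>Y\<close> and \<open>f\<close>, a polynomial
condition on the Pluecker vector \<open>p\<close>. Since the tuples from \<open>L\<close> are closed under scaling, the homogeneous
components of that polynomial vanish separately. As defining family it is convenient to take all
homogeneous polynomials vanishing on the set.\<close>

lemma zariski_closed_Gr_vanishing_on_tuples:
  fixes \<Phi> :: "(real^'n^'n^'m \<Rightarrow> real) set"
  assumes \<Phi>: "\<And>\<phi>. \<phi> \<in> \<Phi> \<Longrightarrow> real_polynomial_function \<phi>"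
  shows "zariski_closed_Gr TYPE('m::finite)
    {L \<in> Gr CARD('m). \<forall>\<phi>\<in>\<Phi>. \<forall>X. (\<forall>k. X $ k \<in> L) \<longrightarrow> \<phi> X = 0}" (is "zariski_closed_Gr _ ?E")
proof -
  define P where "P = {h. real_polynomial_function h \<and> homogeneous h \<and>
    (\<forall>L\<in>?E. \<forall>b :: 'm \<Rightarrow> real^'n^'n. basis_of b L \<longrightarrow> h (pluecker b) = 0)}"
  have "L \<in> ?E" if L: "L \<in> Gr CARD('m)"
    and van: "\<And>h b. h \<in> P \<Longrightarrow> basis_of b L \<Longrightarrow> h (pluecker b) = 0" for L
  proof -
    have "\<phi> X = 0" if \<phi>: "\<phi> \<in> \<Phi>" and X: "\<forall>k. X $ k \<in> L" for \<phi> X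
    proof -
      obtain b :: "'m \<Rightarrow> real^'n^'n" where b: "basis_of b L" using Gr_basis[OF L] by blast
      obtain f where f: "pluecker b $ f \<noteq> 0" using exists_nonzero_pluecker b by (auto simp: basis_of_def)
      have "\<exists>z. X $ k = (\<Sum>l\<in>UNIV. z l *\<^sub>R b l)" for k
      proof -
        have "X $ k \<in> span (range b)" using X b by (auto simp: basis_of_def)
        then show ?thesis by (rule span_range_sum) blast
      qed
      then obtain z where z: "\<And>k. X $ k = (\<Sum>l\<in>UNIV. z k l *\<^sub>R b l)" by metis
      define Y :: "real^'m^'m" where
        "Y = (\<chi> k l. (\<Sum>i\<in>UNIV. z k i * b i $ fst (f l) $ snd (f l)) / pluecker b $ f)"
      have XY: "pluecker_tuple Y f (pluecker b) = X"
      proof -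
        have "pluecker_tuple Y f (pluecker b) $ k = X $ k" for k
        proof -
          have "pluecker_tuple Y f (pluecker b) $ k
            = (\<Sum>l\<in>UNIV. \<Sum>i\<in>UNIV. (z k i / pluecker b $ f) *\<^sub>R (b i $ fst (f l) $ snd (f l) *\<^sub>R pluecker_elem (pluecker b) f l))"
            by (simp add: pluecker_tuple_def Y_def sum_divide_distrib scaleR_sum_left)
          also have "\<dots> = (\<Sum>i\<in>UNIV. (z k i / pluecker b $ f) *\<^sub>R
              (\<Sum>l\<in>UNIV. b i $ fst (f l) $ snd (f l) *\<^sub>R pluecker_elem (pluecker b) f l))"
            by (subst sum.swap) (simp add: scaleR_sum_right)
          also have "\<dots> = X $ k" using f by (simp add: pluecker_elem_spans z)
          finally show ?thesis .
        qed
        then show ?thesis by (simp add: vec_eq_iff)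
      qed
      have scale: "pluecker_tuple Y f (t *\<^sub>R p) = t *\<^sub>R pluecker_tuple Y f p" for t p
        by (simp add: pluecker_tuple_def pluecker_elem_def vec_eq_iff sum_distrib_left mult_ac)
      have pol: "real_polynomial_function (\<lambda>p. \<phi> (pluecker_tuple Y f p))"
      proof (rule real_polynomial_function_comp[OF \<Phi>[OF \<phi>]])
        show "polynomial_function (pluecker_tuple Y f)"
          unfolding pluecker_tuple_def pluecker_elem_def
          apply (rule polynomial_function_vec, simp)
          apply (intro polynomial_intros)
          apply (rule polynomial_function_vec, simp)
          apply (rule polynomial_function_vec, simp)
          apply (intro polynomial_intros)
          done
      qed
      obtain N c where c: "\<And>r. real_polynomial_function (c r)" "\<And>r. homogeneous (c r)"
        and e: "\<And>t p. \<phi> (pluecker_tuple Y f (t *\<^sub>R p)) = (\<Sum>r\<le>(N::nat). c r p * t ^ r)"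
        by (rule homogeneous_components[OF pol], rule that)
      have "c r \<in> P" if "r \<le> N" for r
      proof -
        have "c r (pluecker b') = 0" if "L' \<in> ?E" "basis_of b' L'" for L' and b' :: "'m \<Rightarrow> real^'n^'n"
        proof -
          have "subspace L'" using that by (simp add: Gr_def)
          then have "pluecker_tuple Y f (t *\<^sub>R pluecker b') $ k \<in> L'" for t k
            unfolding scale using pluecker_elem_mem[OF that(2)]
            by (auto simp: pluecker_tuple_def intro!: subspace_scale subspace_sum)
          then have "\<phi> (pluecker_tuple Y f (t *\<^sub>R pluecker b')) = 0" for t using that(1) \<phi> by blast
          then show ?thesis unfolding e by (rule sum_powers_eq_0D[OF _ \<open>r \<le> N\<close>])
        qed
        then show ?thesis using c by (auto simp: P_def)
      qed
      then have "c r (pluecker b) = 0" if "r \<le> N" for r using van b that by blast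
      then have "\<phi> (pluecker_tuple Y f (1 *\<^sub>R pluecker b)) = 0" unfolding e by simp
      then show ?thesis by (simp add: XY)
    qed
    then show ?thesis using L by blast
  qed
  then have "?E = {L \<in> Gr CARD('m). \<forall>h\<in>P. \<forall>b :: 'm \<Rightarrow> real^'n^'n. basis_of b L \<longrightarrow> h (pluecker b) = 0}"
    unfolding P_def by blast
  moreover have "\<forall>h\<in>P. real_polynomial_function h \<and> homogeneous h" unfolding P_def by blast
  ultimately show ?thesis unfolding zariski_closed_Gr_def by (intro exI[of _ P] conjI)
qed

section \<open>Existence of the maximum likelihood estimate\<close>

lemma bounded_bilinear_matrix_vector_mult:
  "bounded_bilinear ((*v) :: real^'n^'k \<Rightarrow> real^'n \<Rightarrow> real^'k)"
  unfolding bilinear_conv_bounded_bilinear[symmetric] bilinear_def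
  by (auto intro!: linearI simp: algebra_simps scaleR_matrix_vector_assoc)

lemma matrix_mult_scaleR_left: "(c *\<^sub>R A) ** B = c *\<^sub>R (A ** B)" for A B :: "real^'n^'n"
  by (simp add: matrix_matrix_mult_def vec_eq_iff sum_distrib_left mult_ac)

lemma matrix_mult_scaleR_right: "A ** (c *\<^sub>R B) = c *\<^sub>R (A ** B)" for A B :: "real^'n^'n"
  by (simp add: matrix_matrix_mult_def vec_eq_iff sum_distrib_left mult_ac)

lemma matrix_diff_rdistrib: "(A - B) ** C = A ** C - B ** C" for A B C :: "real^'n^'n"
  by (simp add: matrix_matrix_mult_def vec_eq_iff sum_subtractf algebra_simps)

lemma bounded_bilinear_matrix_matrix_mult:
  "bounded_bilinear ((**) :: real^'n^'n \<Rightarrow> real^'n^'n \<Rightarrow> real^'n^'n)"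
  unfolding bilinear_conv_bounded_bilinear[symmetric] bilinear_def
  by (auto intro!: linearI simp: matrix_add_ldistrib matrix_add_rdistrib matrix_mult_scaleR_right matrix_mult_scaleR_left)

lemma continuous_on_real_polynomial:
  "real_polynomial_function p \<Longrightarrow> continuous_on S p"
  by (simp add: real_polynomial_function_eq continuous_on_polymonial_function)

lemma real_polynomial_function_det: "real_polynomial_function (det :: real^'n^'n \<Rightarrow> real)"
  unfolding real_polynomial_function_eq by (intro polynomial_intros)

text \<open>Frames are matrices whose columns span the subspaces under consideration. Polynomial conditions on a
frame can always be combined with invertibility.\<close>

lemma exists_invertible_frame_nonzero:
  fixes p :: "real^'n^'n \<Rightarrow> real"
  assumes "real_polynomial_function p" "p g0 \<noteq> 0" "open U" "U \<noteq> {}"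
  obtains g where "g \<in> U" "p g \<noteq> 0" "det g \<noteq> 0"
proof -
  obtain g1 where g1: "g1 \<in> U" "p g1 \<noteq> 0"
    using polynomial_nonzero_in_open[OF assms(1-3)] assms(4) by blast
  have "open {g. p g \<noteq> 0}"
    by (intro open_Collect_neq continuous_on_const continuous_on_real_polynomial assms(1))
  then have "open (U \<inter> {g. p g \<noteq> 0})" using assms(3) by blast
  moreover have "det (mat 1 :: real^'n^'n) \<noteq> 0" by simp
  ultimately obtain g where "g \<in> U \<inter> {g. p g \<noteq> 0}" "det g \<noteq> 0"
    using polynomial_nonzero_in_open[OF real_polynomial_function_det] g1 by blast
  then show ?thesis using that by blast
qed

lemma trace_scaleR: "trace (c *\<^sub>R A) = c * trace A" for A :: "real^'n^'n"
  by (simp add: trace_def sum_distrib_left)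

lemma det_scaleR: "det (c *\<^sub>R A) = c ^ CARD('n) * det A" for A :: "real^'n^'n"
  using det_rows_mul[of "\<lambda>_. c" "\<lambda>i. A $ i"]
  by (simp add: scalar_mult_eq_scaleR scaleR_vec_def)

lemma closed_psd_mats: "closed (psd_mats :: (real^'n^'n) set)"
proof -
  have "psd_mats = sym_mats \<inter> (\<Inter>x. {A :: real^'n^'n. 0 \<le> x \<bullet> (A *v x)})"
    by (auto simp: psd_mats_def)
  moreover have "closed {A :: real^'n^'n. 0 \<le> x \<bullet> (A *v x)}" for x
    by (intro closed_Collect_le continuous_intros
        linear_continuous_on[OF bounded_bilinear.bounded_linear_left[OF bounded_bilinear_matrix_vector_mult]])
  then have "closed (sym_mats \<inter> (\<Inter>x. {A :: real^'n^'n. 0 \<le> x \<bullet> (A *v x)}))"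
    by (intro closed_Int closed_subspace[OF subspace_sym_mats] closed_INT) blast
  ultimately show ?thesis by metis
qed

lemma trace_frame_sum_mult: "trace (frame_sum J g ** K) = (\<Sum>i\<in>J. column i g \<bullet> (K *v column i g))"
proof -
  have 1: "trace (outer u ** K) = u \<bullet> (K *v u)" for u
  proof -
    have "trace (outer u ** K) = (\<Sum>i\<in>UNIV. \<Sum>k\<in>UNIV. u $ k * (K $ k $ i * u $ i))"
      by (simp add: trace_def matrix_matrix_mult_def outer_def mult_ac)
    also have "\<dots> = (\<Sum>k\<in>UNIV. \<Sum>i\<in>UNIV. u $ k * (K $ k $ i * u $ i))" by (rule sum.swap)
    finally show ?thesis by (simp add: inner_vec_def matrix_vector_mult_def sum_distrib_left)
  qed
  have "trace (frame_sum J g ** K) = (\<Sum>i\<in>J. trace (outer (column i g) ** K))"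
    unfolding frame_sum_def
    by (induction J rule: infinite_finite_induct) (auto simp: matrix_add_rdistrib trace_add trace_0[unfolded mat_0])
  then show ?thesis by (simp add: 1)
qed

lemma psd_frame_sum_exists:
  fixes S :: "real^'n^'n"
  assumes "S \<in> psd_mats"
  obtains J g where "S = frame_sum J g"
proof -
  obtain J :: "'n set" where "card J = rank S"
    using rank_bound[of S] obtain_subset_with_card_n[of "rank S" UNIV] by auto
  then show ?thesis using psd_eq_frame_sum[OF assms, of J] that by auto
qed

lemma trace_psd_mult:
  fixes S K :: "real^'n^'n"
  assumes "S \<in> psd_mats" "K \<in> psd_mats"
  shows "0 \<le> trace (S ** K)" and "trace (S ** K) = 0 \<Longrightarrow> S ** K = 0"
proof -
  obtain J g where S: "S = frame_sum J g" using psd_frame_sum_exists[OF assms(1)] .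
  have nn: "0 \<le> column i g \<bullet> (K *v column i g)" for i using assms(2) by (simp add: psd_mats_def)
  then show "0 \<le> trace (S ** K)" by (simp add: S trace_frame_sum_mult sum_nonneg)
  assume "trace (S ** K) = 0"
  then have "\<forall>i\<in>J. column i g \<bullet> (K *v column i g) = 0"
    using nn by (simp add: S trace_frame_sum_mult sum_nonneg_eq_0_iff)
  then have "K *v column i g = 0" if "i \<in> J" for i using psd_kernel[OF assms(2)] that by blast
  then have "(S ** K) *v x = 0" for x
    by (simp add: S matrix_vector_mul_assoc[symmetric] frame_sum_mult sym_mats_inner[OF psd_mats_sym[OF assms(2)]])
  then show "S ** K = 0" by (simp add: matrix_eq)
qed

lemma pd_imp_nonzero: "K \<in> pd_mats \<Longrightarrow> K \<noteq> (0 :: real^'n^'n)"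
  using pd_det_pos[of K] by (metis det_0 less_irrefl mat_0)

text \<open>By compactness of the unit sphere the linear part of the objective is at least \<open>k * norm K\<close> on the
semidefinite matrices in \<open>L\<close>, for some \<open>k > 0\<close>, while \<open>ln (det K)\<close> grows only logarithmically. Hence a sublevel set of the objective is bounded,
and on it \<open>det K\<close> stays away from zero, so the set is compact and the minimum is attained.\<close>

lemma mle_existsI:
  fixes L :: "(real^'n^'n) set"
  assumes L: "subspace L" "L \<inter> pd_mats \<noteq> {}" and S: "S \<in> psd_mats"
    and ker: "\<And>K. K \<in> L \<Longrightarrow> K \<in> psd_mats \<Longrightarrow> S ** K = 0 \<Longrightarrow> K = 0"
  shows "mle_exists L S"
proof -
  define f where "f K = trace (S ** K) - ln (det K)" for K
  obtain K1 where K1: "K1 \<in> L" "K1 \<in> pd_mats" using L(2) by blast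
  define f1 where "f1 = f K1"
  have tracelin: "bounded_linear (\<lambda>K. trace (S ** K))"
    by (intro linear_linear[THEN iffD2] linearI)
      (simp_all add: matrix_add_ldistrib trace_add matrix_mult_scaleR_right trace_scaleR)
  have tr_pos: "0 < trace (S ** K)" if "K \<in> L" "K \<in> psd_mats" "K \<noteq> 0" for K
    using trace_psd_mult[OF S that(2)] ker[OF that(1,2)] that(3) by (metis less_le)
  have cont_tr: "continuous_on A (\<lambda>K. trace (S ** K))" for A
    using tracelin by (rule linear_continuous_on)
  let ?C1 = "L \<inter> psd_mats \<inter> sphere 0 1"
  have unit: "(1 / norm K) *\<^sub>R K \<in> ?C1" if "K \<in> L" "K \<in> psd_mats" "K \<noteq> 0" for K
    using that L(1) by (auto intro: subspace_scale psd_scale)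
  have C1: "compact ?C1"
    by (intro closed_Int_compact closed_Int closed_psd_mats compact_sphere closed_subspace L)
  have C1ne: "?C1 \<noteq> {}" using unit[OF K1(1) pd_mats_psd[OF K1(2)] pd_imp_nonzero[OF K1(2)]] by blast
  obtain Z where Z: "Z \<in> ?C1" "\<And>K. K \<in> ?C1 \<Longrightarrow> trace (S ** Z) \<le> trace (S ** K)"
    using continuous_attains_inf[OF C1 C1ne cont_tr] by metis
  define k where "k = trace (S ** Z)"
  have "Z \<noteq> 0" using Z(1) by auto
  then have k: "k > 0" unfolding k_def using Z(1) tr_pos by blast
  have lower: "k * norm K \<le> trace (S ** K)" if "K \<in> L" "K \<in> psd_mats" for K
  proof (cases "K = 0")
    case True
    then show ?thesis using trace_psd_mult(1)[OF S that(2)] by simp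
  next
    case False
    have "k \<le> trace (S ** ((1 / norm K) *\<^sub>R K))" using Z(2)[OF unit[OF that False]] by (simp add: k_def)
    also have "\<dots> = trace (S ** K) / norm K"
      using linear_scale[OF bounded_linear.linear[OF tracelin], of "1 / norm K" K] by simp
    finally show ?thesis using False by (simp add: field_simps)
  qed
  have "compact (det ` sphere (0 :: real^'n^'n) 1)"
    by (intro compact_continuous_image compact_sphere continuous_on_real_polynomial real_polynomial_function_det)
  then obtain D0 where "\<forall>y\<in>det ` sphere (0 :: real^'n^'n) 1. norm y \<le> D0"
    using compact_imp_bounded bounded_iff by metis
  then have D0: "\<bar>det K\<bar> \<le> D0" if "norm K = 1" for K :: "real^'n^'n" using that by simp
  define D where "D = max D0 1"
  have D: "D > 0" by (simp add: D_def)
  have detle: "\<bar>det K\<bar> \<le> D * norm K ^ CARD('n)" if "K \<noteq> 0" for K :: "real^'n^'n"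
  proof -
    have "det K = norm K ^ CARD('n) * det ((1 / norm K) *\<^sub>R K)"
      using det_scaleR[of "norm K" "(1 / norm K) *\<^sub>R K"] that by simp
    moreover have "\<bar>det ((1 / norm K) *\<^sub>R K)\<bar> \<le> D" using D0[of "(1 / norm K) *\<^sub>R K"] that by (simp add: D_def)
    then have "norm K ^ CARD('n) * \<bar>det ((1 / norm K) *\<^sub>R K)\<bar> \<le> norm K ^ CARD('n) * D"
      by (rule mult_left_mono) simp
    ultimately show ?thesis by (simp add: abs_mult mult.commute)
  qed
  define n where "n = real CARD('n)"
  have n: "n > 0" by (simp add: n_def)
  \<comment> \<open>with y = k / (2 n) * norm K, the inequality ln y <= y - 1 absorbs n ln (norm K) into half of k * norm K\<close>
  define R where "R = 2 * (f1 + ln D + n * ln (2 * n / k)) / k"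
  have bound: "norm K \<le> R" if K: "K \<in> L" "K \<in> pd_mats" "f K \<le> f1" for K
  proof -
    have K0: "K \<noteq> 0" using pd_imp_nonzero K(2) by blast
    have "ln (det K) \<le> ln (D * norm K ^ CARD('n))"
      using detle[OF K0] pd_det_pos[OF K(2)] by (intro ln_mono) auto
    also have "\<dots> = ln D + n * ln (norm K)"
      using D K0 by (simp add: ln_mult ln_realpow n_def)
    finally have 1: "ln (det K) \<le> ln D + n * ln (norm K)" .
    have "ln (norm K) = ln ((k / (2 * n)) * norm K) + ln (2 * n / k)"
      using ln_mult_pos[of "(k / (2 * n)) * norm K" "2 * n / k"] K0 k n by simp
    also have "\<dots> \<le> (k / (2 * n)) * norm K + ln (2 * n / k)"
      using ln_le_minus_one[of "(k / (2 * n)) * norm K"] K0 k n by simp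
    finally have "n * ln (norm K) \<le> n * ((k / (2 * n)) * norm K + ln (2 * n / k))"
      using n by (simp add: mult_left_mono)
    also have "\<dots> = k * norm K / 2 + n * ln (2 * n / k)" using n by (simp add: field_simps)
    finally have "k * norm K \<le> f1 + (ln D + (k * norm K / 2 + n * ln (2 * n / k)))"
      using 1 lower[OF K(1) pd_mats_psd[OF K(2)]] K(3) by (simp add: f_def)
    then show ?thesis using k by (simp add: R_def field_simps)
  qed
  \<comment> \<open>the trace is nonnegative, so a value at most f1 of the objective forces ln (det K) to be at least - f1\<close>
  let ?C = "L \<inter> psd_mats \<inter> cball 0 R \<inter> {K. exp (- f1) \<le> det K}"
  have inC: "K \<in> ?C" if K: "K \<in> L" "K \<in> pd_mats" "f K \<le> f1" for K
  proof -
    have "- f1 \<le> ln (det K)" using K(3) trace_psd_mult(1)[OF S pd_mats_psd[OF K(2)]] by (simp add: f_def)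
    then have "exp (- f1) \<le> det K" using pd_det_pos[OF K(2)] by (metis exp_le_cancel_iff exp_ln)
    then show ?thesis using bound[OF K] K pd_mats_psd by auto
  qed
  have "closed {K :: real^'n^'n. exp (- f1) \<le> det K}"
    by (intro closed_Collect_le continuous_on_const continuous_on_real_polynomial real_polynomial_function_det)
  then have "compact ?C"
    by (intro compact_Int_closed[OF closed_Int_compact] closed_Int closed_psd_mats compact_cball
        closed_subspace[OF L(1)])
  moreover have "?C \<noteq> {}" using inC[OF K1] by (auto simp: f1_def)
  moreover have pdC: "K \<in> pd_mats" if "K \<in> ?C" for K
    using that psd_det_pd[of K] by (auto dest: order.strict_trans2[OF exp_gt_zero])
  then have "continuous_on ?C f" unfolding f_def
    by (intro continuous_on_diff cont_tr continuous_on_ln continuous_on_real_polynomial real_polynomial_function_det)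
      (metis less_irrefl pd_det_pos)
  ultimately obtain Ko where Ko: "Ko \<in> ?C" "\<And>K. K \<in> ?C \<Longrightarrow> f Ko \<le> f K"
    using continuous_attains_inf[of ?C f] by metis
  have "f Ko \<le> f K" if "K \<in> L \<inter> pd_mats" for K
  proof (cases "f K \<le> f1")
    case True
    then show ?thesis using inC that Ko(2) by blast
  next
    case False
    have "f Ko \<le> f1" unfolding f1_def by (rule Ko(2)[OF inC[OF K1]]) (simp add: f1_def)
    with False show ?thesis by simp
  qed
  then show ?thesis unfolding mle_exists_def f_def using Ko(1) pdC[OF Ko(1)] by blast
qed

text \<open>Moving along \<open>K\<close> leaves the trace term unchanged and increases the determinant.\<close>

lemma not_mle_existsI:
  fixes L :: "(real^'n^'n) set"
  assumes L: "subspace L" and K: "K \<in> L" "K \<in> psd_mats" "K \<noteq> 0" "S ** K = 0"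
  shows "\<not> mle_exists L S"
proof
  assume "mle_exists L S"
  then obtain Ko where Ko: "Ko \<in> L" "Ko \<in> pd_mats"
    and min: "\<And>K'. K' \<in> L \<inter> pd_mats \<Longrightarrow> trace (S ** Ko) - ln (det Ko) \<le> trace (S ** K') - ln (det K')"
    unfolding mle_exists_def by blast
  have "Ko + K \<in> L \<inter> pd_mats" using Ko K L pd_add_psd subspace_add by blast
  from min[OF this] have "ln (det (Ko + K)) \<le> ln (det Ko)"
    by (simp add: matrix_add_ldistrib K(4))
  moreover have "det Ko < det (Ko + K)" by (rule det_add_psd_less[OF Ko(2) K(2,3)])
  ultimately show False using pd_det_pos[OF Ko(2)] by (simp add: ln_less_cancel_iff)
qed

section \<open>Eigenvectors of a pencil\<close>

lemma polynomial_function_matrix_mult: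
  fixes A :: "'a::real_normed_vector \<Rightarrow> real^'n^'k" and B :: "'a \<Rightarrow> real^'l^'n"
  assumes "polynomial_function A" "polynomial_function B"
  shows "polynomial_function (\<lambda>x. A x ** B x)"
  by (rule polynomial_function_vec, rule polynomial_function_vec)
    (auto simp: matrix_matrix_mult_def intro!: polynomial_intros assms)

abbreviation matrix_power :: "real^'n^'n \<Rightarrow> nat \<Rightarrow> real^'n^'n" where
  "matrix_power M r \<equiv> (((**) M) ^^ r) (mat 1)"

text \<open>A polynomial condition \<open>q (\<mu>, x) \<noteq> 0\<close> is to hold for all eigenvalues \<open>\<mu>\<close> of \<open>M x\<close>. Substituting the matrix
\<open>M x\<close> for \<open>\<mu>\<close> yields a matrix that acts on an eigenvector as multiplication by \<open>q (\<mu>, x)\<close>. Its determinant is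
polynomial in \<open>x\<close> and plays the role of the resultant of \<open>q\<close> with the characteristic polynomial.\<close>

lemma eigenvalue_elimination:
  fixes q :: "real \<times> 'a::euclidean_space \<Rightarrow> real" and M :: "'a \<Rightarrow> real^'n^'n"
  assumes q: "real_polynomial_function q" and M: "polynomial_function M"
  obtains R where "real_polynomial_function R"
    "\<And>x \<mu> v. R x \<noteq> 0 \<Longrightarrow> v \<noteq> 0 \<Longrightarrow> M x *v v = \<mu> *\<^sub>R v \<Longrightarrow> q (\<mu>, x) \<noteq> 0"
    "\<And>x. (\<And>i j. i \<noteq> j \<Longrightarrow> M x $ i $ j = 0) \<Longrightarrow> (\<And>i. q (M x $ i $ i, x) \<noteq> 0) \<Longrightarrow> R x \<noteq> 0"
proof -
  obtain N c where c: "\<And>r. real_polynomial_function (c r)"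
    and e: "\<And>t x. q (t, x) = (\<Sum>r\<le>(N::nat). c r x * t ^ r)"
    using real_polynomial_function_expand_scalar[OF q] by auto
  define Q where "Q x = (\<Sum>r\<le>N. c r x *\<^sub>R matrix_power (M x) r)" for x
  have "polynomial_function (\<lambda>x. matrix_power (M x) r)" for r
    by (induction r) (auto intro!: polynomial_function_matrix_mult M polynomial_function_const)
  then have "polynomial_function Q"
    unfolding Q_def using c by (intro polynomial_intros) (auto simp: real_polynomial_function_eq)
  then have "real_polynomial_function (\<lambda>x. det (Q x))"
    unfolding real_polynomial_function_eq by (intro polynomial_intros)
  moreover have "q (\<mu>, x) \<noteq> 0" if "det (Q x) \<noteq> 0" "v \<noteq> 0" "M x *v v = \<mu> *\<^sub>R v" for x \<mu> v
  proof -
    have "matrix_power (M x) r *v v = \<mu> ^ r *\<^sub>R v" for r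
      by (induction r) (simp_all add: matrix_vector_mul_assoc[symmetric] matrix_vector_mult_scaleR that(3))
    then have "Q x *v v = q (\<mu>, x) *\<^sub>R v"
      by (simp add: Q_def e sum_matrix_vector_mult scaleR_matrix_vector_assoc[symmetric] scaleR_sum_left)
    moreover have "Q x *v v \<noteq> 0" using that by (simp add: det_nonzero_kernel)
    ultimately show ?thesis by auto
  qed
  moreover have "det (Q x) \<noteq> 0"
    if d: "\<And>i j. i \<noteq> j \<Longrightarrow> M x $ i $ j = 0" and nz: "\<And>i. q (M x $ i $ i, x) \<noteq> 0" for x
  proof -
    have "matrix_power (M x) r $ i $ j = (if i = j then M x $ i $ i ^ r else 0)" for r i j
    proof (induction r arbitrary: i j)
      case 0
      then show ?case by (simp add: mat_def)
    next
      case (Suc r)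
      have "matrix_power (M x) (Suc r) $ i $ j = (\<Sum>k\<in>UNIV. M x $ i $ k * matrix_power (M x) r $ k $ j)"
        by (simp add: matrix_matrix_mult_def)
      also have "\<dots> = (\<Sum>k\<in>UNIV. if k = i then M x $ i $ i * matrix_power (M x) r $ i $ j else 0)"
        by (rule sum.cong) (auto simp: d)
      finally show ?case using Suc by simp
    qed
    then have "Q x $ i $ j = (if i = j then q (M x $ i $ i, x) else 0)" for i j
      by (simp add: Q_def e sum_component)
    then have "det (Q x) = (\<Prod>i\<in>UNIV. q (M x $ i $ i, x))"
      by (subst det_diagonal) auto
    then show ?thesis using nz by simp
  qed
  ultimately show ?thesis using that by blast
qed

text \<open>The adjugate of \<open>G\<close> times \<open>A\<close>, a polynomial substitute for \<open>G\<^sup>-\<^sup>1 A\<close> with the same eigenvectors when \<open>G\<close> is invertible.\<close>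

definition adj_mult :: "real^'n^'n \<Rightarrow> real^'n^'n \<Rightarrow> real^'n^'n" where
  "adj_mult G A = (\<chi> i j. cramer_vec G (column j A) $ i)"

lemma matrix_vector_mult_columns: "A *v x = (\<Sum>j\<in>UNIV. x $ j *\<^sub>R column j A)"
  by (simp add: matrix_mult_sum scalar_mult_eq_scaleR)

lemma adj_mult_vec: "adj_mult G A *v x = cramer_vec G (A *v x)"
proof -
  have "column j (adj_mult G A) = cramer_vec G (column j A)" for j
    by (simp add: adj_mult_def column_def)
  then show ?thesis
    unfolding matrix_vector_mult_columns
    by (simp add: linear_sum[OF linear_cramer_vec] linear_scale[OF linear_cramer_vec])
qed

text \<open>Here \<open>A\<close> and \<open>K\<close> vanish on the subspace \<open>W\<close> spanned by the columns of \<open>g\<close> in \<open>J\<close>. Adding \<open>frame_sum J g\<close>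
makes the matrices nonsingular on \<open>W\<close> without changing anything on its orthogonal complement, and
scaling \<open>A\<close> by the determinant matches the eigenvalues of \<open>adj_mult\<close>.\<close>

definition pencil_matrix :: "'n set \<Rightarrow> real^'n^'n \<Rightarrow> real^'n^'n \<Rightarrow> real^'n^'n \<Rightarrow> real \<Rightarrow> real^'n^'n" where
  "pencil_matrix J A K g \<mu> = det (K + frame_sum J g) *\<^sub>R A - \<mu> *\<^sub>R K + frame_sum J g"

text \<open>Suppose that \<open>J\<close> is not everything. At an eigenvalue \<open>\<mu>\<close> the Cramer vector of the pencil matrix is a
multiple of the eigenvector \<open>v\<close>. If the
determinant of these columns is nonzero, then that multiple is nonzero, which makes the eigenvalue simple,
and the vectors \<open>B $ k *v v\<close> for \<open>k\<close> outside \<open>J\<close> span the orthogonal complement of \<open>W\<close>.\<close>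

definition pencil_columns ::
  "'n set \<Rightarrow> real^'n^'n \<Rightarrow> real^'n^'n \<Rightarrow> real^'n^'n^'n \<Rightarrow> real^'n^'n \<Rightarrow> real^'n \<Rightarrow> real \<Rightarrow> real^'n^'n" where
  "pencil_columns J A K B g w \<mu> =
    (\<chi> i k. if k \<in> J then g $ i $ k else (B $ k *v cramer_vec (pencil_matrix J A K g \<mu>) w) $ i)"

lemma polynomial_function_frame_sum:
  assumes "polynomial_function g"
  shows "polynomial_function (\<lambda>x. frame_sum J (g x))"
  unfolding frame_sum_def outer_def column_def
  apply (rule polynomial_function_sum')
  apply (rule polynomial_function_vec, rule polynomial_function_vec)
  apply simp
  apply (intro polynomial_intros assms)
  done

lemma pencil_polynomial_exists:
  fixes J :: "'n::finite set"
  shows "\<exists>R. real_polynomial_function R \<and>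
    (\<forall>A K B g w \<mu> v. R (A, K, B, g, w) \<noteq> 0 \<longrightarrow> v \<noteq> 0 \<longrightarrow>
      adj_mult (K + frame_sum J g) A *v v = \<mu> *\<^sub>R v \<longrightarrow> det (pencil_columns J A K B g w \<mu>) \<noteq> 0) \<and>
    (\<forall>A K B g w. (\<forall>i j. i \<noteq> j \<longrightarrow> adj_mult (K + frame_sum J g) A $ i $ j = 0) \<longrightarrow>
      (\<forall>i. det (pencil_columns J A K B g w (adj_mult (K + frame_sum J g) A $ i $ i)) \<noteq> 0) \<longrightarrow>
      R (A, K, B, g, w :: real^'n) \<noteq> 0)"
proof -
  define M :: "(real^'n^'n) \<times> (real^'n^'n) \<times> (real^'n^'n^'n) \<times> (real^'n^'n) \<times> (real^'n) \<Rightarrow> real^'n^'n"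
    where "M x = adj_mult (fst (snd x) + frame_sum J (fst (snd (snd (snd x))))) (fst x)" for x
  define q :: "real \<times> (real^'n^'n) \<times> (real^'n^'n) \<times> (real^'n^'n^'n) \<times> (real^'n^'n) \<times> (real^'n) \<Rightarrow> real"
    where "q x = det (pencil_columns J (fst (snd x)) (fst (snd (snd x))) (fst (snd (snd (snd x))))
      (fst (snd (snd (snd (snd x))))) (snd (snd (snd (snd (snd x))))) (fst x))" for x
  have "polynomial_function M"
    unfolding M_def adj_mult_def column_def
    apply (rule polynomial_function_vec, rule polynomial_function_vec)
    apply simp
    apply (rule polynomial_function_nth)
    apply (rule polynomial_function_cramer_vec)
     apply (intro polynomial_intros polynomial_function_frame_sum)
    apply (rule polynomial_function_vec)
    apply simp
    apply (intro polynomial_intros)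
    done
  moreover have "real_polynomial_function q"
    unfolding real_polynomial_function_eq q_def
  proof (rule polynomial_function_det)
    fix i k
    show "polynomial_function (\<lambda>x. pencil_columns J (fst (snd x)) (fst (snd (snd x))) (fst (snd (snd (snd x))))
      (fst (snd (snd (snd (snd x))))) (snd (snd (snd (snd (snd x))))) (fst x) $ i $ k)"
      unfolding pencil_columns_def pencil_matrix_def
      by (cases "k \<in> J"; simp)
        (intro polynomial_intros polynomial_function_matrix_vector_mult polynomial_function_cramer_vec
          polynomial_function_frame_sum)+
  qed
  ultimately obtain R where R: "real_polynomial_function R"
    "\<And>x \<mu> v. R x \<noteq> 0 \<Longrightarrow> v \<noteq> 0 \<Longrightarrow> M x *v v = \<mu> *\<^sub>R v \<Longrightarrow> q (\<mu>, x) \<noteq> 0"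
    "\<And>x. (\<And>i j. i \<noteq> j \<Longrightarrow> M x $ i $ j = 0) \<Longrightarrow> (\<And>i. q (M x $ i $ i, x) \<noteq> 0) \<Longrightarrow> R x \<noteq> 0"
    using eigenvalue_elimination[of q M] by metis
  show ?thesis
  proof (intro exI[of _ R] conjI allI impI)
    show "real_polynomial_function R" by fact
  next
    fix A K B g w \<mu> v
    assume "R (A, K, B, g, w) \<noteq> 0" "v \<noteq> 0" "adj_mult (K + frame_sum J g) A *v v = \<mu> *\<^sub>R v"
    then show "det (pencil_columns J A K B g w \<mu>) \<noteq> 0"
      using R(2)[of "(A, K, B, g, w)" v \<mu>] by (simp add: M_def q_def)
  next
    fix A K :: "real^'n^'n" and B :: "real^'n^'n^'n" and g w
    assume "\<forall>i j. i \<noteq> j \<longrightarrow> adj_mult (K + frame_sum J g) A $ i $ j = 0"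
      "\<forall>i. det (pencil_columns J A K B g w (adj_mult (K + frame_sum J g) A $ i $ i)) \<noteq> 0"
    then show "R (A, K, B, g, w) \<noteq> 0"
      using R(3)[of "(A, K, B, g, w)"] by (simp add: M_def q_def)
  qed
qed

lemma frame_decomposition:
  fixes g :: "real^'n^'n"
  obtains y z where "x = y + z" "y \<in> span ((\<lambda>i. column i g) ` J)" "\<And>i. i \<in> J \<Longrightarrow> column i g \<bullet> z = 0"
proof -
  obtain y z where "y \<in> span ((\<lambda>i. column i g) ` J)" "x = y + z"
    "\<And>w. w \<in> span ((\<lambda>i. column i g) ` J) \<Longrightarrow> orthogonal z w"
    using orthogonal_subspace_decomp_exists by blast
  moreover then have "column i g \<bullet> z = 0" if "i \<in> J" for i
    using that by (metis imageI inner_commute orthogonal_def span_base)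
  ultimately show ?thesis using that by blast
qed

lemma kernel_of_span:
  fixes K g :: "real^'n^'n"
  assumes "\<And>i. i \<in> J \<Longrightarrow> K *v column i g = 0" "y \<in> span ((\<lambda>i. column i g) ` J)"
  shows "K *v y = 0"
proof -
  have "span ((\<lambda>i. column i g) ` J) \<subseteq> {y. K *v y = 0}"
    by (rule span_minimal)
      (auto simp: assms(1) subspace_def matrix_vector_right_distrib matrix_vector_mult_scaleR)
  then show ?thesis using assms(2) by blast
qed

lemma psd_from_complement:
  fixes K g :: "real^'n^'n"
  assumes "K \<in> sym_mats" "\<And>i. i \<in> J \<Longrightarrow> K *v column i g = 0"
    "\<And>z. (\<And>i. i \<in> J \<Longrightarrow> column i g \<bullet> z = 0) \<Longrightarrow> 0 \<le> z \<bullet> (K *v z)"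
  shows "K \<in> psd_mats"
proof -
  have "0 \<le> x \<bullet> (K *v x)" for x
  proof -
    obtain y z where x: "x = y + z" "y \<in> span ((\<lambda>i. column i g) ` J)" "\<And>i. i \<in> J \<Longrightarrow> column i g \<bullet> z = 0"
      using frame_decomposition[of x g J] by blast
    have Ky: "K *v y = 0" using kernel_of_span[OF assms(2) x(2)] by blast
    then have "y \<bullet> (K *v z) = 0" by (simp only: sym_mats_inner[OF assms(1)] inner_zero_left)
    then have "x \<bullet> (K *v x) = z \<bullet> (K *v z)"
      by (simp add: x(1) matrix_vector_right_distrib inner_add_left Ky)
    then show ?thesis using assms(3)[of z] x(3) by simp
  qed
  then show ?thesis using assms(1) by (simp add: psd_mats_def)
qed

lemma complement_nontrivial:
  fixes g :: "real^'n^'n"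
  assumes "det g \<noteq> 0" "k \<notin> J"
  obtains x where "x \<noteq> 0" "\<And>i. i \<in> J \<Longrightarrow> column i g \<bullet> x = 0"
proof -
  have "det (transpose g) \<noteq> 0" using assms by simp
  then obtain x where x: "transpose g *v x = axis k 1" using cramer[of "transpose g"] by blast
  have "column i g \<bullet> x = (if i = k then 1 else 0)" for i
    using arg_cong[OF x, of "\<lambda>v. v $ i"]
    by (simp add: matrix_vector_mult_def inner_vec_def column_def transpose_def axis_def)
  moreover have "x \<noteq> 0" using x by (metis axis_eq_0_iff matrix_vector_mult_0_right zero_neq_one)
  ultimately show ?thesis using that[of x] assms(2) by metis
qed

text \<open>Let \<open>W\<close> be the span of the columns of \<open>g\<close> in \<open>J\<close>, and \<open>K\<close> positive definite on its complement. Subtracting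
from \<open>A\<close> the multiple of \<open>K\<close> given by the minimum \<open>c\<close> of the Rayleigh quotient gives a semidefinite matrix that
is singular on the complement of \<open>W\<close>. The assumption on the determinants makes \<open>c\<close> a simple eigenvalue, so that
the kernel grows by one line only, and it gives the spanning property needed to move this line freely.\<close>

lemma pencil_step:
  fixes A K :: "real^'n^'n" and B :: "real^'n^'n^'n"
  assumes sym: "A \<in> sym_mats" "K \<in> sym_mats" "\<And>k. B $ k \<in> sym_mats"
    and ker: "\<And>i. i \<in> J \<Longrightarrow> A *v column i g = 0" "\<And>i. i \<in> J \<Longrightarrow> K *v column i g = 0"
      "\<And>k i. i \<in> J \<Longrightarrow> B $ k *v column i g = 0"
    and pd: "K + frame_sum J g \<in> pd_mats"
    and g: "det g \<noteq> 0" and k0: "k0 \<notin> J"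
    and q: "\<And>\<mu> v. v \<noteq> 0 \<Longrightarrow> adj_mult (K + frame_sum J g) A *v v = \<mu> *\<^sub>R v
      \<Longrightarrow> det (pencil_columns J A K B g w \<mu>) \<noteq> 0"
  obtains c v where "v \<noteq> 0" "\<And>i. i \<in> J \<Longrightarrow> column i g \<bullet> v = 0"
    "A - c *\<^sub>R K \<in> psd_mats" "(A - c *\<^sub>R K) *v v = 0"
    "\<forall>x. (A - c *\<^sub>R K) *v x = 0 \<longrightarrow> (\<forall>i\<in>J. column i g \<bullet> x = 0) \<longrightarrow> x \<in> span {v}"
    "\<forall>y. (\<forall>i\<in>J. column i g \<bullet> y = 0) \<longrightarrow> (\<exists>z. y = (\<Sum>k\<in>-J. z k *\<^sub>R (B $ k *v v)))"
proof -
  define V where "V = {x. \<forall>i\<in>J. column i g \<bullet> x = 0}"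
  define F where "F = frame_sum J g"
  define G where "G = K + F"
  have V: "subspace V" by (auto simp: V_def subspace_def inner_add_right)
  have Fx: "F *v x = 0" if "x \<in> V" for x using that by (simp add: F_def V_def frame_sum_eq_0)
  have posK: "0 < x \<bullet> (K *v x)" if "x \<in> V" "x \<noteq> 0" for x
  proof -
    have "0 < x \<bullet> (G *v x)" using pd that(2) by (simp add: pd_mats_def G_def F_def)
    then show ?thesis by (simp add: G_def matrix_vector_mult_add_rdistrib Fx[OF that(1)])
  qed
  obtain x0 where x0: "x0 \<noteq> 0" "x0 \<in> V" 
    by (rule complement_nontrivial[OF g k0], rule that) (auto simp: V_def)
  have unit: "(1 / norm x) *\<^sub>R x \<in> V \<inter> sphere 0 1" if "x \<in> V" "x \<noteq> 0" for x
    using that V by (auto intro: subspace_scale)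
  have "compact (V \<inter> sphere 0 1)" by (intro closed_Int_compact closed_subspace V compact_sphere)
  moreover have "V \<inter> sphere 0 1 \<noteq> {}" using unit[OF x0(2,1)] by blast
  moreover have "continuous_on (V \<inter> sphere 0 1) (\<lambda>x. x \<bullet> (A *v x) / (x \<bullet> (K *v x)))"
  proof (intro continuous_intros matrix_vector_mult_linear_continuous_on ballI)
    fix x assume "x \<in> V \<inter> sphere 0 1"
    then have "x \<in> V" "x \<noteq> 0" by auto
    then show "x \<bullet> (K *v x) \<noteq> 0" using posK by fastforce
  qed
  ultimately obtain v where v: "v \<in> V \<inter> sphere 0 1"
    "\<And>x. x \<in> V \<inter> sphere 0 1 \<Longrightarrow> v \<bullet> (A *v v) / (v \<bullet> (K *v v)) \<le> x \<bullet> (A *v x) / (x \<bullet> (K *v x))"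
    using continuous_attains_inf[of "V \<inter> sphere 0 1" "\<lambda>x. x \<bullet> (A *v x) / (x \<bullet> (K *v x))"] by metis
  define c where "c = v \<bullet> (A *v v) / (v \<bullet> (K *v v))"
  have vV: "v \<in> V" "v \<noteq> 0" using v(1) by auto
  define K' where "K' = A - c *\<^sub>R K"
  have qf: "x \<bullet> (K' *v x) = x \<bullet> (A *v x) - c * (x \<bullet> (K *v x))" for x
    by (simp add: K'_def matrix_vector_mult_diff_rdistrib inner_diff_right scaleR_matrix_vector_assoc[symmetric])
  have nonneg: "0 \<le> x \<bullet> (K' *v x)" if "x \<in> V" for x
  proof (cases "x = 0")
    case False
    have "c \<le> x \<bullet> (A *v x) / (x \<bullet> (K *v x))"
      using v(2)[OF unit[OF that False]] False by (simp add: c_def matrix_vector_mult_scaleR)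
    then show ?thesis using posK[OF that False] by (simp add: qf field_simps)
  qed simp
  have symK': "K' \<in> sym_mats" unfolding K'_def
    by (intro subspace_diff subspace_scale subspace_sym_mats sym)
  have kerK': "K' *v column i g = 0" if "i \<in> J" for i
    using ker(1,2)[OF that] by (simp add: K'_def matrix_vector_mult_diff_rdistrib scaleR_matrix_vector_assoc[symmetric])
  have psd: "K' \<in> psd_mats"
    by (rule psd_from_complement[OF symK' kerK']) (auto intro: nonneg simp: V_def)
  have "v \<bullet> (K' *v v) = 0" using posK[OF vV] by (simp add: qf c_def)
  then have K'v: "K' *v v = 0" by (rule psd_kernel[OF psd])
  then have Av: "A *v v = c *\<^sub>R (K *v v)"
    by (simp add: K'_def matrix_vector_mult_diff_rdistrib scaleR_matrix_vector_assoc[symmetric])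
  \<comment> \<open>adj_mult G A is det G times the inverse of G times A, hence this rescaling of c\<close>
  define \<mu> where "\<mu> = det G * c"
  have "A *v v = G *v (c *\<^sub>R v)"
    by (simp add: Av G_def matrix_vector_mult_add_rdistrib Fx[OF vV(1)] matrix_vector_mult_scaleR)
  then have "adj_mult G A *v v = \<mu> *\<^sub>R v"
    by (simp add: adj_mult_vec cramer_vec_mult \<mu>_def)
  then have qmu: "det (pencil_columns J A K B g w \<mu>) \<noteq> 0" using q[OF vV(2)] by (simp add: G_def F_def)
  define N where "N = pencil_matrix J A K g \<mu>"
  have Nx: "N *v x = det G *\<^sub>R (K' *v x) + F *v x" for x
    by (simp add: N_def pencil_matrix_def \<mu>_def G_def F_def K'_def algebra_simps
        matrix_vector_mult_diff_rdistrib scaleR_matrix_vector_assoc[symmetric])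
  have Nv: "N *v v = 0" by (simp add: Nx K'v Fx[OF vV(1)])
  have detN: "det N = 0" using det_nonzero_kernel[of N v] Nv vV(2) by blast
  define cv where "cv = cramer_vec N w"
  have Ncv: "N *v cv = 0" by (simp add: cv_def mult_cramer_vec detN)
  have detG: "det G > 0" using pd_det_pos pd by (simp add: G_def F_def)
  have cvV: "cv \<in> V"
  proof -
    have "0 = det G * (cv \<bullet> (K' *v cv)) + cv \<bullet> (F *v cv)"
      using arg_cong[OF Ncv, of "(\<bullet>) cv"] by (simp add: Nx inner_add_right)
    moreover have "0 \<le> det G * (cv \<bullet> (K' *v cv))" using psd detG by (simp add: psd_mats_def)
    moreover have "0 \<le> cv \<bullet> (F *v cv)" using frame_sum_psd[of J g] by (simp add: psd_mats_def F_def)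
    ultimately have "cv \<bullet> (F *v cv) = 0" by linarith
    then have "F *v cv = 0" using psd_kernel[OF frame_sum_psd] by (simp add: F_def)
    then show ?thesis by (simp add: F_def V_def frame_sum_eq_0)
  qed
  have "cv \<noteq> 0"
  proof
    assume "cv = 0"
    have "column k0 (pencil_columns J A K B g w \<mu>) = B $ k0 *v cv"
      using k0 by (simp add: pencil_columns_def column_def vec_eq_iff cv_def N_def)
    with \<open>cv = 0\<close> have "column k0 (pencil_columns J A K B g w \<mu>) = 0" by simp
    then show False using qmu det_zero_column by blast
  qed
  then obtain l where l: "cv $ l \<noteq> 0" by (auto simp: vec_eq_iff)
  \<comment> \<open>the l-th entry of the Cramer vector is the determinant of N with column l replaced, and replacing a column does not affect vectors whose l-th entry vanishes\<close>
  have line: "u = 0" if "N *v u = 0" "u $ l = 0" for u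
  proof -
    let ?Nl = "\<chi> i j. if j = l then w $ i else N $ i $ j"
    have e: "?Nl *v u = N *v u"
      unfolding matrix_vector_mult_def using that(2) by (auto simp: vec_eq_iff intro!: sum.cong)
    have "det ?Nl \<noteq> 0" using l by (simp add: cv_def cramer_vec_def)
    from det_nonzero_kernel[OF this, of u] show "u = 0" unfolding e that(1) by simp
  qed
  have vl: "v $ l \<noteq> 0" using line[OF Nv] vV(2) by blast
  have kerN: "u = (u $ l / v $ l) *\<^sub>R v" if "N *v u = 0" for u
  proof -
    have "N *v (u - (u $ l / v $ l) *\<^sub>R v) = 0"
      by (simp add: matrix_vector_mult_diff_distrib matrix_vector_mult_scaleR that Nv)
    from line[OF this] vl show ?thesis by simp
  qed
  define s where "s = cv $ l / v $ l"
  have cvs: "cv = s *\<^sub>R v" using kerN[OF Ncv] by (simp add: s_def)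
  have kernel: "x \<in> span {v}" if "K' *v x = 0" "\<And>i. i \<in> J \<Longrightarrow> column i g \<bullet> x = 0" for x
  proof -
    have "x \<in> V" using that(2) by (simp add: V_def)
    then have "N *v x = 0" by (simp add: Nx that(1) Fx)
    from kerN[OF this] show ?thesis by (metis span_base span_scale singletonI)
  qed
  have spanning: "\<exists>z. y = (\<Sum>k\<in>-J. z k *\<^sub>R (B $ k *v v))"
    if y: "\<And>i. i \<in> J \<Longrightarrow> column i g \<bullet> y = 0" for y
  proof -
    define Q where "Q = pencil_columns J A K B g w \<mu>"
    obtain z where z: "Q *v z = y" using cramer[OF qmu] unfolding Q_def by blast
    have col: "column k Q = (if k \<in> J then column k g else B $ k *v cv)" for k
      by (simp add: Q_def pencil_columns_def column_def vec_eq_iff cv_def N_def)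
    define t where "t = (\<Sum>k\<in>J. z $ k *\<^sub>R column k g)"
    define u where "u = (\<Sum>k\<in>-J. z $ k *\<^sub>R (B $ k *v cv))"
    have "y = (\<Sum>k\<in>UNIV. z $ k *\<^sub>R column k Q)" using z by (simp add: matrix_vector_mult_columns)
    also have "\<dots> = (\<Sum>k\<in>J. z $ k *\<^sub>R column k Q) + (\<Sum>k\<in>-J. z $ k *\<^sub>R column k Q)"
      by (subst sum.union_disjoint[symmetric]) (auto simp: Compl_partition)
    also have "\<dots> = t + u" by (simp add: t_def u_def col)
    finally have ytu: "y = t + u" .
    have "column i g \<bullet> u = 0" if "i \<in> J" for i
      using ker(3)[OF that] by (simp add: u_def inner_sum_right sym_mats_inner[OF sym(3)])
    then have "column i g \<bullet> t = 0" if "i \<in> J" for i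
      using y[OF that] that by (simp add: ytu inner_add_right)
    then have "t \<bullet> t = 0" by (subst (1) t_def) (simp add: inner_sum_left)
    then have "y = (\<Sum>k\<in>-J. (z $ k * s) *\<^sub>R (B $ k *v v))"
      using ytu by (simp add: u_def cvs matrix_vector_mult_scaleR)
    then show ?thesis by (rule exI[of _ "\<lambda>k. z $ k * s"])
  qed
  show ?thesis
    by (rule that[of v c]) (use vV psd K'v kernel spanning in \<open>auto simp: V_def K'_def\<close>)
qed

section \<open>Stability of kernels under perturbation of the frame\<close>

lemma norm_transpose: "norm (transpose A) = norm A" for A :: "real^'n^'n"
proof -
  have "transpose A \<bullet> transpose A = (\<Sum>i\<in>UNIV. \<Sum>j\<in>UNIV. A $ j $ i * A $ j $ i)"
    by (simp add: inner_vec_def transpose_def)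
  also have "\<dots> = A \<bullet> A" by (subst sum.swap) (simp add: inner_vec_def)
  finally show ?thesis by (simp add: norm_eq_sqrt_inner)
qed

lemma pd_open_in_sym:
  fixes P :: "real^'n^'n"
  assumes "P \<in> pd_mats"
  obtains d where "d > 0" "\<And>X. X \<in> sym_mats \<Longrightarrow> norm (X - P) < d \<Longrightarrow> X \<in> pd_mats"
proof -
  obtain k where k: "k > 0" "\<And>x. k * (norm x)\<^sup>2 \<le> x \<bullet> (P *v x)"
    using coercive_on_subspace[OF subspace_UNIV, of P] assms by (auto simp: pd_mats_def)
  obtain C where C: "C > 0" "\<And>A (x::real^'n). norm (A *v x :: real^'n) \<le> norm A * norm x * C"
    using bounded_bilinear.pos_bounded[OF bounded_bilinear_matrix_vector_mult] by blast
  have "X \<in> pd_mats" if X: "X \<in> sym_mats" "norm (X - P) < k / C" for X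
  proof -
    have "0 < x \<bullet> (X *v x)" if "x \<noteq> 0" for x
    proof -
      have "\<bar>x \<bullet> ((X - P) *v x)\<bar> \<le> norm x * norm ((X - P) *v x)" by (rule Cauchy_Schwarz_ineq2)
      also have "\<dots> \<le> norm x * (norm (X - P) * norm x * C)" by (intro mult_left_mono C) auto
      also have "\<dots> = (norm (X - P) * C) * (norm x)\<^sup>2" by (simp add: power2_eq_square)
      also have "\<dots> < k * (norm x)\<^sup>2" using X(2) C(1) that by (intro mult_strict_right_mono) (auto simp: field_simps)
      finally have "\<bar>x \<bullet> ((X - P) *v x)\<bar> < x \<bullet> (P *v x)" using k(2)[of x] by linarith
      then show ?thesis by (simp add: matrix_vector_mult_diff_rdistrib inner_diff_right)
    qed
    with X(1) show ?thesis by (simp add: pd_mats_def)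
  qed
  then show ?thesis using that[of "k / C"] k(1) C(1) by simp
qed

text \<open>Transversality of \<open>L\<close> and the space of symmetric matrices that vanish on the span of the columns of \<open>g\<close>
in \<open>J\<close>: their sum is the space of all symmetric matrices.\<close>

definition transversal :: "(real^'n^'n) set \<Rightarrow> 'n set \<Rightarrow> real^'n^'n \<Rightarrow> bool" where
  "transversal L J g \<longleftrightarrow> (\<forall>S\<in>sym_mats. \<exists>K\<in>L. \<forall>i\<in>J. K *v column i g = S *v column i g)"

lemma transversal_linear_lift:
  fixes L :: "(real^'n^'n) set"
  assumes "subspace L" "transversal L J g"
  obtains r where "linear r" "\<And>S. r S \<in> L" "\<And>S i. S \<in> sym_mats \<Longrightarrow> i \<in> J \<Longrightarrow> r S *v column i g = S *v column i g"
proof -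
  define gJ :: "real^'n^'n" where "gJ = (\<chi> i j. if j \<in> J then g $ i $ j else 0)"
  define \<rho> where "\<rho> Y = Y ** gJ" for Y :: "real^'n^'n"
  have col: "column i (\<rho> Y) = (if i \<in> J then Y *v column i g else 0)" for Y i
    by (simp add: \<rho>_def gJ_def column_def matrix_matrix_mult_def matrix_vector_mult_def vec_eq_iff)
  have eq: "\<rho> Y = \<rho> Z \<longleftrightarrow> (\<forall>i\<in>J. Y *v column i g = Z *v column i g)" for Y Z
  proof -
    have "\<rho> Y = \<rho> Z \<longleftrightarrow> (\<forall>i. column i (\<rho> Y) = column i (\<rho> Z))"
      by (auto simp: vec_eq_iff column_def)
    then show ?thesis by (auto simp: col)
  qed
  have "linear \<rho>" unfolding \<rho>_def
    using bounded_linear.linear[OF bounded_bilinear.bounded_linear_left[OF bounded_bilinear_matrix_matrix_mult]] .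
  then obtain s where s: "range s \<subseteq> L" "linear s" "\<And>v. v \<in> \<rho> ` L \<Longrightarrow> \<rho> (s v) = v"
    using linear_exists_right_inverse_on[of \<rho> L] assms(1) by auto
  have "\<rho> (s (\<rho> S)) = \<rho> S" if "S \<in> sym_mats" for S
  proof -
    from bspec[OF assms(2)[unfolded transversal_def] that]
    obtain K where "K \<in> L" "\<forall>i\<in>J. K *v column i g = S *v column i g" by (elim bexE) (rule that)
    then have "\<rho> S \<in> \<rho> ` L" using eq[of K S] by (metis imageI)
    then show ?thesis by (rule s(3))
  qed
  then have "(s \<circ> \<rho>) S *v column i g = S *v column i g" if "S \<in> sym_mats" "i \<in> J" for S i
    using that eq[of "s (\<rho> S)" S] by simp
  moreover have "linear (s \<circ> \<rho>)" using \<open>linear \<rho>\<close> s(2) by (rule linear_compose)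
  moreover have "(s \<circ> \<rho>) S \<in> L" for S using s(1) by auto
  ultimately show ?thesis using that by blast
qed

lemma sym_congruence: "S \<in> sym_mats \<Longrightarrow> transpose h ** S ** h \<in> sym_mats"
  by (simp add: sym_mats_def matrix_transpose_mul matrix_mul_assoc transpose_transpose)

lemma column_matrix_mult: "column i (A ** B) = A *v column i B"
  by (simp add: column_def matrix_matrix_mult_def matrix_vector_mult_def vec_eq_iff)

text \<open>For a nearby frame \<open>g' = h ** g\<close>, a matrix \<open>K' = K + r S\<close> of \<open>L\<close> is sought with \<open>h\<^sup>T K' h\<close> vanishing on the
columns of \<open>g\<close> in \<open>J\<close>. As \<open>r S\<close> and \<open>S\<close> agree on these columns, it suffices that \<open>h\<^sup>T K' h = K + r S - S\<close>. This is
a linear equation for \<open>S\<close> whose operator \<open>F\<close> is the identity for \<open>h = 1\<close>. It is therefore invertible for \<open>h\<close>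
close to the identity, with a small solution.\<close>

lemma transversal_kernel_stable:
  fixes L :: "(real^'n^'n) set"
  assumes L: "subspace L" "L \<subseteq> sym_mats" and tr: "transversal L J g" and g: "det g \<noteq> 0"
    and K: "K \<in> L" "\<And>i. i \<in> J \<Longrightarrow> K *v column i g = 0" and e: "e > 0"
  obtains d where "d > 0" "\<And>g'. norm (g' - g) < d \<Longrightarrow>
    \<exists>K'\<in>L. norm (K' - K) < e \<and> (\<forall>i\<in>J. K' *v column i g' = 0)"
proof -
  obtain r where r: "linear r" "\<And>S. r S \<in> L" "\<And>S i. S \<in> sym_mats \<Longrightarrow> i \<in> J \<Longrightarrow> r S *v column i g = S *v column i g"
    by (rule transversal_linear_lift[OF L(1) tr], rule that)
  obtain Cr where Cr: "Cr > 0" "\<And>S. norm (r S) \<le> norm S * Cr"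
    using bounded_linear.pos_bounded[OF linear_linear[THEN iffD2, OF r(1)]] by blast
  obtain C where "C > 0" "\<forall>(A :: real^'n^'n) (B :: real^'n^'n). norm (A ** B) \<le> norm A * norm B * C"
    using bounded_bilinear.pos_bounded[OF bounded_bilinear_matrix_matrix_mult[where ?'n='n]] by (elim exE conjE) (rule that)
  then have C: "C > 0" "\<And>(A :: real^'n^'n) (B :: real^'n^'n). norm (A ** B) \<le> norm A * norm B * C" by simp_all
  obtain gi where gi: "g ** gi = mat 1" "gi ** g = mat 1"
    using g by (metis invertible_def invertible_det_nz)
  define a where "a = 2 * C + C * C"
  have a: "a > 0" using C by (simp add: a_def add_pos_pos)
  have congr: "norm (transpose (mat 1 + E) ** Y ** (mat 1 + E) - Y) \<le> a * norm E * norm Y"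
    if "norm E \<le> 1" for E Y :: "real^'n^'n"
  proof -
    have "transpose (mat 1 + E) = mat 1 + transpose E"
      by (simp add: transpose_def vec_eq_iff mat_def)
    then have "transpose (mat 1 + E) ** Y ** (mat 1 + E) - Y = Y ** E + transpose E ** Y + transpose E ** Y ** E"
      by (simp add: matrix_add_ldistrib matrix_add_rdistrib)
    also have "norm \<dots> \<le> norm (Y ** E) + norm (transpose E ** Y) + norm (transpose E ** Y ** E)"
      by (meson norm_triangle_le norm_triangle_ineq add_mono order_refl order_trans)
    also have "norm (Y ** E) \<le> C * norm E * norm Y" using C(2)[of Y E] by (simp add: mult_ac)
    also have TE: "norm (transpose E ** Y) \<le> C * norm E * norm Y"
      using C(2)[of "transpose E" Y] by (simp add: norm_transpose mult_ac)
    also have "norm (transpose E ** Y ** E) \<le> C * C * norm E * norm Y"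
    proof -
      have "norm (transpose E ** Y ** E) \<le> norm (transpose E ** Y) * norm E * C" by (rule C(2))
      also have "\<dots> \<le> (C * norm E * norm Y) * 1 * C"
        using TE that C(1) by (intro mult_right_mono mult_mono) auto
      finally show ?thesis by (simp add: mult_ac)
    qed
    finally show ?thesis by (simp add: a_def algebra_simps)
  qed
  \<comment> \<open>F differs from the identity by at most a * Cr * norm E, which d1 bounds by one half; the summand 1 in b only guarantees that b is positive\<close>
  define b where "b = Cr * (2 * (a * norm K)) + 1"
  have b: "b > 0" using Cr a by (simp add: b_def add_nonneg_pos)
  define d1 where "d1 = Min {1, 1 / (2 * (a * Cr)), e / (2 * b)}"
  have d1: "d1 > 0" "d1 \<le> 1" "d1 \<le> 1 / (2 * (a * Cr))" "d1 \<le> e / (2 * b)"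
    using a Cr b e by (auto simp: d1_def)
  have main: "\<exists>K'\<in>L. norm (K' - K) < e \<and> (\<forall>i\<in>J. K' *v column i g' = 0)"
    if hd: "det g' \<noteq> 0" "norm ((g' - g) ** gi) \<le> d1" for g'
  proof -
    define E where "E = (g' - g) ** gi"
    define h where "h = mat 1 + E"
    have E: "norm E \<le> 1" "norm E \<le> 1 / (2 * (a * Cr))" "norm E \<le> e / (2 * b)"
      using hd(2) d1 by (auto simp: E_def)
    have h: "h = g' ** gi" by (simp add: h_def E_def matrix_diff_rdistrib gi)
    have hg: "h ** g = g'" by (simp add: h matrix_mul_assoc[symmetric] gi)
    have "det h \<noteq> 0" using hd(1) hg by (metis det_mul mult_zero_left)
    define F where "F S = transpose h ** r S ** h - r S + S" for S
    have F: "linear F"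
    proof (rule linearI)
      show "F (x + y) = F x + F y" for x y
        by (simp add: F_def linear_add[OF r(1)] matrix_add_ldistrib matrix_add_rdistrib)
      show "F (c *\<^sub>R x) = c *\<^sub>R F x" for c x
        by (simp add: F_def linear_scale[OF r(1)] algebra_simps matrix_mult_scaleR_right matrix_mult_scaleR_left)
    qed
    have near: "norm (F S - S) \<le> norm S / 2" for S
    proof -
      have "norm (F S - S) \<le> a * norm E * norm (r S)"
        using congr[OF E(1), of "r S"] by (simp add: F_def h_def)
      also have "\<dots> \<le> a * (1 / (2 * (a * Cr))) * (norm S * Cr)"
        using E(2) Cr a by (intro mult_mono) auto
      also have "\<dots> = norm S / 2" using a Cr(1) by simp
      finally show ?thesis .
    qed
    have below: "norm S \<le> 2 * norm (F S)" for S
      using near[of S] norm_triangle_ineq2[of S "F S"] by (simp add: norm_minus_commute)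
    have "inj F" using below F by (metis linear_injective_0 norm_le_zero_iff norm_zero mult_zero_right)
    then have "surj F" using F by (simp add: linear_injective_imp_surjective)
    then obtain S where S: "F S = K - transpose h ** K ** h" by (metis surjD)
    have "norm S \<le> 2 * norm (K - transpose h ** K ** h)" using below[of S] S by simp
    also have "\<dots> \<le> 2 * (a * norm E * norm K)"
      using congr[OF E(1), of K] by (simp add: h_def norm_minus_commute)
    finally have nS: "norm S \<le> 2 * (a * norm E * norm K)" .
    have symK: "K \<in> sym_mats" "r S \<in> sym_mats" using K(1) r(2) L(2) by auto
    have "S = K - transpose h ** K ** h - transpose h ** r S ** h + r S"
      using S by (simp add: F_def algebra_simps)
    moreover have "\<dots> \<in> sym_mats"
      by (intro subspace_add subspace_diff subspace_sym_mats sym_congruence symK)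
    ultimately have symS: "S \<in> sym_mats" by metis
    define K' where "K' = K + r S"
    have "K' \<in> L" unfolding K'_def using K(1) r(2) L(1) by (simp add: subspace_add)
    moreover have "norm (K' - K) < e"
    proof -
      have "norm (r S) \<le> (2 * (a * norm E * norm K)) * Cr"
        using Cr(2)[of S] nS Cr(1) by (meson mult_right_mono less_imp_le order_trans)
      also have "\<dots> = (Cr * (2 * (a * norm K))) * norm E" by simp
      also have "\<dots> \<le> b * norm E" by (rule mult_right_mono) (auto simp: b_def)
      also have "\<dots> \<le> b * (e / (2 * b))" using E(3) b by (intro mult_left_mono) auto
      also have "\<dots> < e" using b e by simp
      finally show ?thesis by (simp add: K'_def)
    qed
    moreover have "K' *v column i g' = 0" if i: "i \<in> J" for i
    proof -
      have "transpose h ** K' ** h = K + r S - S"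
        using S by (simp add: F_def K'_def matrix_add_ldistrib matrix_add_rdistrib algebra_simps)
      then have "(transpose h ** K' ** h) *v column i g = 0"
        using K(2)[OF i] r(3)[OF symS i] by (simp add: matrix_vector_mult_add_rdistrib matrix_vector_mult_diff_rdistrib)
      then have "transpose h *v (K' *v (h *v column i g)) = 0" by (simp add: matrix_vector_mul_assoc matrix_mul_assoc)
      then have "K' *v (h *v column i g) = 0" 
        using \<open>det h \<noteq> 0\<close> det_nonzero_kernel[of "transpose h"] by (metis det_transpose)
      then show ?thesis by (metis column_matrix_mult hg)
    qed
    ultimately show ?thesis by blast
  qed
  have "open {g' :: real^'n^'n. det g' \<noteq> 0}"
    by (intro open_Collect_neq continuous_on_const continuous_on_real_polynomial real_polynomial_function_det)
  then have "\<exists>d2>0. \<forall>g'. dist g' g < d2 \<longrightarrow> g' \<in> {g' :: real^'n^'n. det g' \<noteq> 0}"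
    using g unfolding open_dist by (elim ballE[of _ _ g]) simp_all
  then obtain d2 where d2: "d2 > 0" "\<And>g'. dist g' g < d2 \<Longrightarrow> det g' \<noteq> 0" by auto
  have gi0: "norm gi * C \<ge> 0" using C by simp
  define d where "d = min d2 (d1 / (norm gi * C + 1))"
  have "d > 0" using d2 d1 gi0 by (simp add: d_def)
  moreover have "\<exists>K'\<in>L. norm (K' - K) < e \<and> (\<forall>i\<in>J. K' *v column i g' = 0)" if "norm (g' - g) < d" for g'
  proof (rule main)
    show "det g' \<noteq> 0" using that d2 by (simp add: d_def dist_norm)
    have "norm ((g' - g) ** gi) \<le> norm (g' - g) * (norm gi * C)" using C(2)[of "g' - g" gi] by (simp add: mult_ac)
    also have "\<dots> \<le> d1 / (norm gi * C + 1) * (norm gi * C + 1)"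
      using that gi0 d1(1) by (intro mult_mono) (auto simp: d_def)
    also have "\<dots> = d1" using gi0 by simp
    finally show "norm ((g' - g) ** gi) \<le> d1" .
  qed
  ultimately show ?thesis using that by blast
qed

text \<open>That \<open>K\<close> is semidefinite with kernel exactly the span of the columns of \<open>g\<close> in \<open>J\<close>. The last condition
expresses that the kernel is not larger; in this form it is visibly open.\<close>

definition kernel_frame :: "real^'n^'n \<Rightarrow> 'n set \<Rightarrow> real^'n^'n \<Rightarrow> bool" where
  "kernel_frame K J g \<longleftrightarrow>
    K \<in> psd_mats \<and> (\<forall>i\<in>J. K *v column i g = 0) \<and> K + frame_sum J g \<in> pd_mats"

lemma kernel_frameI:
  fixes K g :: "real^'n^'n"
  assumes "K \<in> sym_mats" "\<And>i. i \<in> J \<Longrightarrow> K *v column i g = 0" "K + frame_sum J g \<in> pd_mats"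
  shows "kernel_frame K J g"
proof -
  have "K \<in> psd_mats"
  proof (rule psd_from_complement[OF assms(1,2)])
    fix z assume z: "\<And>i. i \<in> J \<Longrightarrow> column i g \<bullet> z = 0"
    then have "frame_sum J g *v z = 0" by (simp add: frame_sum_eq_0)
    then have "z \<bullet> (K *v z) = z \<bullet> ((K + frame_sum J g) *v z)"
      by (simp add: matrix_vector_mult_add_rdistrib)
    then show "0 \<le> z \<bullet> (K *v z)" using pd_mats_psd[OF assms(3)] by (simp add: psd_mats_def)
  qed auto
  then show ?thesis using assms by (simp add: kernel_frame_def)
qed

lemma kernel_frame_stable:
  fixes L :: "(real^'n^'n) set"
  assumes L: "subspace L" "L \<subseteq> sym_mats" and tr: "transversal L J g" and g: "det g \<noteq> 0"
    and K: "K \<in> L" "kernel_frame K J g"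
  shows "\<exists>U. open U \<and> g \<in> U \<and> (\<forall>g'\<in>U. \<exists>K'\<in>L. kernel_frame K' J g')"
proof -
  have pd: "K + frame_sum J g \<in> pd_mats" and ker: "\<And>i. i \<in> J \<Longrightarrow> K *v column i g = 0"
    using K(2) by (auto simp: kernel_frame_def)
  obtain d where d: "d > 0" "\<And>X. X \<in> sym_mats \<Longrightarrow> norm (X - (K + frame_sum J g)) < d \<Longrightarrow> X \<in> pd_mats"
    using pd_open_in_sym[OF pd] by blast
  have d2: "d / 2 > 0" using d(1) by simp
  obtain e where e: "e > 0" "\<And>g'. norm (g' - g) < e \<Longrightarrow>
    \<exists>K'\<in>L. norm (K' - K) < d / 2 \<and> (\<forall>i\<in>J. K' *v column i g' = 0)"
    by (rule transversal_kernel_stable[OF L tr g K(1) ker d2]) (assumption | rule that)+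
  have "isCont (frame_sum J) g"
    by (rule continuous_polymonial_function[OF polynomial_function_frame_sum[OF polynomial_function_id]])
  then obtain e' where e': "e' > 0" "\<And>g'. dist g' g < e' \<Longrightarrow> dist (frame_sum J g') (frame_sum J g) < d / 2"
    using d2 unfolding continuous_at_eps_delta by meson
  define U where "U = ball g (min e e')"
  have "\<exists>K'\<in>L. kernel_frame K' J g'" if "g' \<in> U" for g'
  proof -
    have n: "norm (g' - g) < e" "dist g' g < e'"
      using that by (simp_all add: U_def dist_norm norm_minus_commute)
    obtain K' where K': "K' \<in> L" "norm (K' - K) < d / 2" "\<forall>i\<in>J. K' *v column i g' = 0" using e(2)[OF n(1)] by blast
    have symK': "K' \<in> sym_mats" using K'(1) L(2) by blast
    have "norm (K' + frame_sum J g' - (K + frame_sum J g)) \<le> norm (K' - K) + norm (frame_sum J g' - frame_sum J g)"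
      using norm_triangle_ineq[of "K' - K" "frame_sum J g' - frame_sum J g"] by (simp add: algebra_simps)
    also have "\<dots> < d" using K'(2) e'(2)[OF n(2)] by (simp add: dist_norm)
    finally have "K' + frame_sum J g' \<in> pd_mats"
      by (intro d(2) subspace_add subspace_sym_mats symK' frame_sum_sym)
    then show ?thesis using kernel_frameI[OF symK'] K' by blast
  qed
  moreover have "g \<in> U" using e e' by (simp add: U_def)
  ultimately show ?thesis by (intro exI[of _ U]) (simp add: U_def)
qed

text \<open>Among the coordinates of \<open>v\<close> with respect to \<open>g\<close> some \<open>l\<close> outside \<open>J\<close> is nonzero, because \<open>v\<close> is orthogonal to
the columns in \<open>J\<close>. The vector \<open>v\<close> may then replace column \<open>l\<close>; the old column \<open>k\<close> is moved to position \<open>l\<close> so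
that \<open>v\<close> ends up at position \<open>k\<close>.\<close>

lemma frame_replace_column:
  fixes g :: "real^'n^'n"
  assumes g: "det g \<noteq> 0" and v: "v \<noteq> 0" "\<And>i. i \<in> J \<Longrightarrow> column i g \<bullet> v = 0" and k: "k \<notin> J"
  obtains g' where "det g' \<noteq> 0" "\<And>i. i \<in> J \<Longrightarrow> column i g' = column i g" "column k g' = v"
proof -
  obtain x where x: "g *v x = v" using cramer[OF g] by blast
  obtain l where l: "l \<notin> J" "x $ l \<noteq> 0"
  proof -
    have "\<exists>l. l \<notin> J \<and> x $ l \<noteq> 0"
    proof (rule ccontr)
      assume a: "\<not> ?thesis"
      have "v = (\<Sum>j\<in>UNIV. x $ j *\<^sub>R column j g)" using x by (simp add: matrix_vector_mult_columns)
      then have "v \<bullet> v = (\<Sum>j\<in>UNIV. x $ j *\<^sub>R column j g) \<bullet> v" by simp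
      also have "\<dots> = 0"
      proof -
        have "x $ j * (column j g \<bullet> v) = 0" for j using a v(2)[of j] by auto
        then show ?thesis by (simp only: inner_sum_left inner_scaleR_left sum.neutral_const)
      qed
      finally show False using v(1) by simp
    qed
    then show ?thesis using that by blast
  qed
  define g' where "g' = (\<chi> i j. if j = k then v $ i else if j = l then g $ i $ k else g $ i $ j)"
  have colk: "column k g' = v" by (simp add: g'_def column_def vec_eq_iff)
  have coll: "column l g' = column k g" if "l \<noteq> k" using that by (simp add: g'_def column_def vec_eq_iff)
  have colo: "column i g' = column i g" if "i \<noteq> k" "i \<noteq> l" for i using that by (simp add: g'_def column_def vec_eq_iff)
  have "det g' \<noteq> 0"
  proof (rule det_nonzeroI)
    fix y assume y: "g' *v y = 0"
    \<comment> \<open>the coordinates of g' *v y with respect to the old frame g\<close>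
    define z where "z = (\<chi> i. y $ k * x $ i + (if i = k then (if l = k then 0 else y $ l) else if i = l then 0 else y $ i))"
    have "g' *v y = y $ k *\<^sub>R v + (\<Sum>j\<in>UNIV - {k}. y $ j *\<^sub>R column j g')"
      by (simp add: matrix_vector_mult_columns sum.remove[of UNIV k] colk)
    also have "(\<Sum>j\<in>UNIV - {k}. y $ j *\<^sub>R column j g')
      = (\<Sum>i\<in>UNIV. (if i = k then (if l = k then 0 else y $ l) else if i = l then 0 else y $ i) *\<^sub>R column i g)"
      (is "_ = (\<Sum>i\<in>UNIV. ?F i)")
    proof -
      have F: "(\<Sum>i\<in>UNIV. ?F i) = ?F k + (\<Sum>i\<in>UNIV - {k}. ?F i)" by (rule sum.remove) auto
      show ?thesis
      proof (cases "l = k")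
        case True
        have "(\<Sum>j\<in>UNIV - {k}. y $ j *\<^sub>R column j g') = (\<Sum>i\<in>UNIV - {k}. ?F i)"
          by (rule sum.cong) (auto simp: colo True)
        then show ?thesis using F True by simp
      next
        case False
        have 1: "(\<Sum>j\<in>UNIV - {k}. y $ j *\<^sub>R column j g')
            = y $ l *\<^sub>R column l g' + (\<Sum>j\<in>UNIV - {k} - {l}. y $ j *\<^sub>R column j g')"
          using False by (intro sum.remove) auto
        have 2: "(\<Sum>j\<in>UNIV - {k}. ?F j) = ?F l + (\<Sum>j\<in>UNIV - {k} - {l}. ?F j)"
          using False by (intro sum.remove) auto
        have 3: "(\<Sum>j\<in>UNIV - {k} - {l}. y $ j *\<^sub>R column j g') = (\<Sum>j\<in>UNIV - {k} - {l}. ?F j)"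
          by (rule sum.cong) (auto simp: colo)
        show ?thesis unfolding F 1 2 3 using False by (simp add: coll)
      qed
    qed
    also have "y $ k *\<^sub>R v = (\<Sum>i\<in>UNIV. (y $ k * x $ i) *\<^sub>R column i g)"
      by (simp add: x[symmetric] matrix_vector_mult_columns scaleR_sum_right)
    finally have "g *v z = 0"
      using y by (simp add: z_def matrix_vector_mult_columns sum.distrib scaleR_add_left)
    then have "z = 0" using g by (simp add: det_nonzero_kernel)
    then have zi: "z $ i = 0" for i by simp
    have "y $ k = 0 \<or> l = k \<and> y $ k = 0"
      using zi[of l] l(2) by (cases "l = k") (auto simp: z_def)
    then have yk: "y $ k = 0" by blast
    have "y $ i = 0" for i
      using zi[of i] zi[of k] yk by (auto simp: z_def split: if_splits)
    then show "y = 0" by (simp add: vec_eq_iff)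
  qed
  moreover have "column i g' = column i g" if "i \<in> J" for i
    using that k l(1) by (intro colo) auto
  ultimately show ?thesis using that colk by blast
qed

section \<open>Charts of the Grassmannian\<close>

text \<open>The map \<open>\<beta>\<close> selects as many positions as \<open>L\<close> has dimensions. Column \<open>l\<close> lists the entries of
\<open>X $ l\<close> at these positions with respect to the frame \<open>g\<close>. If the determinant is nonzero, the selected entries
are coordinates on the span of \<open>X\<close>.\<close>

definition chart_matrix :: "('m \<Rightarrow> 'n \<times> 'n) \<Rightarrow> real^'n^'n^'m \<Rightarrow> real^'n^'n \<Rightarrow> real^'m^'m" where
  "chart_matrix \<beta> X g = (\<chi> k l. column (fst (\<beta> k)) g \<bullet> (X $ l *v column (snd (\<beta> k)) g))"

text \<open>The element of the span of \<open>X\<close> with coordinates \<open>a\<close>, up to the factor \<open>det (chart_matrix \<beta> X g)\<close>, which makes it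
polynomial in \<open>X\<close> and \<open>g\<close>.\<close>

definition chart_elem :: "('m::finite \<Rightarrow> 'n \<times> 'n) \<Rightarrow> real^'n^'n^'m \<Rightarrow> real^'n^'n \<Rightarrow> real^'m \<Rightarrow> real^'n^'n" where
  "chart_elem \<beta> X g a = (\<Sum>l\<in>UNIV. cramer_vec (chart_matrix \<beta> X g) a $ l *\<^sub>R X $ l)"

lemma chart_matrix_mult:
  "(chart_matrix \<beta> X g *v y) $ k = column (fst (\<beta> k)) g \<bullet> ((\<Sum>l\<in>UNIV. y $ l *\<^sub>R X $ l) *v column (snd (\<beta> k)) g)"
  by (simp add: chart_matrix_def matrix_vector_mult_def[of "vec_lambda _"] sum_matrix_vector_mult inner_sum_right
      scaleR_matrix_vector_assoc[symmetric] mult.commute)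

lemma chart_elem_coordinate:
  "column (fst (\<beta> k)) g \<bullet> (chart_elem \<beta> X g a *v column (snd (\<beta> k)) g) = det (chart_matrix \<beta> X g) * a $ k"
  unfolding chart_elem_def chart_matrix_mult[symmetric] by (simp add: mult_cramer_vec)

lemma chart_independent:
  assumes "det (chart_matrix \<beta> X g) \<noteq> 0"
  shows "inj (($) X) \<and> independent (range (($) X))"
  unfolding independent_family_iff
proof (intro allI impI)
  fix y :: "'a \<Rightarrow> real" and k
  assume y: "(\<Sum>k\<in>UNIV. y k *\<^sub>R X $ k) = 0"
  have "chart_matrix \<beta> X g *v (\<chi> k. y k) = 0"
    unfolding vec_eq_iff chart_matrix_mult using y by simp
  then have "(\<chi> k. y k) = 0" using assms by (simp add: det_nonzero_kernel)
  from arg_cong[OF this, of "\<lambda>v. v $ k"] show "y k = 0" by simp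
qed

lemma chart_elem_mem:
  assumes "subspace L" "\<And>l. X $ l \<in> L"
  shows "chart_elem \<beta> X g a \<in> L"
  unfolding chart_elem_def using assms by (intro subspace_sum subspace_scale) auto

lemma transpose_mult_component: "(transpose g *v y) $ l = column l g \<bullet> y"
  by (simp add: matrix_vector_mult_def transpose_def inner_vec_def column_def)

text \<open>Up to symmetry, every position in a row from \<open>J\<close> is selected by some \<open>k\<close>, and the row index of
\<open>\<beta> k\<close> witnesses this. Hence, for invertible \<open>g\<close>, a matrix of \<open>L\<close> vanishes on the columns of \<open>g\<close> in \<open>J\<close> if and only if its coordinates with
row index in \<open>J\<close> are zero, which yields a polynomial parametrization of these matrices by \<open>chart_elem\<close>.\<close>

definition covers :: "('m \<Rightarrow> 'n \<times> 'n) \<Rightarrow> 'n set \<Rightarrow> bool" where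
  "covers \<beta> J \<longleftrightarrow> (\<forall>i\<in>J. \<forall>l. \<exists>k. fst (\<beta> k) \<in> J \<and> (\<beta> k = (i, l) \<or> \<beta> k = (l, i)))"

lemma covers_kernel:
  fixes Z g :: "real^'n^'n"
  assumes \<beta>: "covers \<beta> J" and g: "det g \<noteq> 0" and Z: "Z \<in> sym_mats"
    and 0: "\<And>k. fst (\<beta> k) \<in> J \<Longrightarrow> column (fst (\<beta> k)) g \<bullet> (Z *v column (snd (\<beta> k)) g) = 0"
    and i: "i \<in> J"
  shows "Z *v column i g = 0"
proof -
  have "column l g \<bullet> (Z *v column i g) = 0" for l
  proof -
    obtain k where k: "fst (\<beta> k) \<in> J" "\<beta> k = (i, l) \<or> \<beta> k = (l, i)" using \<beta> i unfolding covers_def by blast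
    have "column i g \<bullet> (Z *v column l g) = column l g \<bullet> (Z *v column i g)"
      using sym_mats_inner[OF Z, of "column i g" "column l g"] by (simp add: inner_commute)
    then show ?thesis using 0[OF k(1)] k(2) by auto
  qed
  then have "transpose g *v (Z *v column i g) = 0"
    by (simp only: vec_eq_iff transpose_mult_component zero_index) simp
  then show ?thesis using det_nonzero_kernel[of "transpose g"] g by (metis det_transpose)
qed

text \<open>The coordinates of an element of \<open>L\<close> may be prescribed arbitrarily, in particular to be those of \<open>S\<close>.\<close>

lemma chart_transversal:
  fixes X :: "real^'n^'n^'m"
  assumes \<beta>: "covers \<beta> J" and g: "det g \<noteq> 0" and L: "subspace L" "L \<subseteq> sym_mats" "\<And>l. X $ l \<in> L"
    and chart: "det (chart_matrix \<beta> X g) \<noteq> 0"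
  shows "transversal L J g"
  unfolding transversal_def
proof
  fix S :: "real^'n^'n" assume S: "S \<in> sym_mats"
  define a where "a = (\<chi> k. (column (fst (\<beta> k)) g \<bullet> (S *v column (snd (\<beta> k)) g)) / det (chart_matrix \<beta> X g))"
  define Z where "Z = chart_elem \<beta> X g a"
  have ZL: "Z \<in> L" unfolding Z_def using L by (intro chart_elem_mem) auto
  have "S - Z \<in> sym_mats" using S ZL L(2) by (intro subspace_diff subspace_sym_mats) auto
  moreover have "column (fst (\<beta> k)) g \<bullet> ((S - Z) *v column (snd (\<beta> k)) g) = 0" for k
    using chart by (simp add: matrix_vector_mult_diff_rdistrib inner_diff_right Z_def chart_elem_coordinate)
      (simp add: a_def)
  ultimately have "(S - Z) *v column i g = 0" if "i \<in> J" for i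
    using covers_kernel[OF \<beta> g _ _ that] by blast
  then have "\<forall>i\<in>J. Z *v column i g = S *v column i g" by (simp add: matrix_vector_mult_diff_rdistrib)
  with ZL show "\<exists>K\<in>L. \<forall>i\<in>J. K *v column i g = S *v column i g" by blast
qed

section \<open>Enlarging the kernel\<close>

text \<open>The polynomial of \<open>pencil_polynomial_exists\<close>, chosen once for every \<open>J\<close>.\<close>

definition pencil_polynomial ::
  "'n set \<Rightarrow> ((real^'n^'n) \<times> (real^'n^'n) \<times> (real^'n^'n^'n) \<times> (real^'n^'n) \<times> (real^'n) \<Rightarrow> real)" where
  "pencil_polynomial J = (SOME R. real_polynomial_function R \<and>
    (\<forall>A K B g w \<mu> v. R (A, K, B, g, w) \<noteq> 0 \<longrightarrow> v \<noteq> 0 \<longrightarrow>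
      adj_mult (K + frame_sum J g) A *v v = \<mu> *\<^sub>R v \<longrightarrow> det (pencil_columns J A K B g w \<mu>) \<noteq> 0) \<and>
    (\<forall>A K B g w. (\<forall>i j. i \<noteq> j \<longrightarrow> adj_mult (K + frame_sum J g) A $ i $ j = 0) \<longrightarrow>
      (\<forall>i. det (pencil_columns J A K B g w (adj_mult (K + frame_sum J g) A $ i $ i)) \<noteq> 0) \<longrightarrow>
      R (A, K, B, g, w) \<noteq> 0))"

lemma pencil_polynomial:
  fixes J :: "'n::finite set"
  shows "real_polynomial_function (pencil_polynomial J)"
    and "\<And>A K B g w \<mu> v. pencil_polynomial J (A, K, B, g, w) \<noteq> 0 \<Longrightarrow> v \<noteq> 0 \<Longrightarrow>
      adj_mult (K + frame_sum J g) A *v v = \<mu> *\<^sub>R v \<Longrightarrow> det (pencil_columns J A K B g w \<mu>) \<noteq> 0"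
    and "\<And>A K B g w. (\<And>i j. i \<noteq> j \<Longrightarrow> adj_mult (K + frame_sum J g) A $ i $ j = 0) \<Longrightarrow>
      (\<And>i. det (pencil_columns J A K B g w (adj_mult (K + frame_sum J g) A $ i $ i)) \<noteq> 0) \<Longrightarrow>
      pencil_polynomial J (A, K, B, g, w) \<noteq> 0"
  using someI_ex[OF pencil_polynomial_exists[of J], folded pencil_polynomial_def] by blast+

text \<open>The polynomial condition holds for the pencil of \<open>A\<close> and \<open>K0\<close>, but \<open>K0\<close> need not be semidefinite. It persists
on the line from \<open>K\<close> to \<open>K0\<close> except at finitely many points, so \<open>K0\<close> can be replaced by a matrix close to \<open>K\<close>,
which is positive definite on the complement of the kernel. Then \<open>pencil_step\<close> yields a matrix of \<open>L\<close> with one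
more dimension in its kernel, and its spanning property extends transversality to the larger kernel. Hence
the new kernel is again stable.\<close>

lemma kernel_frame_extend:
  fixes L :: "(real^'n^'n) set" and B :: "real^'n^'n^'n"
  assumes L: "subspace L" "L \<subseteq> sym_mats" and tr: "transversal L J g" and g: "det g \<noteq> 0" and k: "k \<notin> J"
    and K: "K \<in> L" "kernel_frame K J g"
    and mem: "A \<in> L" "K0 \<in> L" "\<And>i. B $ i \<in> L"
    and ker: "\<And>i. i \<in> J \<Longrightarrow> A *v column i g = 0" "\<And>i. i \<in> J \<Longrightarrow> K0 *v column i g = 0"
      "\<And>l i. i \<in> J \<Longrightarrow> B $ l *v column i g = 0"
    and R: "pencil_polynomial J (A, K0, B, g, w) \<noteq> 0"
  shows "\<exists>U. open U \<and> U \<noteq> {} \<and> (\<forall>g'\<in>U. \<exists>K'\<in>L. kernel_frame K' (insert k J) g')"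
proof -
  have pd: "K + frame_sum J g \<in> pd_mats" and kerK: "\<And>i. i \<in> J \<Longrightarrow> K *v column i g = 0"
    using K(2) by (auto simp: kernel_frame_def)
  obtain d where d: "d > 0" "\<And>X. X \<in> sym_mats \<Longrightarrow> norm (X - (K + frame_sum J g)) < d \<Longrightarrow> X \<in> pd_mats"
    using pd_open_in_sym[OF pd] by blast
  define Kt where "Kt t = K + t *\<^sub>R (K0 - K)" for t
  have "real_polynomial_function (\<lambda>t. pencil_polynomial J (A, Kt t, B, g, w))"
    unfolding Kt_def
    by (intro real_polynomial_function_comp[OF pencil_polynomial(1)] polynomial_intros)
  moreover have "pencil_polynomial J (A, Kt 1, B, g, w) \<noteq> 0" using R by (simp add: Kt_def)
  moreover have "open {t. norm (t *\<^sub>R (K0 - K)) < d}"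
    by (intro open_Collect_less continuous_intros)
  moreover have "0 \<in> {t. norm (t *\<^sub>R (K0 - K)) < d}" using d(1) by simp
  ultimately obtain t where t: "norm (t *\<^sub>R (K0 - K)) < d" "pencil_polynomial J (A, Kt t, B, g, w) \<noteq> 0"
    using polynomial_nonzero_in_open[of "\<lambda>t. pencil_polynomial J (A, Kt t, B, g, w)" 1 _ 0] by blast
  have KtL: "Kt t \<in> L" unfolding Kt_def using K(1) mem(2) L(1)
    by (intro subspace_add subspace_scale subspace_diff)
  have kerKt: "Kt t *v column i g = 0" if "i \<in> J" for i
    using kerK[OF that] ker(2)[OF that]
    by (simp add: Kt_def matrix_vector_mult_add_rdistrib matrix_vector_mult_diff_rdistrib scaleR_matrix_vector_assoc[symmetric])
  have symKt: "Kt t \<in> sym_mats" using KtL L(2) by blast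
  have pdKt: "Kt t + frame_sum J g \<in> pd_mats"
    using t(1) by (intro d(2) subspace_add subspace_sym_mats symKt frame_sum_sym) (simp add: Kt_def)
  have symAB: "A \<in> sym_mats" "B $ i \<in> sym_mats" for i using mem L(2) by auto
  obtain c v where v: "v \<noteq> 0" "\<And>i. i \<in> J \<Longrightarrow> column i g \<bullet> v = 0"
    and psd: "A - c *\<^sub>R Kt t \<in> psd_mats" "(A - c *\<^sub>R Kt t) *v v = 0"
    and line: "\<forall>x. (A - c *\<^sub>R Kt t) *v x = 0 \<longrightarrow> (\<forall>i\<in>J. column i g \<bullet> x = 0) \<longrightarrow> x \<in> span {v}"
    and span: "\<forall>y. (\<forall>i\<in>J. column i g \<bullet> y = 0) \<longrightarrow> (\<exists>z. y = (\<Sum>k\<in>-J. z k *\<^sub>R (B $ k *v v)))"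
    by (rule pencil_step[OF symAB(1) symKt symAB(2) ker(1) kerKt ker(3) pdKt g k pencil_polynomial(2)[OF t(2)]])
      (assumption | rule that)+
  define K' where "K' = A - c *\<^sub>R Kt t"
  have K'L: "K' \<in> L" unfolding K'_def using mem(1) KtL L(1) by (intro subspace_diff subspace_scale)
  have symK': "K' \<in> sym_mats" using K'L L(2) by blast
  have kerK': "K' *v column i g = 0" if "i \<in> J" for i
    using ker(1)[OF that] kerKt[OF that]
    by (simp add: K'_def matrix_vector_mult_diff_rdistrib scaleR_matrix_vector_assoc[symmetric])
  obtain g' where g': "det g' \<noteq> 0" "\<And>i. i \<in> J \<Longrightarrow> column i g' = column i g" "column k g' = v"
    by (rule frame_replace_column[OF g v k]) (assumption | rule that)+
  have "transversal L (insert k J) g'"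
    unfolding transversal_def
  proof
    fix S :: "real^'n^'n" assume S: "S \<in> sym_mats"
    obtain K1 where K1: "K1 \<in> L" "\<forall>i\<in>J. K1 *v column i g = S *v column i g"
      using bspec[OF tr[unfolded transversal_def] S] by blast
    \<comment> \<open>K1 is right on the old columns; a combination of the B $ l, which vanish there, corrects it on v\<close>
    have sy: "S - K1 \<in> sym_mats" using S K1(1) L(2) by (intro subspace_diff subspace_sym_mats) auto
    have "column i g \<bullet> ((S - K1) *v v) = 0" if "i \<in> J" for i
      unfolding sym_mats_inner[OF sy] using K1(2) that by (simp add: matrix_vector_mult_diff_rdistrib)
    with span obtain z where z: "(S - K1) *v v = (\<Sum>l\<in>-J. z l *\<^sub>R (B $ l *v v))" by blast
    define K2 where "K2 = K1 + (\<Sum>l\<in>-J. z l *\<^sub>R B $ l)"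
    have "K2 \<in> L" unfolding K2_def using K1(1) mem(3) L(1)
      by (intro subspace_add subspace_sum subspace_scale) auto
    moreover have "K2 *v column i g' = S *v column i g'" if "i \<in> insert k J" for i
    proof (cases "i = k")
      case True
      then show ?thesis using z
        by (simp add: K2_def g'(3) matrix_vector_mult_add_rdistrib matrix_vector_mult_diff_rdistrib
            sum_matrix_vector_mult scaleR_matrix_vector_assoc[symmetric] algebra_simps)
    next
      case False
      then have "i \<in> J" using that by blast
      then show ?thesis using K1(2)
        by (simp add: K2_def g'(2) matrix_vector_mult_add_rdistrib sum_matrix_vector_mult
            scaleR_matrix_vector_assoc[symmetric] ker(3))
    qed
    ultimately show "\<exists>K\<in>L. \<forall>i\<in>insert k J. K *v column i g' = S *v column i g'" by blast
  qed
  moreover have "kernel_frame K' (insert k J) g'"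
  proof (rule kernel_frameI[OF symK'])
    fix i assume "i \<in> insert k J"
    then show "K' *v column i g' = 0" using g'(2,3) kerK' psd(2) by (auto simp: K'_def)
  next
    have fp: "frame_sum (insert k J) g' \<in> psd_mats" by (rule frame_sum_psd)
    have "0 < x \<bullet> ((K' + frame_sum (insert k J) g') *v x)" if "x \<noteq> 0" for x
    proof (rule ccontr)
      assume a: "\<not> ?thesis"
      have nn: "0 \<le> x \<bullet> (K' *v x)" "0 \<le> x \<bullet> (frame_sum (insert k J) g' *v x)"
        using psd(1) fp by (auto simp: psd_mats_def K'_def)
      then have z: "x \<bullet> (K' *v x) = 0" "x \<bullet> (frame_sum (insert k J) g' *v x) = 0"
        using a by (auto simp: matrix_vector_mult_add_rdistrib inner_add_right)
      have "K' *v x = 0" using psd_kernel[OF _ z(1)] psd(1) by (simp add: K'_def)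
      moreover have o: "\<forall>i\<in>insert k J. column i g' \<bullet> x = 0"
        using psd_kernel[OF fp z(2)] by (simp only: frame_sum_eq_0)
      then have "column i g \<bullet> x = 0" if "i \<in> J" for i using g'(2)[OF that] that by auto
      ultimately have "x \<in> span {v}" using line by (simp add: K'_def)
      then obtain r where "x = r *\<^sub>R v" by (auto simp: span_singleton)
      moreover have "v \<bullet> x = 0" using o g'(3) by auto
      ultimately show False using that v(1) by auto
    qed
    then show "K' + frame_sum (insert k J) g' \<in> pd_mats"
      using subspace_add[OF subspace_sym_mats symK' frame_sum_sym] by (simp add: pd_mats_def)
  qed
  ultimately obtain U where "open U" "g' \<in> U" "\<forall>h\<in>U. \<exists>K'\<in>L. kernel_frame K' (insert k J) h"
    using kernel_frame_stable[OF L _ g'(1) K'L] by blast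
  then show ?thesis by blast
qed

section \<open>A pencil with coordinate eigenvectors\<close>

lemma column_mat1: "column i (mat 1 :: real^'n^'n) = axis i 1"
  by (simp add: column_def mat_def axis_def vec_eq_iff)

lemma chart_matrix_mat1:
  fixes X :: "real^'n^'n^'m"
  shows "chart_matrix \<beta> X (mat 1) = (\<chi> k l. X $ l $ fst (\<beta> k) $ snd (\<beta> k))"
proof -
  have "axis i 1 \<bullet> (Z *v axis l 1) = Z $ i $ l" for Z :: "real^'n^'n" and i l
    by (simp add: inner_axis' matrix_vector_mult_basis) (simp add: column_def)
  then show ?thesis by (simp add: chart_matrix_def column_mat1)
qed

lemma cramer_vec_mat1: "cramer_vec (mat 1) x = x"
  using cramer_vec_mult[of "mat 1" x] by simp

text \<open>Summing the equations over \<open>k\<close> shows that the sum of the entries of \<open>y\<close>, multiplied by a positive number,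
equals \<open>y $ i0\<close>; so either alternative in the last assumption makes both vanish.\<close>

lemma all_ones_system_trivial:
  fixes y :: "real^'n"
  assumes i0: "i0 \<notin> J" and J: "\<And>k. k \<in> J \<Longrightarrow> y $ k = 0"
    and eq: "\<And>k. k \<notin> J \<Longrightarrow> k \<noteq> i0 \<Longrightarrow> (\<Sum>l\<in>UNIV. y $ l) + y $ k = 0"
    and d: "(\<Sum>l\<in>UNIV. y $ l) = 0 \<or> y $ i0 = 0"
  shows "y = 0"
proof -
  define s where "s = (\<Sum>l\<in>UNIV. y $ l)"
  have "s = y $ i0 + (\<Sum>l\<in>UNIV - {i0}. y $ l)" unfolding s_def by (rule sum.remove) auto
  also have "(\<Sum>l\<in>UNIV - {i0}. y $ l) = (\<Sum>l\<in>- J - {i0}. y $ l)"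
    by (rule sum.mono_neutral_right) (auto simp: J)
  also have "\<dots> = (\<Sum>l\<in>- J - {i0}. - s)"
    by (rule sum.cong) (use eq in \<open>auto simp: s_def eq_neg_iff_add_eq_0 add.commute\<close>)
  finally have se: "s * (1 + real (card (- J - {i0}))) = y $ i0" by (simp add: algebra_simps)
  have "s = 0"
    using d
  proof
    assume "y $ i0 = 0"
    then show ?thesis using se by (auto simp: add_nonneg_eq_0_iff)
  qed (simp add: s_def)
  moreover then have "y $ i0 = 0" using se by simp
  ultimately have "y $ k = 0" for k
    using J[of k] eq[of k] by (cases "k \<in> J"; cases "k = i0") (auto simp: s_def)
  then show ?thesis by (simp add: vec_eq_iff)
qed

text \<open>On the complement of the coordinates in \<open>J\<close> this is the pencil of a diagonal matrix with distinct positive entries and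
the identity, so its eigenvectors are coordinate vectors \<open>c\<close>. There \<open>outer (u k)\<close> maps \<open>c\<close> to a nonzero
multiple of \<open>u k\<close>, which is the sum of the all-ones vector and a coordinate vector on the complement of \<open>J\<close>, and the vectors
\<open>u k\<close> for \<open>k \<noteq> i0\<close> outside \<open>J\<close> together with \<open>c = I' *v c\<close> form a basis. The eliminated condition also involves the
eigenvalue zero, which belongs to the coordinates in \<open>J\<close>; the vector \<open>w\<close> is chosen such that the Cramer vector
at this eigenvalue is proportional to the indicator vector of the complement of \<open>J\<close>.\<close>

lemma pencil_witness_determinant:
  fixes J :: "'n::finite set" and a :: "'n \<Rightarrow> real"
  assumes i0: "i0 \<notin> J" and a: "inj a" "\<And>i. a i > 0"
  defines "A \<equiv> (\<chi> i l. if i = l \<and> i \<notin> J then a i else 0) :: real^'n^'n"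
    and "I' \<equiv> (\<chi> i l. if i = l \<and> i \<notin> J then 1 else 0) :: real^'n^'n"
    and "u \<equiv> \<lambda>k. (\<chi> l. if l \<in> J then 0 else if l = k then 2 else 1) :: real^'n"
  defines "B \<equiv> (\<chi> k. if k \<notin> J \<and> k \<noteq> i0 then outer (u k) else if k = i0 then I' else 0) :: real^'n^'n^'n"
    and "w \<equiv> (\<chi> l. if l \<in> J then 0 else a l) :: real^'n"
  shows "pencil_polynomial J (A, I', B, mat 1, w) \<noteq> 0"
proof -
  have I'x: "(I' *v x) $ l = (if l \<in> J then 0 else x $ l)" for x l
    by (simp add: I'_def matrix_vector_mult_def if_distrib[of "\<lambda>c. c * _"] cong: if_cong)
  have Ax: "(A *v x) $ l = (if l \<in> J then 0 else a l * x $ l)" for x l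
    by (simp add: A_def matrix_vector_mult_def if_distrib[of "\<lambda>c. c * _"] cong: if_cong)
  have Fx: "(frame_sum J (mat 1) *v x) $ l = (if l \<in> J then x $ l else 0)" for x l
  proof -
    have "axis i 1 $ l = (if i = l then 1 else (0::real))" for i by (simp add: axis_def)
    then show ?thesis
      by (simp add: frame_sum_mult column_mat1 inner_axis' sum_component if_distrib[of "\<lambda>c. _ * c"] cong: if_cong)
  qed
  have "(I' + frame_sum J (mat 1)) *v x = mat 1 *v x" for x
    by (simp add: vec_eq_iff matrix_vector_mult_add_rdistrib I'x Fx)
  then have G: "I' + frame_sum J (mat 1) = mat 1" unfolding matrix_eq by blast
  have adj: "adj_mult (I' + frame_sum J (mat 1)) A = A"
    unfolding G by (simp add: adj_mult_def cramer_vec_mat1 column_def vec_eq_iff)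
  have ux: "u k \<bullet> y = (\<Sum>l\<in>UNIV. y $ l) + y $ k" if "k \<notin> J" "\<And>l. l \<in> J \<Longrightarrow> y $ l = 0" for k y
  proof -
    have "u k \<bullet> y = (\<Sum>l\<in>UNIV. y $ l + (if l = k then y $ l else 0))"
      unfolding inner_vec_def u_def by (rule sum.cong) (use that in auto)
    then show ?thesis by (simp add: sum.distrib)
  qed
  show ?thesis
  proof (rule pencil_polynomial(3))
    fix i j :: 'n assume "i \<noteq> j"
    then show "adj_mult (I' + frame_sum J (mat 1)) A $ i $ j = 0" by (simp only: adj) (simp add: A_def)
  next
    fix i :: 'n
    define \<mu> where "\<mu> = A $ i $ i"
    define N where "N = pencil_matrix J A I' (mat 1) \<mu>"
    have Nx: "(N *v x) $ l = (if l \<in> J then x $ l else (a l - \<mu>) * x $ l)" for x l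
      unfolding N_def pencil_matrix_def G
      by (simp add: matrix_vector_mult_add_rdistrib matrix_vector_mult_diff_rdistrib
          scaleR_matrix_vector_assoc[symmetric] I'x Ax Fx algebra_simps)
    define c where "c = cramer_vec N w"
    have Nc: "N *v c = det N *\<^sub>R w" by (simp add: c_def mult_cramer_vec)
    \<comment> \<open>the columns of the pencil determinant are independent if only y = 0 is orthogonal to them\<close>
    have key: "y = 0" if yJ: "\<And>k. k \<in> J \<Longrightarrow> y $ k = 0" and yB: "\<And>k. k \<notin> J \<Longrightarrow> (B $ k *v c) \<bullet> y = 0" for y
    proof -
      have yI: "(\<Sum>l\<in>UNIV. if l \<in> J then 0 else c $ l * y $ l) = 0"
        using yB[OF i0] by (simp add: B_def inner_vec_def I'x if_distrib[of "\<lambda>c. c * _"] cong: if_cong)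
      have yu: "(u k \<bullet> c) * ((\<Sum>l\<in>UNIV. y $ l) + y $ k) = 0" if "k \<notin> J" "k \<noteq> i0" for k
        using yB[OF that(1)] that ux[OF that(1) yJ] by (simp add: B_def outer_mult)
      show ?thesis
      proof (cases "i \<in> J")
        case True
        then have \<mu>: "\<mu> = 0" by (simp add: \<mu>_def A_def)
        have "det N \<noteq> 0"
        proof (rule det_nonzeroI)
          fix x assume "N *v x = 0"
          then have "(N *v x) $ l = 0" for l by simp
          then have "x $ l = 0" for l using a(2)[of l] unfolding Nx \<mu> by (metis diff_zero less_irrefl mult_eq_0_iff)
          then show "x = 0" by (simp add: vec_eq_iff)
        qed
        have cl: "c $ l = (if l \<in> J then 0 else det N)" for l
          using arg_cong[OF Nc, of "\<lambda>v. v $ l"] a(2)[of l] unfolding Nx \<mu> by (auto simp: w_def split: if_splits)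
        have "u k \<bullet> c \<noteq> 0" if "k \<notin> J" for k
        proof -
          have "u k \<bullet> c = det N * (\<Sum>l\<in>UNIV. if l \<in> J then 0 else if l = k then 2 else 1)"
            unfolding inner_vec_def u_def sum_distrib_left by (rule sum.cong) (auto simp: cl)
          moreover have "(\<Sum>l\<in>UNIV. if l \<in> J then 0 else if l = k then 2 else (1::real)) > 0"
            by (rule sum_pos2[of _ k]) (use that in auto)
          ultimately show ?thesis using \<open>det N \<noteq> 0\<close> by simp
        qed
        then have eq: "(\<Sum>l\<in>UNIV. y $ l) + y $ k = 0" if "k \<notin> J" "k \<noteq> i0" for k using yu[OF that] that by auto
        have "det N * (\<Sum>l\<in>UNIV. y $ l) = (\<Sum>l\<in>UNIV. if l \<in> J then 0 else c $ l * y $ l)"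
          unfolding sum_distrib_left by (rule sum.cong) (auto simp: cl yJ)
        then have "(\<Sum>l\<in>UNIV. y $ l) = 0" using yI \<open>det N \<noteq> 0\<close> by simp
        then show ?thesis using all_ones_system_trivial[OF i0 yJ eq] by blast
      next
        case False
        then have \<mu>: "\<mu> = a i" by (simp add: \<mu>_def A_def)
        have Ni: "N *v axis i 1 = 0" unfolding vec_eq_iff Nx \<mu> using False by (auto simp: axis_def)
        then have "det N = 0" using det_nonzero_kernel[of N "axis i 1"] by (auto simp: axis_eq_0_iff)
        then have c0: "c $ l = 0" if "l \<noteq> i" for l
          using arg_cong[OF Nc, of "\<lambda>v. v $ l"] that injD[OF a(1), of l i] unfolding Nx \<mu>
          by (auto split: if_splits)
        have ci: "c $ i \<noteq> 0"
        proof -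
          let ?Ni = "\<chi> r s. if s = i then w $ r else N $ r $ s"
          have "det ?Ni \<noteq> 0"
          proof (rule det_nonzeroI)
            fix x assume x: "?Ni *v x = 0"
            have "(?Ni *v x) $ r = w $ r * x $ i + (N *v (x - x $ i *\<^sub>R axis i 1)) $ r" for r
            proof -
              have "(?Ni *v x) $ r = (\<Sum>s\<in>UNIV. (if s = i then w $ r * x $ i else 0) + N $ r $ s * (x - x $ i *\<^sub>R axis i 1) $ s)"
                unfolding matrix_vector_mult_def by (simp add: axis_def) (rule sum.cong, auto)
              then show ?thesis by (simp add: sum.distrib matrix_vector_mult_def)
            qed
            then have r0: "w $ r * x $ i + (N *v x) $ r = 0" for r
              using x by (simp add: matrix_vector_mult_diff_distrib matrix_vector_mult_scaleR Ni)
            have "x $ i = 0" using r0[of i] False a(2)[of i] unfolding Nx \<mu> by (simp add: w_def)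
            then have "x $ r = 0" for r
              using r0[of r] injD[OF a(1), of r i] unfolding Nx \<mu> by (cases "r = i") (auto split: if_splits)
            then show "x = 0" by (simp add: vec_eq_iff)
          qed
          then show ?thesis by (simp add: c_def cramer_vec_def)
        qed
        have "u k \<bullet> c \<noteq> 0" for k
        proof -
          have "u k \<bullet> c = (\<Sum>l\<in>UNIV. if l = i then u k $ i * c $ i else 0)"
            unfolding inner_vec_def by (rule sum.cong) (auto simp: c0)
          then show ?thesis using ci False by (simp add: u_def)
        qed
        then have eq: "(\<Sum>l\<in>UNIV. y $ l) + y $ k = 0" if "k \<notin> J" "k \<noteq> i0" for k using yu[OF that] that by auto
        have "(\<Sum>l\<in>UNIV. if l \<in> J then 0 else c $ l * y $ l) = (\<Sum>l\<in>UNIV. if l = i then c $ i * y $ i else 0)"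
          by (rule sum.cong) (use False in \<open>auto simp: c0\<close>)
        then have yi: "y $ i = 0" using yI ci by simp
        then have "(\<Sum>l\<in>UNIV. y $ l) = 0 \<or> y $ i0 = 0" using eq[OF False] by (cases "i = i0") auto
        then show ?thesis using all_ones_system_trivial[OF i0 yJ eq] by blast
      qed
    qed
    have "det (transpose (pencil_columns J A I' B (mat 1) w \<mu>)) \<noteq> 0"
    proof (rule det_nonzeroI)
      fix y assume y: "transpose (pencil_columns J A I' B (mat 1) w \<mu>) *v y = 0"
      have col: "column k (pencil_columns J A I' B (mat 1) w \<mu>) = (if k \<in> J then axis k 1 else B $ k *v c)" for k
        by (auto simp: pencil_columns_def column_def vec_eq_iff c_def N_def mat_def axis_def)
      have "column k (pencil_columns J A I' B (mat 1) w \<mu>) \<bullet> y = 0" for k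
        using y by (metis transpose_mult_component zero_index)
      then have k0: "(if k \<in> J then axis k 1 else B $ k *v c) \<bullet> y = 0" for k unfolding col .
      show "y = 0"
      proof (rule key)
        show "y $ k = 0" if "k \<in> J" for k using k0[of k] that by (simp add: inner_axis')
        show "(B $ k *v c) \<bullet> y = 0" if "k \<notin> J" for k using k0[of k] that by simp
      qed
    qed
    then show "det (pencil_columns J A I' B (mat 1) w (adj_mult (I' + frame_sum J (mat 1)) A $ i $ i)) \<noteq> 0"
      unfolding adj \<mu>_def[symmetric] by simp
  qed
qed

text \<open>The matrices of the special pencil have to be realized in the span of a tuple \<open>X\<close> on which the positions
selected by \<open>\<beta>\<close> are coordinates. These positions separate the space \<open>V\<close> spanned by the pencil, because they contain
row \<open>i0\<close>, which determines the coefficients of the rank one matrices, and a second diagonal position, which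
tells \<open>A\<close> from \<open>I'\<close>. A left inverse \<open>h\<close> of the coordinate map on \<open>V\<close> then extends to a section \<open>\<rho>'\<close> of the coordinate
map on all symmetric matrices whose range contains \<open>V\<close>.\<close>

lemma pencil_witness:
  fixes \<beta> :: "'m::finite \<Rightarrow> 'n::finite \<times> 'n" and J :: "'n set"
  assumes inj: "inj \<beta>" and swap: "\<And>k k' i l. \<beta> k = (i, l) \<Longrightarrow> \<beta> k' = (l, i) \<Longrightarrow> i = l"
    and i0: "i0 \<notin> J" and i1: "i1 \<notin> J" "i1 \<noteq> i0"
    and row: "\<And>l. l \<notin> J \<Longrightarrow> (i0, l) \<in> range \<beta>" and diag: "(i1, i1) \<in> range \<beta>"
  shows "\<exists>X \<alpha> \<kappa> b w. (\<forall>l. X $ l \<in> sym_mats) \<and> det (chart_matrix \<beta> X (mat 1)) \<noteq> 0 \<and>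
    (\<forall>k. fst (\<beta> k) \<in> J \<longrightarrow> \<alpha> $ k = 0 \<and> \<kappa> $ k = 0 \<and> (\<forall>i. b $ i $ k = 0)) \<and>
    pencil_polynomial J (chart_elem \<beta> X (mat 1) \<alpha>, chart_elem \<beta> X (mat 1) \<kappa>,
      (\<chi> i. chart_elem \<beta> X (mat 1) (b $ i)), mat 1, w) \<noteq> 0"
proof -
  obtain f :: "'n \<Rightarrow> nat" where f: "inj f" using finite_imp_inj_to_nat_seg[of "UNIV :: 'n set"] by auto
  define a where "a i = 1 + real (f i)" for i
  have a: "inj a" "\<And>i. a i > 0" using f by (auto simp: a_def inj_def)
  define A :: "real^'n^'n" where "A = (\<chi> i l. if i = l \<and> i \<notin> J then a i else 0)"
  define I' :: "real^'n^'n" where "I' = (\<chi> i l. if i = l \<and> i \<notin> J then 1 else 0)"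
  define u :: "'n \<Rightarrow> real^'n" where "u k = (\<chi> l. if l \<in> J then 0 else if l = k then 2 else 1)" for k
  define B :: "real^'n^'n^'n"
    where "B = (\<chi> k. if k \<notin> J \<and> k \<noteq> i0 then outer (u k) else if k = i0 then I' else 0)"
  define w :: "real^'n" where "w = (\<chi> l. if l \<in> J then 0 else a l)"
  have R: "pencil_polynomial J (A, I', B, mat 1, w) \<noteq> 0"
    unfolding A_def I'_def B_def w_def u_def using pencil_witness_determinant[OF i0 a] by simp
  define \<Lambda> :: "real \<times> real \<times> (real^'n) \<Rightarrow> real^'n^'n"
    where "\<Lambda> z = fst z *\<^sub>R I' + fst (snd z) *\<^sub>R A + (\<Sum>k\<in>- J - {i0}. snd (snd z) $ k *\<^sub>R outer (u k))" for z
  have lin\<Lambda>: "linear \<Lambda>"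
    by (rule linearI) (simp_all add: \<Lambda>_def algebra_simps sum.distrib scaleR_sum_right)
  define V where "V = range \<Lambda>"
  have V: "subspace V" unfolding V_def using lin\<Lambda> by (rule linear_subspace_image) simp
  define \<gamma> :: "real^'n^'n \<Rightarrow> real^'m" where "\<gamma> Z = (\<chi> k. Z $ fst (\<beta> k) $ snd (\<beta> k))" for Z
  have lin\<gamma>: "linear \<gamma>" by (rule linearI) (simp_all add: \<gamma>_def vec_eq_iff)
  have symV: "Z \<in> sym_mats" if "Z \<in> V" for Z
  proof -
    have "I' \<in> sym_mats" "A \<in> sym_mats" by (auto intro!: sym_matsI simp: I'_def A_def)
    then show ?thesis using that unfolding V_def \<Lambda>_def
      by (auto intro!: subspace_add subspace_sum subspace_scale subspace_sym_mats outer_sym)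
  qed
  have kerV: "Z = 0" if Z: "Z \<in> V" "\<gamma> Z = 0" for Z
  proof -
    obtain s t x where Zst: "Z = \<Lambda> (s, t, x)" using Z(1) unfolding V_def by auto
    have coord: "Z $ i $ l = 0" if il: "(i, l) \<in> range \<beta>" for i l
    proof -
      obtain k where "(i, l) = \<beta> k" using il by blast
      then have "fst (\<beta> k) = i" "snd (\<beta> k) = l" by (metis fst_conv, metis snd_conv)
      then show ?thesis using arg_cong[OF Z(2), of "\<lambda>v. v $ k"] by (simp add: \<gamma>_def)
    qed
    have entry: "Z $ i $ l = s * I' $ i $ l + t * A $ i $ l + (\<Sum>k\<in>- J - {i0}. x $ k * (u k $ i * u k $ l))" for i l
      by (simp add: Zst \<Lambda>_def outer_def sum_component)
    define y where "y = (\<chi> k. if k \<in> J \<or> k = i0 then 0 else x $ k)"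
    have sumy: "(\<Sum>l\<in>UNIV. y $ l) = (\<Sum>k\<in>- J - {i0}. x $ k)"
      by (rule sum.mono_neutral_cong_right) (auto simp: y_def)
    have rowsum: "(\<Sum>k\<in>- J - {i0}. x $ k * (u k $ i0 * u k $ l)) = (\<Sum>l\<in>UNIV. y $ l) + y $ l" if "l \<notin> J" for l
    proof -
      have "(\<Sum>k\<in>- J - {i0}. x $ k * (u k $ i0 * u k $ l)) = (\<Sum>k\<in>- J - {i0}. x $ k + (if k = l then x $ k else 0))"
        by (rule sum.cong) (use i0 that in \<open>auto simp: u_def\<close>)
      also have "\<dots> = (\<Sum>k\<in>- J - {i0}. x $ k) + (if l \<in> - J - {i0} then x $ l else 0)"
        by (simp add: sum.distrib sum.delta')
      also have "(if l \<in> - J - {i0} then x $ l else 0) = y $ l" by (auto simp: y_def)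
      finally show ?thesis unfolding sumy .
    qed
    have "(\<Sum>l\<in>UNIV. y $ l) + y $ l = 0" if "l \<notin> J" "l \<noteq> i0" for l
      using coord[OF row[OF that(1)]] entry[of i0 l] rowsum[OF that(1)] that by (simp add: I'_def A_def)
    then have y: "y = 0"
      by (intro all_ones_system_trivial[OF i0]) (auto simp: y_def)
    then have x: "x $ k = 0" if "k \<in> - J - {i0}" for k
    proof -
      have "y $ k = x $ k" using that by (simp add: y_def)
      then show ?thesis using y by simp
    qed
    then have "(\<Sum>k\<in>- J - {i0}. x $ k * (u k $ i * u k $ l)) = 0" for i l by simp
    then have d: "Z $ i $ l = s * I' $ i $ l + t * A $ i $ l" for i l by (simp add: entry)
    have st: "s + t * a i0 = 0" "s + t * a i1 = 0"
      using coord[OF row[OF i0]] coord[OF diag] i0 i1 by (simp_all add: d I'_def A_def)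
    have "a i0 \<noteq> a i1" using i1(2) a(1) by (auto dest: injD)
    moreover have "t * (a i0 - a i1) = (s + t * a i0) - (s + t * a i1)" by (simp add: right_diff_distrib)
    then have "t * (a i0 - a i1) = 0" unfolding st by simp
    ultimately have "t = 0" by simp
    with st(1) have "s = 0" by simp
    with \<open>t = 0\<close> show "Z = 0" by (simp add: vec_eq_iff d)
  qed
  have "inj_on \<gamma> V"
  proof (rule inj_onI)
    fix Z Z' assume "Z \<in> V" "Z' \<in> V" "\<gamma> Z = \<gamma> Z'"
    then have "Z - Z' = 0" using V by (intro kerV) (auto simp: subspace_diff linear_diff[OF lin\<gamma>])
    then show "Z = Z'" by simp
  qed
  then obtain h where h: "range h \<subseteq> V" "linear h" "\<And>Z. Z \<in> V \<Longrightarrow> h (\<gamma> Z) = Z"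
    using linear_exists_left_inverse_on[OF lin\<gamma> V] by auto
  define \<rho> :: "real^'m \<Rightarrow> real^'n^'n"
    where "\<rho> y = (\<chi> i l. \<Sum>k\<in>UNIV. if \<beta> k = (i, l) \<or> \<beta> k = (l, i) then y $ k else 0)" for y
  have lin\<rho>: "linear \<rho>"
    by (rule linearI)
      (simp_all add: \<rho>_def vec_eq_iff sum_distrib_left if_distrib[of "\<lambda>c. _ * c"] flip: sum.distrib,
        auto intro!: sum.cong)
  have \<gamma>\<rho>: "\<gamma> (\<rho> y) = y" for y
  proof -
    have "(\<beta> k' = (fst (\<beta> k), snd (\<beta> k)) \<or> \<beta> k' = (snd (\<beta> k), fst (\<beta> k))) \<longleftrightarrow> k' = k" for k k'
    proof
      assume a: "\<beta> k' = (fst (\<beta> k), snd (\<beta> k)) \<or> \<beta> k' = (snd (\<beta> k), fst (\<beta> k))"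
      then have "\<beta> k' = \<beta> k"
        using swap[of k "fst (\<beta> k)" "snd (\<beta> k)" k'] by (auto simp: prod_eq_iff)
      then show "k' = k" using injD[OF inj] by blast
    qed simp
    then show ?thesis by (simp add: \<gamma>_def \<rho>_def vec_eq_iff)
  qed
  \<comment> \<open>the plain section rho, corrected by h so that it inverts the coordinate map on V\<close>
  define \<rho>' where "\<rho>' y = \<rho> (y - \<gamma> (h y)) + h y" for y
  have lin\<rho>': "linear \<rho>'"
    by (rule linearI)
      (simp_all add: \<rho>'_def linear_add[OF lin\<rho>] linear_diff[OF lin\<rho>] linear_add[OF lin\<gamma>] linear_add[OF h(2)]
        linear_scale[OF lin\<rho>] linear_scale[OF lin\<gamma>] linear_scale[OF h(2)] algebra_simps)
  have \<gamma>\<rho>': "\<gamma> (\<rho>' y) = y" for y by (simp add: \<rho>'_def linear_add[OF lin\<gamma>] \<gamma>\<rho>)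
  have \<rho>'\<gamma>: "\<rho>' (\<gamma> Z) = Z" if "Z \<in> V" for Z by (simp add: \<rho>'_def h(3)[OF that] linear_0[OF lin\<rho>])
  define X :: "real^'n^'n^'m" where "X = (\<chi> k. \<rho>' (axis k 1))"
  have "X $ k \<in> sym_mats" for k
  proof -
    have "\<rho> y \<in> sym_mats" for y by (rule sym_matsI) (simp add: \<rho>_def disj_commute)
    moreover have "h y \<in> sym_mats" for y using h(1) symV by blast
    ultimately show ?thesis by (auto simp: X_def \<rho>'_def intro!: subspace_add subspace_sym_mats)
  qed
  moreover have chart: "chart_matrix \<beta> X (mat 1) = mat 1"
  proof -
    have "X $ l $ fst (\<beta> k) $ snd (\<beta> k) = axis l 1 $ k" for k l
      using arg_cong[OF \<gamma>\<rho>'[of "axis l 1"], of "\<lambda>v. v $ k"] by (simp add: \<gamma>_def X_def)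
    then show ?thesis unfolding chart_matrix_mat1 by (simp add: vec_eq_iff mat_def axis_def)
  qed
  have elem: "chart_elem \<beta> X (mat 1) y = \<rho>' y" for y
  proof -
    have "y = (\<Sum>l\<in>UNIV. y $ l *\<^sub>R axis l 1)"
      by (simp add: vec_eq_iff sum_component axis_def if_distrib[of "\<lambda>c. _ * c"] cong: if_cong)
    then have "\<rho>' y = (\<Sum>l\<in>UNIV. y $ l *\<^sub>R \<rho>' (axis l 1))"
      by (metis (mono_tags, lifting) lin\<rho>' linear_scale linear_sum sum.cong)
    then show ?thesis unfolding chart_elem_def chart cramer_vec_mat1 by (simp add: X_def)
  qed
  have mem: "A \<in> V" "I' \<in> V" "B $ k \<in> V" for k
  proof -
    have "A = \<Lambda> (0, 1, 0)" "I' = \<Lambda> (1, 0, 0)" by (simp_all add: \<Lambda>_def)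
    then show AI: "A \<in> V" "I' \<in> V" unfolding V_def by blast+
    have "outer (u k) = \<Lambda> (0, 0, axis k 1)" if "k \<notin> J" "k \<noteq> i0"
      using that by (simp add: \<Lambda>_def axis_def if_distrib[of "\<lambda>c. c *\<^sub>R _"] cong: if_cong)
    then have "outer (u k) \<in> V" if "k \<notin> J" "k \<noteq> i0" using that unfolding V_def by blast
    then show "B $ k \<in> V" using AI(2) subspace_0[OF V] by (simp add: B_def)
  qed
  define b :: "real^'m^'n" where "b = (\<chi> i. \<gamma> (B $ i))"
  have "(\<chi> i. chart_elem \<beta> X (mat 1) (b $ i)) = B" by (simp add: vec_eq_iff b_def elem \<rho>'\<gamma>[OF mem(3)])
  then have "pencil_polynomial J (chart_elem \<beta> X (mat 1) (\<gamma> A), chart_elem \<beta> X (mat 1) (\<gamma> I'),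
      (\<chi> i. chart_elem \<beta> X (mat 1) (b $ i)), mat 1, w) \<noteq> 0"
    using R by (simp add: elem \<rho>'\<gamma> mem)
  moreover have "\<gamma> A $ k = 0 \<and> \<gamma> I' $ k = 0 \<and> (\<forall>i. b $ i $ k = 0)" if "fst (\<beta> k) \<in> J" for k
    using that by (auto simp: \<gamma>_def b_def A_def I'_def B_def outer_def u_def)
  moreover have "det (chart_matrix \<beta> X (mat 1)) \<noteq> 0" by (simp add: chart)
  ultimately show ?thesis by blast
qed

section \<open>Lexicographic enumeration of matrix positions\<close>

text \<open>The dimension of the variety of symmetric matrices of rank at most \<open>d\<close>; equivalently the number of positions
\<open>(i, l)\<close> with \<open>i \<le> l\<close> in the first \<open>d\<close> rows.\<close>

definition rank_dim :: "nat \<Rightarrow> nat \<Rightarrow> nat" where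
  "rank_dim n d = (\<Sum>i<d. n - i)"

lemma rank_dim_mono: "d \<le> e \<Longrightarrow> rank_dim n d \<le> rank_dim n e"
  unfolding rank_dim_def by (rule sum_mono2) auto

lemma rank_dim_Suc: "rank_dim n (Suc d) = rank_dim n d + (n - d)"
  by (simp add: rank_dim_def)

lemma rank_dim_eq: "d \<le> n \<Longrightarrow> int (rank_dim n d) = int n * int d - int (d choose 2)"
proof (induction d)
  case 0
  then show ?case by (simp add: rank_dim_def)
next
  case (Suc d)
  have "Suc d choose 2 = d + (d choose 2)" by (simp add: numeral_2_eq_2)
  then show ?case using Suc by (simp add: rank_dim_Suc algebra_simps of_nat_diff)
qed

lemma rank_dim_full: "rank_dim n n = (n + 1) choose 2"
proof -
  have "int (rank_dim n n) + int (n choose 2) = int n * int n" using rank_dim_eq[of n n] by simp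
  moreover have "(n + 1) choose 2 = n + (n choose 2)" by (simp add: numeral_2_eq_2)
  moreover have "n + 2 * (n choose 2) = n * n"
    by (induction n) (auto simp: numeral_2_eq_2)
  ultimately show ?thesis by (metis (no_types, opaque_lifting) add_right_cancel mult_2 group_cancel.add1 of_nat_add of_nat_eq_iff of_nat_mult)
qed

text \<open>The first \<open>m\<close> positions on and above the diagonal, row by row. Initial segments of this order exhaust the rows one
after the other and enter each row at its diagonal position; so the same selection of positions works for all
kernel dimensions that occur.\<close>

lemma lexicographic_enumeration:
  assumes m: "m = CARD('m::finite)" "m \<le> rank_dim CARD('n::finite) CARD('n)"
  obtains ord :: "'n::finite \<Rightarrow> nat" and \<beta> :: "'m::finite \<Rightarrow> 'n \<times> 'n"
  where "bij_betw ord UNIV {..<CARD('n)}" "inj \<beta>" "\<And>k. ord (fst (\<beta> k)) \<le> ord (snd (\<beta> k))"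
    "\<And>i l. ord i \<le> ord l \<Longrightarrow> (i, l) \<in> range \<beta> \<longleftrightarrow> rank_dim CARD('n) (ord i) + (ord l - ord i) < m"
proof -
  define n where "n = CARD('n)"
  have "\<exists>h :: 'n \<Rightarrow> nat. bij_betw h UNIV {..<n}"
    by (rule finite_same_card_bij) (simp_all add: n_def)
  then obtain ord :: "'n \<Rightarrow> nat" where ord: "bij_betw ord UNIV {..<n}" by (elim exE)
  have ordlt: "ord i < n" for i using ord by (auto simp: bij_betw_def)
  define pos where "pos p = rank_dim n (ord (fst p)) + (ord (snd p) - ord (fst p))" for p
  define P where "P = {p. ord (fst p) \<le> ord (snd p) \<and> pos p < m}"
  have pos_lt: "pos p < rank_dim n (Suc (ord (fst p)))" if "ord (fst p) \<le> ord (snd p)" for p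
    using that ordlt[of "snd p"] by (simp add: pos_def rank_dim_Suc)
  have "inj_on pos P"
  proof (rule inj_onI)
    fix p q assume pq: "p \<in> P" "q \<in> P" "pos p = pos q"
    have no: "\<not> ord (fst r) < ord (fst s)" if "r \<in> P" "s \<in> P" "pos r = pos s" for r s
    proof
      assume "ord (fst r) < ord (fst s)"
      then have "rank_dim n (Suc (ord (fst r))) \<le> rank_dim n (ord (fst s))" by (intro rank_dim_mono) simp
      then have "pos r < rank_dim n (ord (fst s))" using pos_lt[of r] that(1) by (simp add: P_def)
      then show False using that(3) by (simp add: pos_def)
    qed
    have "ord (fst p) = ord (fst q)" using no[of p q] no[of q p] pq by simp
    moreover then have "ord (snd p) = ord (snd q)"
    proof -
      assume e: "ord (fst p) = ord (fst q)"
      have "ord (fst p) \<le> ord (snd p)" "ord (fst q) \<le> ord (snd q)" using pq by (auto simp: P_def)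
      moreover have "ord (snd p) - ord (fst p) = ord (snd q) - ord (fst q)" using pq(3) e by (simp add: pos_def)
      ultimately show ?thesis using e by linarith
    qed
    ultimately show "p = q" using ord by (metis bij_betw_imp_inj_on injD prod.expand)
  qed
  moreover have "pos ` P = {..<m}"
  proof
    show "pos ` P \<subseteq> {..<m}" by (auto simp: P_def)
    show "{..<m} \<subseteq> pos ` P"
    proof
      fix r assume "r \<in> {..<m}"
      then have r: "r < rank_dim n n" "r < m" using m(2) by (auto simp: n_def)
      have "\<exists>i<d. rank_dim n i \<le> r \<and> r < rank_dim n (Suc i)" if "r < rank_dim n d" for d
        using that
      proof (induction d)
        case 0
        then show ?case by (simp add: rank_dim_def)
      next
        case (Suc d)
        then show ?case by (metis less_Suc_eq not_le)
      qed
      from this[OF r(1)] obtain i where i: "i < n" "rank_dim n i \<le> r" "r < rank_dim n (Suc i)" by blast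
      define l where "l = i + (r - rank_dim n i)"
      have l: "l < n" using i by (simp add: l_def rank_dim_Suc)
      have onto: "ord ` UNIV = {..<n}" using ord by (simp add: bij_betw_def)
      obtain x where x: "ord x = i" using onto i(1) by (metis imageE lessThan_iff)
      obtain y where y: "ord y = l" using onto l by (metis imageE lessThan_iff)
      have "pos (x, y) = r" using i(2) x y by (simp add: pos_def l_def)
      moreover have "(x, y) \<in> P" using calculation r x y by (simp add: P_def l_def)
      ultimately show "r \<in> pos ` P" by (metis imageI)
    qed
  qed
  ultimately have "card P = m" by (metis card_image card_lessThan)
  then have "\<exists>h :: 'm \<Rightarrow> 'n \<times> 'n. bij_betw h UNIV P"
    by (intro finite_same_card_bij) (simp_all add: m(1))
  then obtain \<beta> :: "'m \<Rightarrow> 'n \<times> 'n" where \<beta>: "bij_betw \<beta> UNIV P" by (elim exE)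
  show ?thesis
  proof (rule that)
    show "bij_betw ord UNIV {..<CARD('n)}" using ord by (simp add: n_def)
    show "inj \<beta>" using \<beta> by (simp add: bij_betw_def)
    have "\<beta> k \<in> P" for k using \<beta> by (auto simp: bij_betw_def)
    then show "ord (fst (\<beta> k)) \<le> ord (snd (\<beta> k))" for k by (simp add: P_def)
    show "(i, l) \<in> range \<beta> \<longleftrightarrow> rank_dim CARD('n) (ord i) + (ord l - ord i) < m" if "ord i \<le> ord l" for i l
      using \<beta> that by (simp add: bij_betw_def P_def pos_def n_def)
  qed
qed

section \<open>The maximum likelihood threshold\<close>

lemma rank_frame_sum:
  fixes g :: "real^'n^'n"
  assumes g: "det g \<noteq> 0"
  shows "rank (frame_sum J g) = card J"
proof -
  have "\<forall>y. (\<Sum>k\<in>UNIV. y k *\<^sub>R column k g) = 0 \<longrightarrow> (\<forall>k. y k = 0)"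
  proof (intro allI impI)
    fix y :: "'n \<Rightarrow> real" and k
    assume "(\<Sum>k\<in>UNIV. y k *\<^sub>R column k g) = 0"
    then have "g *v (\<chi> k. y k) = 0" by (simp add: matrix_vector_mult_columns)
    then have "(\<chi> k. y k) = 0" using g by (simp add: det_nonzero_kernel)
    from arg_cong[OF this, of "\<lambda>v. v $ k"] show "y k = 0" by simp
  qed
  then have ind: "inj (\<lambda>k. column k g)" "independent (range (\<lambda>k. column k g))"
    using independent_family_iff[of "\<lambda>k. column k g"] by auto
  have "range ((*v) (frame_sum J g)) = span ((\<lambda>k. column k g) ` J)"
  proof
    show "range ((*v) (frame_sum J g)) \<subseteq> span ((\<lambda>k. column k g) ` J)"
    proof
      fix y assume "y \<in> range ((*v) (frame_sum J g))"
      then obtain x where "y = (\<Sum>i\<in>J. (column i g \<bullet> x) *\<^sub>R column i g)" by (auto simp: frame_sum_mult)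
      then show "y \<in> span ((\<lambda>k. column k g) ` J)" by (auto intro: span_sum span_scale span_base)
    qed
    show "span ((\<lambda>k. column k g) ` J) \<subseteq> range ((*v) (frame_sum J g))"
    proof (rule span_minimal)
      show "subspace (range ((*v) (frame_sum J g)))" by (intro linear_subspace_image) auto
      show "(\<lambda>k. column k g) ` J \<subseteq> range ((*v) (frame_sum J g))"
      proof
        fix y assume "y \<in> (\<lambda>k. column k g) ` J"
        then obtain k where k: "k \<in> J" "y = column k g" by blast
        have "det (transpose g) \<noteq> 0" using g by simp
        then obtain x where x: "transpose g *v x = axis k 1" using cramer[of "transpose g"] by blast
        have "column i g \<bullet> x = (if i = k then 1 else 0)" for i
          using arg_cong[OF x, of "\<lambda>v. v $ i"] unfolding transpose_mult_component by (simp add: axis_def)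
        then have "frame_sum J g *v x = y"
          using k by (simp add: frame_sum_mult if_distrib[of "\<lambda>c. c *\<^sub>R _"] cong: if_cong)
        then show "y \<in> range ((*v) (frame_sum J g))" by blast
      qed
    qed
  qed
  then have "rank (frame_sum J g) = dim ((\<lambda>k. column k g) ` J)" by (simp add: rank_dim_range)
  also have "\<dots> = card ((\<lambda>k. column k g) ` J)"
    by (rule dim_eq_card_independent) (rule independent_mono[OF ind(2)], auto)
  also have "\<dots> = card J" using ind(1) by (simp add: card_image inj_on_subset)
  finally show ?thesis .
qed

lemma sum_matrix_matrix_mult: "(\<Sum>i\<in>I. f i) ** B = (\<Sum>i\<in>I. f i ** B)" for B :: "real^'n^'n"
  by (induction I rule: infinite_finite_induct) (simp_all add: matrix_add_rdistrib)

text \<open>If all selected positions lie in rows from \<open>J\<close>, then no nonzero element of \<open>L\<close> vanishes on the columns of \<open>g\<close> in \<open>J\<close>.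
That no nonzero element of \<open>L\<close> annihilates \<open>S\<close> is the nonvanishing of a Gram determinant, hence Zariski open in \<open>S\<close>.\<close>

lemma generic_rank_mle_exists:
  fixes X :: "real^'n^'n^'m" and g :: "real^'n^'n"
  assumes L: "L = span (range (($) X))" "L \<inter> pd_mats \<noteq> {}"
    and g: "det g \<noteq> 0" and chart: "det (chart_matrix \<beta> X g) \<noteq> 0"
    and \<beta>: "\<And>k. fst (\<beta> k) \<in> J" and sym: "\<And>l. X $ l \<in> sym_mats"
  shows "\<exists>U. zariski_openin (psd_mats_of_rank (card J)) U \<and> U \<noteq> {} \<and> (\<forall>S\<in>U. mle_exists L S)"
proof -
  define p where "p S = det (\<chi> k l. (X $ k ** S) \<bullet> (X $ l ** S))" for S :: "real^'n^'n"
  have "real_polynomial_function p"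
    unfolding real_polynomial_function_eq p_def
    by (rule polynomial_function_det)
      (auto simp: inner_vec_def intro!: polynomial_intros polynomial_function_matrix_mult)
  have gram: "p S \<noteq> 0 \<longleftrightarrow> (\<forall>y. (\<Sum>l\<in>UNIV. y $ l *\<^sub>R X $ l) ** S = 0 \<longrightarrow> y = 0)" for S
  proof -
    let ?Z = "\<lambda>y. (\<Sum>l\<in>UNIV. y $ l *\<^sub>R X $ l) ** S"
    have Z: "?Z y = (\<Sum>l\<in>UNIV. y $ l *\<^sub>R (X $ l ** S))" for y
      by (simp add: sum_matrix_matrix_mult matrix_mult_scaleR_left)
    have G: "((\<chi> k l. (X $ k ** S) \<bullet> (X $ l ** S)) *v y) $ k = (X $ k ** S) \<bullet> ?Z y" for y k
      unfolding Z inner_sum_right inner_scaleR_right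
      by (simp only: matrix_vector_mult_def vec_lambda_beta mult.commute)
    have eqv: "(\<chi> k l. (X $ k ** S) \<bullet> (X $ l ** S)) *v y = 0 \<longleftrightarrow> ?Z y = 0" for y
    proof
      assume 0: "(\<chi> k l. (X $ k ** S) \<bullet> (X $ l ** S)) *v y = 0"
      have "(X $ k ** S) \<bullet> ?Z y = 0" for k unfolding G[symmetric] 0 by simp
      then have "?Z y \<bullet> ?Z y = 0" by (subst (1) Z) (simp add: inner_sum_left)
      then show "?Z y = 0" by simp
    next
      assume 0: "?Z y = 0"
      have "((\<chi> k l. (X $ k ** S) \<bullet> (X $ l ** S)) *v y) $ k = 0" for k unfolding G 0 by simp
      then show "(\<chi> k l. (X $ k ** S) \<bullet> (X $ l ** S)) *v y = 0" by (simp only: vec_eq_iff zero_index) simp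
    qed
    show ?thesis
    proof
      assume nz: "p S \<noteq> 0"
      show "\<forall>y. ?Z y = 0 \<longrightarrow> y = 0"
        using det_nonzero_kernel[OF nz[unfolded p_def]] unfolding eqv by blast
    next
      assume a: "\<forall>y. ?Z y = 0 \<longrightarrow> y = 0"
      show "p S \<noteq> 0" unfolding p_def by (rule det_nonzeroI) (use a in \<open>simp only: eqv\<close>)
    qed
  qed
  define U where "U = psd_mats_of_rank (card J) - {S. \<forall>q\<in>{p}. q S = 0}"
  have "zariski_openin (psd_mats_of_rank (card J)) U"
    unfolding zariski_openin_def U_def using \<open>real_polynomial_function p\<close> by (intro exI[of _ "{p}"]) auto
  moreover have "frame_sum J g \<in> U"
  proof -
    have "y = 0" if y: "(\<Sum>l\<in>UNIV. y $ l *\<^sub>R X $ l) ** frame_sum J g = 0" for y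
    proof -
      define Z where "Z = (\<Sum>l\<in>UNIV. y $ l *\<^sub>R X $ l)"
      have symZ: "Z \<in> sym_mats" unfolding Z_def by (intro subspace_sum subspace_scale subspace_sym_mats sym)
      have "(transpose Z ** frame_sum J g) = 0" using y symZ by (simp add: Z_def sym_mats_def)
      then have "frame_sum J g ** Z = 0"
        by (metis (mono_tags) frame_sum_sym matrix_transpose_mul mem_Collect_eq sym_mats_def symZ y Z_def
            transpose_mat mat_0)
      then have "frame_sum J g *v (Z *v x) = 0" for x by (simp add: matrix_vector_mul_assoc)
      then have "column i g \<bullet> (Z *v x) = 0" if "i \<in> J" for i x using that by (simp add: frame_sum_eq_0)
      then have "(chart_matrix \<beta> X g *v y) $ k = 0" for k
        unfolding chart_matrix_mult Z_def[symmetric] using \<beta> by blast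
      then have "chart_matrix \<beta> X g *v y = 0" by (simp add: vec_eq_iff)
      then show "y = 0" using chart by (simp add: det_nonzero_kernel)
    qed
    then have "p (frame_sum J g) \<noteq> 0" unfolding gram by blast
    then show ?thesis by (simp add: U_def psd_mats_of_rank_def frame_sum_psd rank_frame_sum[OF g])
  qed
  moreover have "mle_exists L S" if "S \<in> U" for S
  proof (rule mle_existsI)
    show "subspace L" by (simp add: L(1))
    show "L \<inter> pd_mats \<noteq> {}" by (rule L(2))
    have S: "S \<in> psd_mats" "p S \<noteq> 0" using that by (auto simp: U_def psd_mats_of_rank_def)
    show "S \<in> psd_mats" by (rule S)
    fix K assume K: "K \<in> L" "K \<in> psd_mats" "S ** K = 0"
    have "transpose (S ** K) = K ** S"
      using psd_mats_sym[OF S(1)] psd_mats_sym[OF K(2)] by (simp add: matrix_transpose_mul sym_mats_def)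
    then have KS: "K ** S = 0" using K(3) by (metis mat_0 transpose_mat)
    obtain y where "K = (\<Sum>l\<in>UNIV. y l *\<^sub>R X $ l)"
      using K(1) span_range_sum[of K "($) X"] L(1) by metis
    then have "K = (\<Sum>l\<in>UNIV. (\<chi> l. y l) $ l *\<^sub>R X $ l)" by simp
    moreover then have "(\<chi> l. y l) = 0" using S(2) KS unfolding gram by metis
    ultimately show "K = 0" by simp
  qed
  ultimately show ?thesis by blast
qed

text \<open>The matrices \<open>frame_sum I g\<close> for \<open>g\<close> in a nonempty open set are Zariski dense among the semidefinite matrices of
rank \<open>card I\<close>, because every such matrix has this form for some \<open>g\<close>. None of them has a maximum likelihood estimate.\<close>

lemma open_kernels_no_mle:
  fixes L :: "(real^'n^'n) set"
  assumes L: "subspace L" and N: "open N" "N \<noteq> {}" "\<And>g. g \<in> N \<Longrightarrow> \<exists>K\<in>L. kernel_frame K J g"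
    and J: "J \<noteq> UNIV" and I: "I \<subseteq> J"
  shows "\<not> (\<exists>U. zariski_openin (psd_mats_of_rank (card I)) U \<and> U \<noteq> {} \<and> (\<forall>S\<in>U. mle_exists L S))"
proof
  assume "\<exists>U. zariski_openin (psd_mats_of_rank (card I)) U \<and> U \<noteq> {} \<and> (\<forall>S\<in>U. mle_exists L S)"
  then obtain P S0 where P: "\<And>p. p \<in> P \<Longrightarrow> real_polynomial_function p"
    and S0: "S0 \<in> psd_mats_of_rank (card I) - {x. \<forall>p\<in>P. p x = 0}"
    and mle: "\<And>S. S \<in> psd_mats_of_rank (card I) - {x. \<forall>p\<in>P. p x = 0} \<Longrightarrow> mle_exists L S"
    unfolding zariski_openin_def by blast
  obtain p where p: "p \<in> P" "p S0 \<noteq> 0" using S0 by blast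
  obtain g0 where g0: "S0 = frame_sum I g0"
    using S0 psd_eq_frame_sum[of S0 I] by (auto simp: psd_mats_of_rank_def)
  have pol: "real_polynomial_function (\<lambda>g. p (frame_sum I g))"
    by (rule real_polynomial_function_comp[OF P[OF p(1)] polynomial_function_frame_sum[OF polynomial_function_id]])
  have nz: "p (frame_sum I g0) \<noteq> 0" using p(2) g0 by simp
  obtain g where g: "g \<in> N" and pg: "p (frame_sum I g) \<noteq> 0" "det g \<noteq> 0"
    by (rule exists_invertible_frame_nonzero[OF pol nz N(1,2)], rule that)
  have "frame_sum I g \<in> psd_mats_of_rank (card I)"
    by (simp add: psd_mats_of_rank_def frame_sum_psd rank_frame_sum[OF pg(2)])
  then have "mle_exists L (frame_sum I g)" using mle pg(1) p(1) by blast
  moreover obtain K where K: "K \<in> L" "kernel_frame K J g" using N(3)[OF g] by blast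
  moreover have "K \<noteq> 0"
  proof
    assume "K = 0"
    then have pd: "frame_sum J g \<in> pd_mats" using K(2) by (simp add: kernel_frame_def)
    obtain k where "k \<notin> J" using J by blast
    then obtain x where "x \<noteq> 0" "\<And>i. i \<in> J \<Longrightarrow> column i g \<bullet> x = 0"
      using complement_nontrivial[OF pg(2)] by metis
    moreover then have "frame_sum J g *v x = 0" by (simp add: frame_sum_eq_0)
    ultimately show False using pd by (auto simp: pd_mats_def)
  qed
  moreover have "frame_sum I g ** K = 0"
  proof -
    have psdK: "K \<in> psd_mats" using K(2) by (simp add: kernel_frame_def)
    have "(frame_sum I g ** K) *v x = 0" for x
    proof -
      have "column i g \<bullet> (K *v x) = 0" if "i \<in> I" for i
        using K(2) that I by (simp add: sym_mats_inner[OF psd_mats_sym[OF psdK]] kernel_frame_def subset_iff)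
      then have "frame_sum I g *v (K *v x) = 0" by (simp add: frame_sum_eq_0)
      then show ?thesis by (simp add: matrix_vector_mul_assoc)
    qed
    then show ?thesis by (simp add: matrix_eq)
  qed
  ultimately show False using not_mle_existsI[OF L, of K "frame_sum I g"] by (auto simp: kernel_frame_def)
qed

type_synonym ('m, 'n) pencil_data = "(real^'m) \<times> (real^'m) \<times> (real^'m^'n) \<times> (real^'n)"

text \<open>The pencil condition for matrices of \<open>L\<close> given by their coordinates, as a polynomial in a basis \<open>X\<close> of \<open>L\<close> and in
the frame \<open>g\<close>.\<close>

definition level_polynomial ::
  "('m::finite \<Rightarrow> 'n::finite \<times> 'n) \<Rightarrow> 'n set \<Rightarrow> ('m, 'n) pencil_data \<Rightarrow> real^'n^'n^'m \<Rightarrow> real^'n^'n \<Rightarrow> real" where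
  "level_polynomial \<beta> J d X g = (case d of (\<alpha>, \<kappa>, b, w) \<Rightarrow>
    pencil_polynomial J (chart_elem \<beta> X g \<alpha>, chart_elem \<beta> X g \<kappa>, (\<chi> i. chart_elem \<beta> X g (b $ i)), g, w))"

text \<open>The coordinates with row index in \<open>J\<close> vanish, so that the corresponding elements of \<open>L\<close> vanish on the columns
of the frame in \<open>J\<close>.\<close>

definition supported :: "('m::finite \<Rightarrow> 'n::finite \<times> 'n) \<Rightarrow> 'n set \<Rightarrow> ('m, 'n) pencil_data \<Rightarrow> bool" where
  "supported \<beta> J d \<longleftrightarrow> (case d of (\<alpha>, \<kappa>, b, w) \<Rightarrow>
    \<forall>k. fst (\<beta> k) \<in> J \<longrightarrow> \<alpha> $ k = 0 \<and> \<kappa> $ k = 0 \<and> (\<forall>i. b $ i $ k = 0))"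

lemma polynomial_function_chart_matrix:
  fixes X :: "'z::real_normed_vector \<Rightarrow> real^'n^'n^'m"
  assumes "polynomial_function X" "polynomial_function g"
  shows "polynomial_function (\<lambda>x. chart_matrix \<beta> (X x) (g x))"
  unfolding chart_matrix_def
  apply (rule polynomial_function_vec, rule polynomial_function_vec)
  apply (simp add: inner_vec_def column_def)
  apply (intro polynomial_intros polynomial_function_matrix_vector_mult assms)
  apply (rule polynomial_function_vec)
  apply (simp)
  apply (intro polynomial_intros assms)
  done

lemma polynomial_function_chart_elem:
  fixes X :: "'z::real_normed_vector \<Rightarrow> real^'n^'n^'m"
  assumes "polynomial_function X" "polynomial_function g"
  shows "polynomial_function (\<lambda>x. chart_elem \<beta> (X x) (g x) a)"
  unfolding chart_elem_def
  by (intro polynomial_intros polynomial_function_cramer_vec polynomial_function_chart_matrix assms)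

lemma real_polynomial_function_level:
  fixes X :: "'z::real_normed_vector \<Rightarrow> real^'n^'n^'m"
  assumes "polynomial_function X" "polynomial_function g"
  shows "real_polynomial_function (\<lambda>x. level_polynomial \<beta> J d (X x) (g x))"
proof (cases d)
  case (fields \<alpha> \<kappa> b w)
  have "polynomial_function (\<lambda>x. \<chi> i. chart_elem \<beta> (X x) (g x) (b $ i))"
    by (rule polynomial_function_vec) (simp add: polynomial_function_chart_elem assms)
  then show ?thesis unfolding level_polynomial_def fields prod.case
    by (intro real_polynomial_function_comp[OF pencil_polynomial(1)] polynomial_intros
        polynomial_function_chart_elem assms)
qed

lemma real_polynomial_function_chart_det:
  fixes X :: "'z::real_normed_vector \<Rightarrow> real^'n^'n^'m"
  assumes "polynomial_function X" "polynomial_function g"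
  shows "real_polynomial_function (\<lambda>x. det (chart_matrix \<beta> (X x) (g x)))"
  unfolding real_polynomial_function_eq
  by (intro polynomial_intros polynomial_function_chart_matrix assms)

text \<open>The condition holds at some frame, hence at a dense set of frames, in particular at one in the open set \<open>U\<close>.\<close>

lemma kernel_frame_step:
  fixes L :: "(real^'n^'n) set" and X :: "real^'n^'n^'m"
  assumes L: "subspace L" "L \<subseteq> sym_mats" "\<And>l. X $ l \<in> L" and \<beta>: "covers \<beta> J" and k: "k \<notin> J"
    and U: "open U" "U \<noteq> {}" "\<And>g. g \<in> U \<Longrightarrow> \<exists>K\<in>L. kernel_frame K J g"
    and d: "supported \<beta> J d"
    and nz: "det (chart_matrix \<beta> X g0) \<noteq> 0" "level_polynomial \<beta> J d X g0 \<noteq> 0"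
  shows "\<exists>U. open U \<and> U \<noteq> {} \<and> (\<forall>g'\<in>U. \<exists>K'\<in>L. kernel_frame K' (insert k J) g')"
proof -
  have pol: "real_polynomial_function (\<lambda>g. det (chart_matrix \<beta> X g) * level_polynomial \<beta> J d X g)"
    by (intro real_polynomial_function.intros(4) real_polynomial_function_chart_det
        real_polynomial_function_level polynomial_intros)
  have nz0: "det (chart_matrix \<beta> X g0) * level_polynomial \<beta> J d X g0 \<noteq> 0" using nz by simp
  obtain g where g: "g \<in> U"
      "det (chart_matrix \<beta> X g) * level_polynomial \<beta> J d X g \<noteq> 0" "det g \<noteq> 0"
    by (rule exists_invertible_frame_nonzero[OF pol nz0 U(1,2)], rule that)
  then have nzg: "det (chart_matrix \<beta> X g) \<noteq> 0" "level_polynomial \<beta> J d X g \<noteq> 0" "det g \<noteq> 0"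
    by auto
  obtain K where K: "K \<in> L" "kernel_frame K J g" using U(3)[OF g(1)] by blast
  obtain \<alpha> \<kappa> b w where dd: "d = (\<alpha>, \<kappa>, b, w)" by (cases d)
  have mem: "chart_elem \<beta> X g a \<in> L" for a using L by (intro chart_elem_mem) auto
  have ker: "chart_elem \<beta> X g a *v column i g = 0" if "i \<in> J" "\<And>k. fst (\<beta> k) \<in> J \<Longrightarrow> a $ k = 0" for a i
    using mem[of a] L(2) that by (intro covers_kernel[OF \<beta> nzg(3)]) (auto simp: chart_elem_coordinate)
  show ?thesis
  proof (rule kernel_frame_extend[OF L(1,2) chart_transversal[OF \<beta> nzg(3) L nzg(1)] nzg(3) k K])
    show "pencil_polynomial J (chart_elem \<beta> X g \<alpha>, chart_elem \<beta> X g \<kappa>, (\<chi> i. chart_elem \<beta> X g (b $ i)), g, w) \<noteq> 0"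
      using nzg(2) by (simp add: level_polynomial_def dd)
  qed (use d in \<open>auto simp: mem supported_def dd intro!: ker\<close>)
qed

text \<open>Starting from a positive definite matrix in \<open>L\<close>, the kernel is enlarged one dimension at a time.\<close>

lemma kernel_frames_below_threshold:
  fixes L :: "(real^'n^'n) set" and X :: "real^'n^'n^'m" and ord :: "'n \<Rightarrow> nat"
  assumes L: "subspace L" "L \<subseteq> sym_mats" "\<And>l. X $ l \<in> L" "L \<inter> pd_mats \<noteq> {}"
    and ord: "bij_betw ord UNIV {..<CARD('n)}" and d: "d \<le> CARD('n)"
    and cov: "\<And>j. j \<le> d \<Longrightarrow> covers \<beta> {x. ord x < j}"
    and sup: "\<And>j. j < d \<Longrightarrow> supported \<beta> {x. ord x < j} (par j)"
    and nz: "det (chart_matrix \<beta> X g0) \<noteq> 0" "\<And>j. j < d \<Longrightarrow> level_polynomial \<beta> {x. ord x < j} (par j) X g0 \<noteq> 0"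
  shows "\<exists>U. open U \<and> U \<noteq> {} \<and> (\<forall>g\<in>U. \<exists>K\<in>L. kernel_frame K {x. ord x < d} g)"
proof -
  have "\<exists>U. open U \<and> U \<noteq> {} \<and> (\<forall>g\<in>U. \<exists>K\<in>L. kernel_frame K {x. ord x < j} g)" if "j \<le> d" for j
    using that
  proof (induction j)
    case 0
    obtain K where K: "K \<in> L" "K \<in> pd_mats" using L(4) by blast
    have "kernel_frame K {x. ord x < 0} g" for g
      using K(2) pd_mats_psd[OF K(2)] by (simp add: kernel_frame_def frame_sum_def)
    then show ?case using K(1) by (intro exI[of _ UNIV]) auto
  next
    case (Suc j)
    then obtain U where U: "open U" "U \<noteq> {}" "\<And>g. g \<in> U \<Longrightarrow> \<exists>K\<in>L. kernel_frame K {x. ord x < j} g"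
      by auto
    have "ord ` UNIV = {..<CARD('n)}" using ord by (simp add: bij_betw_def)
    moreover have "j \<in> {..<CARD('n)}" using Suc d by simp
    ultimately obtain k where k: "ord k = j" by (metis imageE)
    have "{x. ord x < Suc j} = insert k {x. ord x < j}"
      using k ord by (auto simp: bij_betw_def less_Suc_eq dest: injD)
    moreover have "k \<notin> {x. ord x < j}" using k by simp
    moreover have j: "j < d" "j \<le> d" using Suc.prems by simp_all
    ultimately show ?case
      using kernel_frame_step[OF L(1-3) cov[OF j(2)] _ U sup[OF j(1)] nz(1) nz(2)[OF j(1)], of k] by simp
  qed
  then show ?thesis by simp
qed

lemma card_below:
  fixes ord :: "'n::finite \<Rightarrow> nat"
  assumes "bij_betw ord UNIV {..<CARD('n)}" "d \<le> CARD('n)"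
  shows "card {x. ord x < d} = d"
proof -
  have "ord ` {x. ord x < d} = {..<d}"
  proof
    show "{..<d} \<subseteq> ord ` {x. ord x < d}"
    proof
      fix i assume "i \<in> {..<d}"
      then have "i \<in> ord ` UNIV" using assms by (auto simp: bij_betw_def)
      then show "i \<in> ord ` {x. ord x < d}" using \<open>i \<in> {..<d}\<close> by auto
    qed
  qed auto
  moreover have "inj_on ord {x. ord x < d}" using assms(1) by (auto simp: bij_betw_def intro: inj_on_subset)
  ultimately show ?thesis by (metis card_image card_lessThan)
qed

theorem theorem3p23:
  fixes n m :: nat
  assumes "CARD('n::finite) = n" and "n \<ge> 1"
    and "CARD('m::finite) = m" and "1 \<le> m" and "m \<le> (n + 1) choose 2"
  shows "\<exists>E :: (real^'n^'n) set set.
    zariski_closed_Gr TYPE('m) E \<and> E \<subset> Gr m \<and>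
    (\<forall>L \<in> Gr m. L \<notin> E \<and> L \<inter> pd_mats \<noteq> {} \<longrightarrow>
       MLT L = (LEAST d. d \<le> n \<and> int m \<le> int n * int d - int (d choose 2)))"
proof -
  have mD: "m \<le> rank_dim CARD('n) CARD('n)" using assms by (simp add: rank_dim_full)
  obtain ord :: "'n \<Rightarrow> nat" and \<beta> :: "'m \<Rightarrow> 'n \<times> 'n"
    where ord: "bij_betw ord UNIV {..<CARD('n)}" and inj: "inj \<beta>"
      and le: "\<And>k. ord (fst (\<beta> k)) \<le> ord (snd (\<beta> k))"
      and range: "\<And>i l. ord i \<le> ord l \<Longrightarrow> (i, l) \<in> range \<beta> \<longleftrightarrow> rank_dim CARD('n) (ord i) + (ord l - ord i) < m"
    using lexicographic_enumeration[where ?'m='m and ?'n='n, OF assms(3)[symmetric] mD] by metis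
  have injord: "inj ord" and ordlt: "\<And>x. ord x < n" using ord assms(1) by (auto simp: bij_betw_def)
  have onto: "\<exists>x. ord x = j" if "j < n" for j
    using ord assms(1) that by (metis (no_types, lifting) bij_betw_def imageE lessThan_iff)
  have swap: "i = l" if "\<beta> k = (i, l)" "\<beta> k' = (l, i)" for k k' i l
    using le[of k] le[of k'] that injord by (auto dest: injD)
  define J where "J j = {x. ord x < j}" for j
  define good where "good d \<longleftrightarrow> d \<le> n \<and> int m \<le> int n * int d - int (d choose 2)" for d
  have good_iff: "good d \<longleftrightarrow> d \<le> n \<and> m \<le> rank_dim n d" for d
    using rank_dim_eq[of d n] by (auto simp: good_def)
  have "good n" using mD assms(1) by (simp add: good_iff)
  define d where "d = (LEAST d. good d)"
  have d: "good d" unfolding d_def using \<open>good n\<close> by (rule LeastI)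
  have least: "d \<le> e" if "good e" for e unfolding d_def using that by (rule Least_le)
  have "d \<noteq> 0" 
  proof
    assume "d = 0"
    with d have "m \<le> rank_dim n 0" by (simp add: good_iff)
    with assms(4) show False by (simp add: rank_dim_def)
  qed
  define c where "c = d - 1"
  have cd: "d = Suc c" "c < n" using \<open>d \<noteq> 0\<close> d by (auto simp: c_def good_iff)
  have "\<not> good c" using least[of c] cd(1) by auto
  then have mc: "rank_dim n c < m" using cd(2) by (simp add: good_iff)
  have cov: "covers \<beta> (J j)" if "j \<le> c" for j
    unfolding covers_def
  proof (intro ballI allI)
    fix i l assume i: "i \<in> J j"
    define x y where "x = (if ord i \<le> ord l then i else l)" and "y = (if ord i \<le> ord l then l else i)"
    have xy: "ord x \<le> ord y" "ord x < j" using i by (auto simp: x_def y_def J_def)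
    have "rank_dim n (ord x) + (ord y - ord x) < rank_dim n (Suc (ord x))"
      using xy ordlt[of y] by (simp add: rank_dim_Suc)
    also have "\<dots> \<le> rank_dim n c" using xy that by (intro rank_dim_mono) simp
    finally have "(x, y) \<in> range \<beta>" using range[OF xy(1)] mc assms(1) by simp
    then obtain k where "\<beta> k = (x, y)" by (metis imageE)
    then have "fst (\<beta> k) \<in> J j \<and> (\<beta> k = (i, l) \<or> \<beta> k = (l, i))"
      using xy(2) by (auto simp: x_def y_def J_def)
    then show "\<exists>k. fst (\<beta> k) \<in> J j \<and> (\<beta> k = (i, l) \<or> \<beta> k = (l, i))" by blast
  qed
  have all: "fst (\<beta> k) \<in> J d" for k
  proof (rule ccontr)
    assume "\<not> ?thesis"
    then have "d \<le> ord (fst (\<beta> k))" by (simp add: J_def)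
    then have "m \<le> rank_dim n (ord (fst (\<beta> k)))" using d rank_dim_mono[of d "ord (fst (\<beta> k))" n] by (simp add: good_iff)
    moreover have "(fst (\<beta> k), snd (\<beta> k)) \<in> range \<beta>" by simp
    ultimately show False using range[OF le[of k]] assms(1) by simp
  qed
  \<comment> \<open>one polynomial for all conditions: the chart, and the pencil condition for each kernel dimension below c = d - 1\<close>
  define \<phi> where "\<phi> g par X = det (chart_matrix \<beta> X g) * (\<Prod>j<c. level_polynomial \<beta> (J j) (par j) X g)"
    for g and par :: "nat \<Rightarrow> ('m, 'n) pencil_data" and X :: "real^'n^'n^'m"
  define \<Phi> where "\<Phi> = {\<phi> g par | g par. \<forall>j<c. supported \<beta> (J j) (par j)}"
  define E where "E = {L \<in> Gr m. \<forall>f\<in>\<Phi>. \<forall>X. (\<forall>k. X $ k \<in> L) \<longrightarrow> f X = 0}"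
  have closed: "zariski_closed_Gr TYPE('m) E"
  proof -
    have "real_polynomial_function (\<phi> g par)" for g par
      unfolding \<phi>_def
      by (intro real_polynomial_function.intros(4) real_polynomial_function_prod
          real_polynomial_function_chart_det real_polynomial_function_level polynomial_intros) auto
    then show ?thesis
      unfolding E_def using zariski_closed_Gr_vanishing_on_tuples[where ?'m='m and ?'n='n, of \<Phi>] assms(3)
      by (auto simp: \<Phi>_def)
  qed
  have proper: "E \<noteq> Gr m"
  proof -
    have wit: "\<exists>X par. (\<forall>l. X $ l \<in> sym_mats) \<and> det (chart_matrix \<beta> X (mat 1)) \<noteq> 0 \<and>
      supported \<beta> (J j) par \<and> level_polynomial \<beta> (J j) par X (mat 1) \<noteq> 0" if j: "j < c" for j
    proof -
      \<comment> \<open>m exceeds the number of positions in the rows up to j < c, so row j is selected completely, and so is the next diagonal position\<close>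
      obtain i0 where i0: "ord i0 = j" using onto j cd(2) by (meson less_trans)
      obtain i1 where i1: "ord i1 = Suc j" using onto j cd(2) by (meson less_le_trans Suc_leI less_trans le_less_trans)
      have "\<exists>X \<alpha> \<kappa> b w. (\<forall>l. X $ l \<in> sym_mats) \<and> det (chart_matrix \<beta> X (mat 1)) \<noteq> 0 \<and>
        (\<forall>k. fst (\<beta> k) \<in> J j \<longrightarrow> \<alpha> $ k = 0 \<and> \<kappa> $ k = 0 \<and> (\<forall>i. b $ i $ k = 0)) \<and>
        pencil_polynomial (J j) (chart_elem \<beta> X (mat 1) \<alpha>, chart_elem \<beta> X (mat 1) \<kappa>,
          (\<chi> i. chart_elem \<beta> X (mat 1) (b $ i)), mat 1, w) \<noteq> 0"
      proof (rule pencil_witness[OF inj swap])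
        show "i0 \<notin> J j" "i1 \<notin> J j" "i1 \<noteq> i0" using i0 i1 by (auto simp: J_def)
        show "(i0, l) \<in> range \<beta>" if "l \<notin> J j" for l
        proof -
          have "ord i0 \<le> ord l" using that i0 by (simp add: J_def)
          moreover have "rank_dim n j + (ord l - j) < rank_dim n (Suc j)"
            using ordlt[of l] j cd(2) by (simp add: rank_dim_Suc)
          moreover have "rank_dim n (Suc j) \<le> rank_dim n c" using j by (intro rank_dim_mono) simp
          ultimately show ?thesis using range[of i0 l] mc assms(1) i0 by simp
        qed
        have "rank_dim n (Suc j) \<le> rank_dim n c" using j by (intro rank_dim_mono) simp
        then show "(i1, i1) \<in> range \<beta>" using range[of i1 i1] mc assms(1) i1 by simp
      qed
      then obtain X \<alpha> \<kappa> b w where "\<forall>l. X $ l \<in> sym_mats" "det (chart_matrix \<beta> X (mat 1)) \<noteq> 0"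
        "supported \<beta> (J j) (\<alpha>, \<kappa>, b, w)" "level_polynomial \<beta> (J j) (\<alpha>, \<kappa>, b, w) X (mat 1) \<noteq> 0"
        unfolding supported_def level_polynomial_def prod.case by blast
      then show ?thesis by blast
    qed
    then have "\<forall>j. \<exists>X par. j < c \<longrightarrow> (\<forall>l. X $ l \<in> sym_mats) \<and> det (chart_matrix \<beta> X (mat 1)) \<noteq> 0 \<and>
      supported \<beta> (J j) par \<and> level_polynomial \<beta> (J j) par X (mat 1) \<noteq> 0" by blast
    then obtain XX par where XX: "\<And>j. j < c \<Longrightarrow> (\<forall>l. XX j $ l \<in> sym_mats) \<and>
      supported \<beta> (J j) (par j) \<and> level_polynomial \<beta> (J j) (par j) (XX j) (mat 1) \<noteq> 0"
      by metis
    \<comment> \<open>a tuple for the chart condition alone, which is the only one when c = 0\<close>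
    define X0 :: "real^'n^'n^'m" where
      "X0 = (\<chi> k. \<chi> a b. if \<beta> k = (a, b) \<or> \<beta> k = (b, a) then 1 else 0)"
    have X0: "\<forall>l. X0 $ l \<in> sym_mats" by (auto simp: X0_def intro!: sym_matsI)
    have "X0 $ l $ fst (\<beta> k) $ snd (\<beta> k) = (if k = l then 1 else 0)" for k l
      using swap[of l "snd (\<beta> k)" "fst (\<beta> k)" k] injD[OF inj, of k l] by (auto simp: X0_def prod_eq_iff)
    then have "chart_matrix \<beta> X0 (mat 1) = mat 1"
      unfolding chart_matrix_mat1 by (simp add: vec_eq_iff mat_def)
    then have detX0: "det (chart_matrix \<beta> X0 (mat 1)) \<noteq> 0" by simp
    \<comment> \<open>each condition has its own witness; irreducibility of the space of symmetric tuples provides a common one\<close>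
    define V where "V = {X :: real^'n^'n^'m. \<forall>l. X $ l \<in> sym_mats}"
    define P where "P j X = (if j < c then level_polynomial \<beta> (J j) (par j) X (mat 1) else det (chart_matrix \<beta> X (mat 1)))"
      for j X
    have "\<exists>X\<in>V. \<forall>j\<in>{..c}. P j X \<noteq> 0"
    proof (rule polynomials_common_nonzero)
      show "V \<noteq> {}" using X0 by (auto simp: V_def)
      show "y + t *\<^sub>R (x - y) \<in> V" if "x \<in> V" "y \<in> V" for x y t
        using that by (auto simp: V_def intro!: subspace_add subspace_scale subspace_diff subspace_sym_mats)
      show "real_polynomial_function (P j)" for j
        unfolding P_def
        by (cases "j < c"; simp; intro real_polynomial_function_chart_det real_polynomial_function_level polynomial_intros)
      show "\<exists>X\<in>V. P j X \<noteq> 0" for j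
        using XX[of j] X0 detX0 by (cases "j < c") (auto simp: P_def V_def)
    qed simp
    then obtain X where X: "\<And>l. X $ l \<in> sym_mats" "\<And>j. j \<le> c \<Longrightarrow> P j X \<noteq> 0" by (auto simp: V_def)
    have detX: "det (chart_matrix \<beta> X (mat 1)) \<noteq> 0" using X(2)[of c] by (simp add: P_def)
    have ind: "inj (($) X)" "independent (range (($) X))"
      using chart_independent[OF detX] by auto
    define L where "L = span (range (($) X))"
    have "dim L = card (range (($) X))" unfolding L_def using ind(2) by (rule dim_span_eq_card_independent)
    also have "\<dots> = m" using ind(1) assms(3) by (simp add: card_image)
    finally have "dim L = m" .
    moreover have "L \<subseteq> sym_mats"
      unfolding L_def by (rule span_minimal[OF _ subspace_sym_mats]) (use X(1) in blast)
    ultimately have "L \<in> Gr m" by (simp add: Gr_def L_def)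
    moreover have "level_polynomial \<beta> (J j) (par j) X (mat 1) \<noteq> 0" if "j < c" for j
      using X(2)[of j] that by (simp add: P_def)
    then have "\<phi> (mat 1) par X \<noteq> 0" using detX by (simp add: \<phi>_def)
    moreover have "\<phi> (mat 1) par \<in> \<Phi>" using XX by (auto simp: \<Phi>_def)
    moreover have "X $ k \<in> L" for k by (simp add: L_def span_base)
    ultimately have "L \<in> Gr m" "L \<notin> E" unfolding E_def by blast+
    then show ?thesis by blast
  qed
  have MLT: "MLT L = d" if L: "L \<in> Gr m" "L \<notin> E" "L \<inter> pd_mats \<noteq> {}" for L
  proof -
    have sub: "subspace L" "L \<subseteq> sym_mats" "dim L = m" using L(1) by (auto simp: Gr_def)
    obtain g0 par X where par: "\<And>j. j < c \<Longrightarrow> supported \<beta> (J j) (par j)"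
      and X: "\<And>k. X $ k \<in> L" and nz: "\<phi> g0 par X \<noteq> 0"
      using L(1,2) unfolding E_def \<Phi>_def by blast
    have nz1: "det (chart_matrix \<beta> X g0) \<noteq> 0" and nz2: "\<And>j. j < c \<Longrightarrow> level_polynomial \<beta> (J j) (par j) X g0 \<noteq> 0"
      using nz by (auto simp: \<phi>_def)
    have symX: "X $ k \<in> sym_mats" for k using X sub(2) by blast
    obtain g where g: "det (chart_matrix \<beta> X g) \<noteq> 0" "det g \<noteq> 0"
      by (rule exists_invertible_frame_nonzero[OF
            real_polynomial_function_chart_det[OF polynomial_function_const polynomial_function_id]
            nz1 open_UNIV UNIV_not_empty], rule that)
    have ind: "inj (($) X)" "independent (range (($) X))"
      using chart_independent[OF g(1)] by auto
    have "card (range (($) X)) = dim L" using ind(1) assms(3) sub(3) by (simp add: card_image)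
    then have Lspan: "L = span (range (($) X))"
      using ind(2) X sub(1) card_eq_dim[of "range (($) X)" L] span_minimal[of "range (($) X)" L]
      by (auto intro: independent_imp_finite)
    have upper: "\<exists>U. zariski_openin (psd_mats_of_rank d) U \<and> U \<noteq> {} \<and> (\<forall>S\<in>U. mle_exists L S)"
      using generic_rank_mle_exists[OF Lspan L(3) g(2,1) all symX]
        card_below[OF ord, of d] d assms(1) by (simp add: J_def good_iff)
    have lower: "d \<le> e"
      if e: "e \<le> CARD('n)" "\<exists>U. zariski_openin (psd_mats_of_rank e) U \<and> U \<noteq> {} \<and> (\<forall>S\<in>U. mle_exists L S)" for e
    proof (rule ccontr)
      assume "\<not> d \<le> e"
      then have ec: "e \<le> c" using cd(1) by simp
      have cn: "c \<le> CARD('n)" using cd(2) assms(1) by simp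
      have "\<exists>U. open U \<and> U \<noteq> {} \<and> (\<forall>g\<in>U. \<exists>K\<in>L. kernel_frame K (J c) g)"
        unfolding J_def
        by (rule kernel_frames_below_threshold[OF sub(1,2) X L(3) ord cn cov[unfolded J_def]
              par[unfolded J_def] nz1 nz2[unfolded J_def]])
      then obtain U where U: "open U" "U \<noteq> {}" "\<forall>g\<in>U. \<exists>K\<in>L. kernel_frame K (J c) g" by blast
      obtain x where "ord x = c" using onto cd(2) by blast
      then have "x \<notin> J c" by (simp add: J_def)
      then have "J c \<noteq> UNIV" by blast
      moreover have "J e \<subseteq> J c" using ec by (auto simp: J_def)
      ultimately show False
        using open_kernels_no_mle[OF sub(1) U(1,2) bspec[OF U(3)], of "J e"] e(2) card_below[OF ord e(1)] by (simp add: J_def)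
    qed
    show ?thesis
      unfolding MLT_def using upper lower d assms(1) by (intro Least_equality) (auto simp: good_iff)
  qed
  have "E \<subset> Gr m" using proper by (auto simp: E_def)
  moreover have "d = (LEAST d. d \<le> n \<and> int m \<le> int n * int d - int (d choose 2))"
    by (simp add: d_def good_def)
  ultimately show ?thesis using closed MLT by blast
qed

end
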